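(* For each $r\in\mathbb N$ let $(d_r^{(n)})_{n}$ be a sequence of positive integers such that \[d_r^{(n)}=rn\ln\ln n+o(n)\quad\text{as }n\to\infty,\] where the $o(n)$ term may differ for different $r$. Let $(G_r,r\in\mathbb N)$ be a random element of $\mathbb R^\infty$ with probability generating function \[\mathbb E\Bigl(\prod_{r=1}^\infty u_r^{G_r}\Bigr)=\Bigl(\mathrm e-\sum_{r=1}^\infty\frac{u_r}{r!}\Bigr)^{-1},\quad (u_r,r\in\mathbb N)\in[0,1]^\infty.\] Equivalently, $(G_r,r\in\mathbb N)$ may be defined as the random sequence $\bigl(N_r(E/r!),r\in\mathbb N\bigr)$, where $E\sim\mathsf{Exp}(1)$ and $N_r$, $r\in\mathbb N$, are unit-rate Poisson counting processes, independent of each other and of $E$. Then \[\bigl(\hat U_r^{(n)},r\in\mathbb N\bigr)\xrightarrow{d}(G_r,r\in\mathbb N)\quad\text{in }\mathbb R^{\infty}\text{ as }n\to\infty.\]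
   Context: Extended coupon collector's problem. For each $n\in\mathbb N$, coupons arrive one by one at times $1,2,3,\ldots$; the types of the coupons are independent and uniformly distributed on $\{1,\ldots,n\}$. For $i\in\{1,\ldots,n\}$ and $r\in\mathbb N_0=\mathbb N\cup\{0\}$, let $Y_{i,r}^{(n)}$ be the arrival time of the $(r+1)$-th coupon of type $i$ (this is when the collector labelled $r$ receives a coupon of type $i$). Let $T_0^{(n)}=\max_{j\le n}Y_{j,0}^{(n)}$ be the time when collector $0$ completes his collection. For $r\in\mathbb N$ and given $d_r^{(n)}\in\mathbb N$, let \[\hat U_r^{(n)}=\operatorname{card}\bigl\{i\in\{1,\ldots,n\}\colon Y_{i,r}^{(n)}>\max_{1\le j\le n}Y_{j,0}^{(n)}+d_r^{(n)}\bigr\},\] the number of empty spots in the album of the $r$-th collector at time $T_0^{(n)}+d_r^{(n)}$. $\xrightarrow{d}$ denotes convergence in distribution, and $\mathbb R^\infty$ is the space of real sequences with the product topology. *)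

theory Defs
  imports "HOL-Probability.Probability" "HOL-Library.Landau_Symbols" "HOL-Library.Extended_Nat"
begin

section \<open>The coupon collector model\<close>

text \<open>\<open>C t\<close> is the type of the coupon that arrives at time \<open>t \<ge> 1\<close>; the value \<open>C 0\<close> is never used.\<close>

definition coupon_sequence :: "'a measure \<Rightarrow> nat \<Rightarrow> (nat \<Rightarrow> 'a \<Rightarrow> nat) \<Rightarrow> bool" where
  "coupon_sequence M n C \<longleftrightarrow>
     prob_space M \<and>
     prob_space.indep_vars M (\<lambda>_. count_space UNIV) C {1..} \<and>
     (\<forall>t\<ge>1. distr M (count_space UNIV) (C t) = measure_pmf (pmf_of_set {1..n}))"

text \<open>On the null event that fewer than \<open>r + 1\<close> coupons of type \<open>i\<close> ever arrive, the infimum below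
  is taken over the empty set, so the arrival time is \<open>\<infinity>\<close>.\<close>

definition arrival_time :: "(nat \<Rightarrow> 'a \<Rightarrow> nat) \<Rightarrow> nat \<Rightarrow> nat \<Rightarrow> 'a \<Rightarrow> enat" where
  "arrival_time C i r \<omega> =
     Inf (enat ` {t. 1 \<le> t \<and> C t \<omega> = i \<and> card {s \<in> {1..t}. C s \<omega> = i} = r + 1})"

definition completion_time :: "nat \<Rightarrow> (nat \<Rightarrow> 'a \<Rightarrow> nat) \<Rightarrow> 'a \<Rightarrow> enat" where
  "completion_time n C \<omega> = Max ((\<lambda>j. arrival_time C j 0 \<omega>) ` {1..n})"

definition empty_spots :: "nat \<Rightarrow> (nat \<Rightarrow> 'a \<Rightarrow> nat) \<Rightarrow> nat \<Rightarrow> nat \<Rightarrow> 'a \<Rightarrow> nat" where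
  "empty_spots n C r d \<omega> =
     card {i \<in> {1..n}. arrival_time C i r \<omega> > completion_time n C \<omega> + enat d}"

section \<open>Convergence in distribution\<close>

text \<open>For random elements \<open>X n\<close> (on possibly different probability spaces) of a topological space.
  Measurability is only required eventually, as a sequence may start at index \<open>1\<close>.\<close>

definition converges_in_distribution ::
  "(nat \<Rightarrow> 'a measure) \<Rightarrow> (nat \<Rightarrow> 'a \<Rightarrow> 'c::topological_space) \<Rightarrow> 'b measure \<Rightarrow> ('b \<Rightarrow> 'c) \<Rightarrow> bool" where
  "converges_in_distribution M X L Z \<longleftrightarrow>
     (\<forall>\<^sub>F n in sequentially. X n \<in> borel_measurable (M n)) \<and>
     Z \<in> borel_measurable L \<and>
     (\<forall>f :: 'c \<Rightarrow> real. continuous_on UNIV f \<longrightarrow> bounded (range f) \<longrightarrow>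
        (\<lambda>n. \<integral>\<omega>. f (X n \<omega>) \<partial>M n) \<longlonglongrightarrow> (\<integral>\<omega>. f (Z \<omega>) \<partial>L))"

text \<open>Families indexed by \<open>r \<in> {1, 2, \<dots>}\<close> become points of \<open>\<real>\<^sup>\<infinity>\<close>, i.e. of
  \<open>nat \<Rightarrow> real\<close> (whose topology is the product topology), with coordinate \<open>k\<close> holding the
  entry for \<open>r = k + 1\<close>.\<close>

definition real_seq :: "(nat \<Rightarrow> 'a \<Rightarrow> nat) \<Rightarrow> 'a \<Rightarrow> (nat \<Rightarrow> real)" where
  "real_seq V \<omega> = (\<lambda>k. real (V (Suc k) \<omega>))"

section \<open>The limiting random sequence\<close>

text \<open>The infinite product is the limit of the (decreasing) partial products.  The library's
  \<open>prodinf\<close> is unsuitable, since it does not assign the value \<open>0\<close> to a product of nonzero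
  factors whose partial products tend to \<open>0\<close>.\<close>

definition joint_pgf :: "'b measure \<Rightarrow> (nat \<Rightarrow> 'b \<Rightarrow> nat) \<Rightarrow> (nat \<Rightarrow> real) \<Rightarrow> real" where
  "joint_pgf L G u = (\<integral>\<omega>. lim (\<lambda>m. \<Prod>r = 1..m. u r ^ G r \<omega>) \<partial>L)"

definition has_limit_pgf :: "'b measure \<Rightarrow> (nat \<Rightarrow> 'b \<Rightarrow> nat) \<Rightarrow> bool" where
  "has_limit_pgf L G \<longleftrightarrow>
     (\<forall>u. (\<forall>r\<ge>1. 0 \<le> u r \<and> u r \<le> 1) \<longrightarrow>
        joint_pgf L G u = inverse (exp 1 - (\<Sum>k. u (Suc k) / fact (Suc k))))"

text \<open>\<open>N t\<close> is the value of the process at time \<open>t \<ge> 0\<close>.  The subtractions on \<open>nat\<close> do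
  not truncate, because paths are nondecreasing.\<close>

definition unit_poisson_process :: "'c measure \<Rightarrow> (real \<Rightarrow> 'c \<Rightarrow> nat) \<Rightarrow> bool" where
  "unit_poisson_process P N \<longleftrightarrow>
     (\<forall>t\<ge>0. N t \<in> measurable P (count_space UNIV)) \<and>
     (\<forall>\<omega>\<in>space P. N 0 \<omega> = 0 \<and> mono_on {0..} (\<lambda>t. N t \<omega>) \<and>
        (\<forall>t\<ge>0. continuous (at_right t) (\<lambda>s. real (N s \<omega>)))) \<and>
     (\<forall>s t. 0 \<le> s \<and> s < t \<longrightarrow>
        distr P (count_space UNIV) (\<lambda>\<omega>. N t \<omega> - N s \<omega>) = measure_pmf (poisson_pmf (t - s))) \<and>
     (\<forall>(\<tau> :: nat \<Rightarrow> real) m. 0 \<le> \<tau> 0 \<and> mono \<tau> \<longrightarrow>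
        prob_space.indep_vars P (\<lambda>_. count_space UNIV)
          (\<lambda>i \<omega>. N (\<tau> (Suc i)) \<omega> - N (\<tau> i) \<omega>) {..<m})"

text \<open>Independence of \<open>E\<close> and the processes \<open>N r\<close>, \<open>r \<ge> 1\<close>, is independence of the generated
  sigma-algebras; index \<open>0\<close> stands for \<open>E\<close>.  As the processes are only meaningful at
  nonnegative times, \<open>E\<close> is required to be nonnegative everywhere.\<close>

definition exp_poisson_model :: "'c measure \<Rightarrow> ('c \<Rightarrow> real) \<Rightarrow> (nat \<Rightarrow> real \<Rightarrow> 'c \<Rightarrow> nat) \<Rightarrow> bool" where
  "exp_poisson_model P E N \<longleftrightarrow>
     prob_space P \<and>
     distributed P lborel E (exponential_density 1) \<and>
     (\<forall>\<omega>\<in>space P. 0 \<le> E \<omega>) \<and>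
     (\<forall>r\<ge>1. unit_poisson_process P (N r)) \<and>
     prob_space.indep_sets P
       (\<lambda>r. if r = 0 then sets (vimage_algebra (space P) E borel)
            else sets (vimage_algebra (space P) (\<lambda>\<omega>. \<lambda>t\<in>{0..}. N r t \<omega>)
                         (Pi\<^sub>M {0..} (\<lambda>_. count_space UNIV))))
       UNIV"

end

theory Submission
  imports Defs "HOL-Real_Asymp.Real_Asymp"
begin

text \<open>Let \<open>N\<^sub>i(t)\<close> be the number of coupons of type \<open>i\<close> among the first \<open>t\<close> coupons.  The album of collector \<open>r\<close>
misses type \<open>i\<close> at time \<open>t\<close> iff \<open>N\<^sub>i(t) \<le> r\<close>; let \<open>Z\<^sub>r(t)\<close> be the number of such \<^emph>\<open>scarce\<close> types.  Then
collector \<open>0\<close> finishes at the first time \<open>T\<close> with \<open>Z\<^sub>0(T) = 0\<close>, and the number of empty spots of collector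
\<open>r\<close> is \<open>Z\<^sub>r(T + d\<^sub>r)\<close>.

\<^bold>\<open>Deterministic times.\<close>  Consider times \<open>t\<^sub>r = n ln n + r n ln (ln n) + \<sigma>\<^sub>r n + o(n)\<close> for \<open>r = 0, \<dots>, R\<close>.
The counts \<open>Z\<^sub>0(t\<^sub>0), \<dots>, Z\<^sub>R(t\<^sub>R)\<close> are asymptotically independent Poisson variables with means
\<open>exp (- \<sigma>\<^sub>r) / r!\<close> (\<open>scarce_types_pgf_limit\<close>).  The gaps between these times have order \<open>n ln (ln n)\<close>, which is
short compared with \<open>n ln n\<close>.  Hence a type that is scarce for collector \<open>r\<close> at time \<open>t\<^sub>r\<close> has, up to an error of
vanishing probability, obtained exactly \<open>r\<close> coupons before \<open>t\<^sub>0\<close> and none between \<open>t\<^sub>0\<close> and \<open>t\<^sub>r\<close>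
(\<open>late_hits_negligible\<close>).  For different \<open>r\<close> these events are disjoint, and for finitely many types their joint
probability is an explicit multinomial expression, which factorises asymptotically
(\<open>avg_prod_early_weight_bounds\<close>).  So the factorial moments converge, and the Bonferroni inequalities turn this
into convergence of the generating functions.

\<^bold>\<open>The random time.\<close>  The event \<open>T \<le> s\<close> says that \<open>Z\<^sub>0(s) = 0\<close>, and its indicator is \<open>u\<^sub>0 ^ Z\<^sub>0(s)\<close> for
\<open>u\<^sub>0 = 0\<close>.  If \<open>s < T \<le> s'\<close>, then \<open>Z\<^sub>r(T + d\<^sub>r)\<close> lies between \<open>Z\<^sub>r(s' + d\<^sub>r)\<close> and \<open>Z\<^sub>r(s + d\<^sub>r)\<close>.  Summing over
a grid \<open>s = n ln n + \<sigma> n\<close> on which the limiting probability \<open>x = exp (- exp (- \<sigma>))\<close> of \<open>T \<le> s\<close> takes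
equidistant values, the bounds for the generating function become Riemann sums for the integral of \<open>x\<^sup>c\<close> over
\<open>{0..1}\<close>, where \<open>c\<close> is the sum of \<open>(1 - u\<^sub>r) / r!\<close>.  Its value \<open>1 / (1 + c)\<close> is the generating function of the
limit (\<open>empty_spots_pgf_limit\<close>).

\<^bold>\<open>From generating functions to laws.\<close>  The indicator of a point of the natural numbers is a uniform limit of
polynomials in \<open>2 ^ (- x)\<close>.  Therefore finite-dimensional generating functions determine, also in the limit, the
probabilities of finite initial segments.  A nonnegative continuous function of a sequence of natural numbers
is an increasing limit of functions of initial segments, which gives convergence in distribution.

\<^bold>\<open>The mixed Poisson sequence.\<close>  Replacing the exponential time by a dyadic approximation from above makes
conditioning on it elementary; right-continuity of the paths recovers the generating function \<open>1 / (1 + c)\<close>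
(\<open>finite_pgf\<close>).\<close>

section \<open>Averages over coupon sequences\<close>

definition paths :: "nat \<Rightarrow> nat \<Rightarrow> (nat \<Rightarrow> nat) set" where
  "paths n T = {1..T} \<rightarrow>\<^sub>E {1..n}"

text \<open>Everything that happens up to a fixed time is a function of finitely many independent uniform coupons, so its
expectation is a finite average.  Working with such averages removes all measurability and integrability
conditions from the combinatorial part.\<close>

definition avg :: "nat \<Rightarrow> nat \<Rightarrow> ((nat \<Rightarrow> nat) \<Rightarrow> real) \<Rightarrow> real" where
  "avg n T \<Phi> = (\<Sum>c\<in>paths n T. \<Phi> c) / real n ^ T"

abbreviation freq :: "nat \<Rightarrow> nat \<Rightarrow> ((nat \<Rightarrow> nat) \<Rightarrow> bool) \<Rightarrow> real" where
  "freq n T Q \<equiv> avg n T (\<lambda>c. of_bool (Q c))"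

definition hits :: "(nat \<Rightarrow> nat) \<Rightarrow> nat \<Rightarrow> nat \<Rightarrow> nat" where
  "hits c i t = card {s \<in> {1..t}. c s = i}"

lemma finite_paths [simp]: "finite (paths n T)"
  by (simp add: paths_def finite_PiE)

lemma paths_mem: "c \<in> paths n T \<Longrightarrow> s \<in> {1..T} \<Longrightarrow> c s \<in> {1..n}"
  unfolding paths_def by (rule PiE_mem)

lemma card_paths: "card (paths n T) = n ^ T"
  by (simp add: paths_def card_PiE)

lemma avg_add: "avg n T (\<lambda>c. \<Phi> c + \<Psi> c) = avg n T \<Phi> + avg n T \<Psi>"
  by (simp add: avg_def sum.distrib add_divide_distrib)

lemma avg_diff: "avg n T (\<lambda>c. \<Phi> c - \<Psi> c) = avg n T \<Phi> - avg n T \<Psi>"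
  by (simp add: avg_def sum_subtractf diff_divide_distrib)

lemma avg_cmult: "avg n T (\<lambda>c. a * \<Phi> c) = a * avg n T \<Phi>"
  by (simp add: avg_def sum_distrib_left)

lemma avg_sum: "avg n T (\<lambda>c. \<Sum>i\<in>I. \<Phi> i c) = (\<Sum>i\<in>I. avg n T (\<Phi> i))"
  unfolding avg_def by (subst sum.swap) (simp add: sum_divide_distrib)

lemma avg_mono: "(\<And>c. c \<in> paths n T \<Longrightarrow> \<Phi> c \<le> \<Psi> c) \<Longrightarrow> avg n T \<Phi> \<le> avg n T \<Psi>"
  unfolding avg_def by (intro divide_right_mono sum_mono) auto

lemma avg_cong: "(\<And>c. c \<in> paths n T \<Longrightarrow> \<Phi> c = \<Psi> c) \<Longrightarrow> avg n T \<Phi> = avg n T \<Psi>"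
  unfolding avg_def by (simp cong: sum.cong)

lemma avg_const: "n \<ge> 1 \<Longrightarrow> avg n T (\<lambda>_. a) = a"
  by (simp add: avg_def card_paths)

lemma hits_0 [simp]: "hits c i 0 = 0"
  by (simp add: hits_def)

lemma hits_Suc: "hits c i (Suc t) = hits c i t + of_bool (c (Suc t) = i)"
proof -
  have *: "{s \<in> {1..Suc t}. c s = i} = {s \<in> {1..t}. c s = i} \<union> (if c (Suc t) = i then {Suc t} else {})"
    by (auto simp: le_Suc_eq)
  show ?thesis unfolding hits_def * by (auto simp: card_insert_if)
qed

lemma hits_mono: "s \<le> t \<Longrightarrow> hits c i s \<le> hits c i t"
  unfolding hits_def by (intro card_mono) auto

lemma hits_update: "s > t \<Longrightarrow> hits (c(s := j)) i t = hits c i t"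
  unfolding hits_def by (rule arg_cong[where f=card]) auto

text \<open>The independence of one coupon from all others, in the form that drives the recursions over time below.\<close>

lemma freq_independent_coordinate:
  assumes s: "s \<in> {1..T}" and n: "n \<ge> 1" and S: "S \<subseteq> {1..n}"
    and Q: "\<And>c j. Q (c(s := j)) = Q c"
  shows "freq n T (\<lambda>c. Q c \<and> c s \<in> S) = real (card S) / real n * freq n T Q"
proof -
  let ?P = "({1..T} - {s}) \<rightarrow>\<^sub>E {1..n}"
  have ins: "{1..T} = insert s ({1..T} - {s})" using s by auto
  have inj: "inj_on (\<lambda>(y, g). g(s := y)) ({1..n} \<times> ?P)"
    using inj_combinator[of s "{1..T} - {s}" "\<lambda>_. {1..n}"] by auto
  have eq: "paths n T = (\<lambda>(y, g). g(s := y)) ` ({1..n} \<times> ?P)"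
    unfolding paths_def by (subst ins) (rule PiE_insert_eq)
  have split: "(\<Sum>c\<in>paths n T. \<Phi> c) = (\<Sum>y\<in>{1..n}. \<Sum>g\<in>?P. \<Phi> (g(s := y)))"
    for \<Phi> :: "(nat \<Rightarrow> nat) \<Rightarrow> real"
    unfolding eq by (subst sum.reindex[OF inj]) (simp add: sum.cartesian_product case_prod_beta)
  let ?q = "(\<Sum>g\<in>?P. of_bool (Q g)) :: real"
  have 1: "(\<Sum>c\<in>paths n T. of_bool (Q c)) = real n * ?q"
    by (simp add: split Q)
  have "(\<Sum>c\<in>paths n T. of_bool (Q c \<and> c s \<in> S)) = (\<Sum>y\<in>{1..n}. of_bool (y \<in> S) * ?q)"
    by (simp add: split Q of_bool_conj sum_distrib_left mult.commute)
  also have "\<dots> = (\<Sum>y\<in>{1..n}. of_bool (y \<in> S)) * ?q"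
    by (simp add: sum_distrib_right)
  also have "(\<Sum>y\<in>{1..n}. of_bool (y \<in> S)) = real (card S)"
    using S by (simp add: of_bool_def sum.If_cases Int_absorb1)
  finally show ?thesis using n unfolding avg_def by (simp add: 1)
qed

section \<open>Prescribed numbers of coupons of given types\<close>

text \<open>The multinomial distribution of the numbers of coupons of the types in \<open>A\<close>.  The proof conditions on coupon
\<open>t + 1\<close>: either its type is outside \<open>A\<close>, or it is some \<open>i \<in> A\<close> and the first \<open>t\<close> coupons must provide
\<open>\<rho> i - 1\<close> of them.  The resulting recursion reduces to Pascal's rule because the factors \<open>\<rho> i\<close>
add up to the total number of prescribed coupons.\<close>

lemma freq_hits:
  assumes n: "n \<ge> 1" and A: "A \<subseteq> {1..n}" and "t \<le> T"
  shows "freq n T (\<lambda>c. \<forall>i\<in>A. hits c i t = \<rho> i) =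
    fact (\<Sum>i\<in>A. \<rho> i) * real (t choose (\<Sum>i\<in>A. \<rho> i)) / (\<Prod>i\<in>A. fact (\<rho> i)) / real n ^ (\<Sum>i\<in>A. \<rho> i) *
    (1 - real (card A) / real n) ^ (t - (\<Sum>i\<in>A. \<rho> i))"
  using \<open>t \<le> T\<close>
proof (induction t arbitrary: \<rho>)
  case 0
  have fin: "finite A" using A finite_subset by blast
  show ?case
  proof (cases "\<forall>i\<in>A. \<rho> i = 0")
    case True
    then have "(\<Sum>i\<in>A. \<rho> i) = 0" "(\<Prod>i\<in>A. fact (\<rho> i)) = (1::real)"
      by simp_all
    then show ?thesis using True n by (simp add: avg_const)
  next
    case False
    then have m: "(\<Sum>i\<in>A. \<rho> i) > 0" using fin by (metis gr0I sum_eq_0_iff)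
    have "freq n T (\<lambda>c. \<forall>i\<in>A. hits c i 0 = \<rho> i) = avg n T (\<lambda>_. 0)"
      using False by (intro avg_cong) auto
    then show ?thesis using m n by (simp add: avg_const binomial_eq_0)
  qed
next
  case (Suc t)
  have fin: "finite A" using A finite_subset by blast
  define m where "m = (\<Sum>i\<in>A. \<rho> i)"
  define F where "F = (\<Prod>i\<in>A. fact (\<rho> i) :: real)"
  define q where "q = 1 - real (card A) / real n"
  define ff where "ff t m = fact m * real (t choose m)" for t m :: nat
  have F0: "F \<noteq> 0" unfolding F_def using fin by simp
  let ?H = "\<lambda>\<rho> c. \<forall>i\<in>A. hits c i t = \<rho> i"
  have inv: "?H \<rho>' (c(Suc t := j)) = ?H \<rho>' c" for \<rho>' c j by (simp add: hits_update)
  have "freq n T (\<lambda>c. \<forall>i\<in>A. hits c i (Suc t) = \<rho> i) =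
     avg n T (\<lambda>c. (\<Sum>i\<in>A. of_bool (\<rho> i > 0) * of_bool (?H (\<rho>(i := \<rho> i - 1)) c \<and> c (Suc t) \<in> {i}))
        + of_bool (?H \<rho> c \<and> c (Suc t) \<in> {1..n} - A))"
  proof (rule avg_cong)
    fix c assume c: "c \<in> paths n T"
    have cS: "c (Suc t) \<in> {1..n}" using Suc.prems by (intro paths_mem[OF c]) auto
    show "of_bool (\<forall>i\<in>A. hits c i (Suc t) = \<rho> i) = (\<Sum>i\<in>A. of_bool (\<rho> i > 0) * of_bool (?H (\<rho>(i := \<rho> i - 1)) c \<and> c (Suc t) \<in> {i}))
        + (of_bool (?H \<rho> c \<and> c (Suc t) \<in> {1..n} - A) :: real)"
    proof (cases "c (Suc t) \<in> A")
      case True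
      let ?k = "c (Suc t)"
      have "(\<Sum>i\<in>A. of_bool (\<rho> i > 0) * of_bool (?H (\<rho>(i := \<rho> i - 1)) c \<and> c (Suc t) \<in> {i})) =
         (\<Sum>i\<in>A. if ?k = i then of_bool (\<rho> ?k > 0 \<and> ?H (\<rho>(?k := \<rho> ?k - 1)) c) else (0::real))"
        by (intro sum.cong) auto
      also have "\<dots> = of_bool (\<rho> ?k > 0 \<and> ?H (\<rho>(?k := \<rho> ?k - 1)) c)"
        using True fin by simp
      also have "(\<rho> ?k > 0 \<and> ?H (\<rho>(?k := \<rho> ?k - 1)) c) = (\<forall>i\<in>A. hits c i (Suc t) = \<rho> i)"
        using True by (auto simp: hits_Suc)
      finally show ?thesis using True by simp
    next
      case False
      have "(\<Sum>i\<in>A. of_bool (\<rho> i > 0) * of_bool (?H (\<rho>(i := \<rho> i - 1)) c \<and> c (Suc t) \<in> {i})) = (0::real)"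
        using False by (intro sum.neutral) auto
      moreover have "(\<forall>i\<in>A. hits c i (Suc t) = \<rho> i) = ?H \<rho> c"
        using False by (auto simp: hits_Suc)
      ultimately show ?thesis using False cS by simp
    qed
  qed
  also have "\<dots> = (\<Sum>i\<in>A. of_bool (\<rho> i > 0) * (1 / real n * freq n T (?H (\<rho>(i := \<rho> i - 1)))))
       + q * freq n T (?H \<rho>)"
  proof -
    have "freq n T (\<lambda>c. ?H (\<rho>(i := \<rho> i - 1)) c \<and> c (Suc t) \<in> {i}) = 1 / real n * freq n T (?H (\<rho>(i := \<rho> i - 1)))"
      if "i \<in> A" for i
    proof -
      have "{i} \<subseteq> {1..n}" using that A by auto
      from freq_independent_coordinate[of "Suc t" T n, OF _ n this, of "?H (\<rho>(i := \<rho> i - 1))", OF _ inv]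
      show ?thesis using Suc.prems by simp
    qed
    moreover have "freq n T (\<lambda>c. ?H \<rho> c \<and> c (Suc t) \<in> {1..n} - A) = q * freq n T (?H \<rho>)"
    proof -
      have le: "card A \<le> n" using card_mono[OF _ A] by simp
      have "card ({1..n} - A) = n - card A" using A fin by (simp add: card_Diff_subset)
      then have q: "real (card ({1..n} - A)) / real n = q"
        using le n unfolding q_def by (simp add: of_nat_diff field_simps)
      from Suc.prems show ?thesis
        unfolding q[symmetric] by (intro freq_independent_coordinate n inv) auto
    qed
    ultimately show ?thesis by (simp add: avg_add avg_sum avg_cmult)
  qed
  also have "freq n T (?H \<rho>) = ff t m / F / real n ^ m * q ^ (t - m)"
    using Suc.IH[of \<rho>] Suc.prems by (simp add: m_def F_def q_def ff_def)
  also have "(\<Sum>i\<in>A. of_bool (\<rho> i > 0) * (1 / real n * freq n T (?H (\<rho>(i := \<rho> i - 1))))) =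
     (\<Sum>i\<in>A. real (\<rho> i) * (ff t (m - 1) / F / real n ^ m * q ^ (t - (m - 1))))"
  proof (rule sum.cong[OF refl])
    fix i assume i: "i \<in> A"
    show "of_bool (\<rho> i > 0) * (1 / real n * freq n T (?H (\<rho>(i := \<rho> i - 1)))) =
      real (\<rho> i) * (ff t (m - 1) / F / real n ^ m * q ^ (t - (m - 1)))"
    proof (cases "\<rho> i = 0")
      case False
      have ms: "m = \<rho> i + sum \<rho> (A - {i})" unfolding m_def using fin i by (simp add: sum.remove)
      have ms': "sum (\<rho>(i := \<rho> i - 1)) A = \<rho> i - 1 + sum \<rho> (A - {i})"
        using fin i by (simp add: sum.remove[of A i])
      have m1: "sum (\<rho>(i := \<rho> i - 1)) A = m - 1" using False ms ms' by simp
      have "F = fact (\<rho> i) * (\<Prod>k\<in>A-{i}. fact (\<rho> k))" unfolding F_def using fin i by (simp add: prod.remove)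
      moreover have "(\<Prod>k\<in>A. fact ((\<rho>(i := \<rho> i - 1)) k)) = (fact (\<rho> i - 1) :: real) * (\<Prod>k\<in>A-{i}. fact (\<rho> k))"
        using fin i by (simp add: prod.remove[of A i])
      moreover have "fact (\<rho> i) = real (\<rho> i) * (fact (\<rho> i - 1) :: real)" using False by (simp add: fact_reduce)
      ultimately have F1: "(\<Prod>k\<in>A. fact ((\<rho>(i := \<rho> i - 1)) k)) = F / real (\<rho> i)"
        using False by simp
      have "m = Suc (m - 1)" using False ms by simp
      then have np: "real n ^ m = real n * real n ^ (m - 1)" by (metis power_Suc)
      have "freq n T (?H (\<rho>(i := \<rho> i - 1))) = ff t (m - 1) / (F / real (\<rho> i)) / real n ^ (m - 1) * q ^ (t - (m - 1))"
        using Suc.IH[of "\<rho>(i := \<rho> i - 1)"] Suc.prems unfolding m1 F1 by (simp add: q_def ff_def)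
      then show ?thesis using False F0 n by (simp add: np mult_ac)
    qed simp
  qed
  also have "\<dots> = real m * (ff t (m - 1) / F / real n ^ m * q ^ (t - (m - 1)))"
    unfolding m_def of_nat_sum by (rule sum_distrib_right[symmetric])
  also have "\<dots> + q * (ff t m / F / real n ^ m * q ^ (t - m)) =
      (real m * ff t (m - 1) * q ^ (t - (m - 1)) + ff t m * (q * q ^ (t - m))) / F / real n ^ m"
    by (simp add: add_divide_distrib algebra_simps)
  \<comment> \<open>for \<open>m > t\<close> the truncated exponents are harmless because the binomial coefficients vanish\<close>
  also have "real m * ff t (m - 1) * q ^ (t - (m - 1)) + ff t m * (q * q ^ (t - m)) =
      ff (Suc t) m * q ^ (Suc t - m)"
  proof (cases m)
    case (Suc k)
    consider "m \<le> t" | "m = Suc t" | "m > Suc t" by linarith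
    then show ?thesis
    proof cases
      case 1
      then have "q * q ^ (t - m) = q ^ (Suc t - m)" by (simp add: Suc_diff_le)
      moreover have "t - (m - 1) = Suc t - m" using Suc by simp
      moreover have "real m * ff t (m - 1) + ff t m = ff (Suc t) m"
        using Suc unfolding ff_def by (simp add: algebra_simps)
      ultimately show ?thesis by (metis (no_types) distrib_right)
    next
      case 2
      then show ?thesis by (simp add: ff_def binomial_eq_0)
    next
      case 3
      then show ?thesis by (simp add: ff_def binomial_eq_0)
    qed
  qed (simp add: ff_def)
  finally show ?case by (simp add: m_def F_def q_def ff_def)
qed

text \<open>After time \<open>start\<close>, each coupon at a time \<open>s\<close> only has to avoid the types that must still stay silent at \<open>s\<close>.\<close>

lemma freq_hits_then_silent:
  assumes n: "n \<ge> 1" and A: "A \<subseteq> {1..n}" and start: "start \<le> t" and "t \<le> T"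
  shows "freq n T (\<lambda>c. (\<forall>i\<in>A. hits c i start = \<rho> i) \<and> (\<forall>i\<in>A. \<forall>s\<in>{start<..t}. s \<le> \<tau> i \<longrightarrow> c s \<noteq> i)) =
    freq n T (\<lambda>c. \<forall>i\<in>A. hits c i start = \<rho> i) * (\<Prod>s\<in>{start<..t}. 1 - real (card {i\<in>A. s \<le> \<tau> i}) / real n)"
  using start \<open>t \<le> T\<close>
proof (induction t rule: dec_induct)
  case base
  then show ?case by simp
next
  case (step t)
  have fin: "finite A" using A finite_subset by blast
  let ?Q = "\<lambda>t c. (\<forall>i\<in>A. hits c i start = \<rho> i) \<and> (\<forall>i\<in>A. \<forall>s\<in>{start<..t}. s \<le> \<tau> i \<longrightarrow> c s \<noteq> i)"
  let ?B = "{i\<in>A. Suc t \<le> \<tau> i}"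
  have iv: "{start<..Suc t} = insert (Suc t) {start<..t}" using step.hyps by auto
  have inv: "?Q t (c(Suc t := j)) = ?Q t c" for c j
    using step.hyps by (auto simp: hits_update)
  have B: "?B \<subseteq> {1..n}" using A by auto
  then have le: "card ?B \<le> n" using card_mono[OF _ B] by simp
  have cB: "real (card ({1..n} - ?B)) / real n = 1 - real (card ?B) / real n"
    using B le n fin by (simp add: card_Diff_subset of_nat_diff field_simps)
  have "freq n T (?Q (Suc t)) = freq n T (\<lambda>c. ?Q t c \<and> c (Suc t) \<in> {1..n} - ?B)"
  proof (rule avg_cong)
    fix c assume c: "c \<in> paths n T"
    have cS: "c (Suc t) \<in> {1..n}" using step.prems by (intro paths_mem[OF c]) auto
    have "?Q (Suc t) c = (?Q t c \<and> c (Suc t) \<in> {1..n} - ?B)"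
      unfolding iv using cS by auto
    then show "(of_bool (?Q (Suc t) c) :: real) = of_bool (?Q t c \<and> c (Suc t) \<in> {1..n} - ?B)" by simp
  qed
  also have "\<dots> = real (card ({1..n} - ?B)) / real n * freq n T (?Q t)"
    using step.prems by (intro freq_independent_coordinate n inv) auto
  also have "freq n T (?Q t) = freq n T (\<lambda>c. \<forall>i\<in>A. hits c i start = \<rho> i) * (\<Prod>s\<in>{start<..t}. 1 - real (card {i\<in>A. s \<le> \<tau> i}) / real n)"
    using step by simp
  finally show ?case unfolding iv cB by (simp add: mult_ac)
qed

section \<open>Bonferroni inequalities\<close>

text \<open>The elementary symmetric polynomial of degree \<open>j\<close>.  For indicators \<open>w i\<close> it counts the \<open>j\<close>-subsets of the
occurring events, so its expectation is a factorial moment divided by \<open>j!\<close>.\<close>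

definition esym :: "'i set \<Rightarrow> ('i \<Rightarrow> real) \<Rightarrow> nat \<Rightarrow> real" where
  "esym I w j = (\<Sum>A | A \<subseteq> I \<and> card A = j. \<Prod>i\<in>A. w i)"

lemma esym_0: "finite I \<Longrightarrow> esym I w 0 = 1"
proof -
  assume "finite I"
  then have "{A. A \<subseteq> I \<and> card A = 0} = {{}}" by (auto dest: finite_subset)
  then show ?thesis by (simp add: esym_def)
qed

lemma esym_insert_Suc:
  assumes "finite I" "x \<notin> I"
  shows "esym (insert x I) w (Suc j) = esym I w (Suc j) + w x * esym I w j"
proof -
  let ?S = "\<lambda>j. {A. A \<subseteq> I \<and> card A = j}"
  have fin: "A \<in> ?S j \<Longrightarrow> finite A" for A j using assms(1) by (auto dest: finite_subset)
  have nx: "A \<in> ?S j \<Longrightarrow> x \<notin> A" for A j using assms(2) by auto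
  have eq: "{A. A \<subseteq> insert x I \<and> card A = Suc j} = ?S (Suc j) \<union> insert x ` ?S j"
  proof (intro set_eqI iffI)
    fix A assume A: "A \<in> {A. A \<subseteq> insert x I \<and> card A = Suc j}"
    show "A \<in> ?S (Suc j) \<union> insert x ` ?S j"
    proof (cases "x \<in> A")
      case True
      have "finite A" using A assms(1) finite_subset by blast
      then have "A = insert x (A - {x})" "A - {x} \<in> ?S j" using A True by auto
      then show ?thesis by blast
    qed (use A in auto)
  next
    fix A assume "A \<in> ?S (Suc j) \<union> insert x ` ?S j"
    then consider "A \<in> ?S (Suc j)" | B where "B \<in> ?S j" "A = insert x B" by blast
    then show "A \<in> {A. A \<subseteq> insert x I \<and> card A = Suc j}"
    proof cases
      case 2
      then have "card A = Suc (card B)" using fin[of B j] nx[of B j] by simp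
      then show ?thesis using 2 by auto
    qed auto
  qed
  have fS: "finite (?S j)" for j using assms(1) by simp
  have "inj_on (insert x) (?S j)"
  proof (rule inj_onI)
    fix A B assume AB: "A \<in> ?S j" "B \<in> ?S j" "insert x A = insert x B"
    show "A = B" using insert_ident[OF nx[OF AB(1)] nx[OF AB(2)]] AB(3) by simp
  qed
  then have "(\<Sum>A\<in>insert x ` ?S j. \<Prod>i\<in>A. w i) = (\<Sum>A\<in>?S j. \<Prod>i\<in>insert x A. w i)"
    by (simp add: sum.reindex)
  also have "\<dots> = (\<Sum>A\<in>?S j. w x * (\<Prod>i\<in>A. w i))"
  proof (rule sum.cong[OF refl])
    fix A assume A: "A \<in> ?S j"
    show "(\<Prod>i\<in>insert x A. w i) = w x * (\<Prod>i\<in>A. w i)"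
      using fin[OF A] nx[OF A] by simp
  qed
  finally have "(\<Sum>A\<in>insert x ` ?S j. \<Prod>i\<in>A. w i) = (\<Sum>A\<in>?S j. w x * (\<Prod>i\<in>A. w i))" .
  moreover have "?S (Suc j) \<inter> insert x ` ?S j = {}" using assms(2) by auto
  ultimately show ?thesis unfolding esym_def eq
    using fS by (subst sum.union_disjoint) (auto simp: sum_distrib_left)
qed

text \<open>The truncations of the expansion of the product alternate around its value.  With weights in \<open>[0, 1]\<close>
instead of indicators, these inequalities apply directly to generating functions.  In the induction, the remainder
for \<open>insert x I\<close> at level \<open>J\<close> is the sum of the remainder for \<open>I\<close> at level \<open>J\<close> and \<open>w x\<close> times the one at level
\<open>J - 1\<close>.\<close>

lemma bonferroni:
  fixes w :: "'i \<Rightarrow> real"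
  assumes "finite I" "\<And>i. i \<in> I \<Longrightarrow> 0 \<le> w i \<and> w i \<le> 1"
  shows "0 \<le> (-1) ^ J * ((\<Sum>j\<le>J. (-1) ^ j * esym I w j) - (\<Prod>i\<in>I. 1 - w i))"
  using assms
proof (induction I arbitrary: J rule: finite_induct)
  case empty
  have e: "esym {} w j = (if j = 0 then 1 else 0)" for j
  proof -
    have "{A. A \<subseteq> ({} :: 'i set) \<and> card A = j} = (if j = 0 then {{}} else {})" by auto
    then show ?thesis unfolding esym_def by (simp only:) auto
  qed
  have "(\<Sum>j\<le>J. (-1) ^ j * esym {} w j) = (\<Sum>j\<le>J. if j = 0 then 1 else (0::real))"
    by (intro sum.cong) (auto simp: e)
  then show ?case by simp
next
  case (insert x I)
  define P where "P = (\<Prod>i\<in>I. 1 - w i)"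
  define S where "S J = (\<Sum>j\<le>J. (-1) ^ j * esym I w j)" for J
  have P01: "0 \<le> P" unfolding P_def using insert.prems by (intro prod_nonneg) auto
  have wx: "0 \<le> w x" "w x \<le> 1" using insert.prems[of x] by auto
  have P: "(\<Prod>i\<in>insert x I. 1 - w i) = (1 - w x) * P"
    using insert.hyps by (simp add: P_def)
  have IH: "0 \<le> (-1) ^ J * (S J - P)" for J
    using insert.IH[of J] insert.prems by (simp add: S_def P_def)
  show ?case
  proof (cases J)
    case 0
    have "P \<le> 1" unfolding P_def using insert.prems by (intro prod_le_1) auto
    then have "(1 - w x) * P \<le> 1" using wx P01 mult_le_one[of "1 - w x" P] by auto
    then show ?thesis using 0 insert.hyps unfolding P by (simp add: esym_0)
  next
    case (Suc k)
    have "(\<Sum>j\<le>J. (-1) ^ j * esym (insert x I) w j) =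
        1 + (\<Sum>j\<le>k. (-1) ^ Suc j * (esym I w (Suc j) + w x * esym I w j))"
      unfolding Suc using insert.hyps
      by (subst sum.atMost_Suc_shift) (simp add: esym_0 esym_insert_Suc)
    also have "\<dots> = 1 + (\<Sum>j\<le>k. (-1) ^ Suc j * esym I w (Suc j)) - w x * S k"
      by (simp add: S_def algebra_simps sum.distrib sum_distrib_left sum_negf sum_subtractf)
    also have "1 + (\<Sum>j\<le>k. (-1) ^ Suc j * esym I w (Suc j)) = S J"
      unfolding Suc S_def using insert.hyps by (subst sum.atMost_Suc_shift) (simp add: esym_0)
    finally have E: "(\<Sum>j\<le>J. (-1) ^ j * esym (insert x I) w j) = S J - w x * S k" .
    have "(-1) ^ J * ((\<Sum>j\<le>J. (-1) ^ j * esym (insert x I) w j) - (\<Prod>i\<in>insert x I. 1 - w i))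
       = (-1) ^ J * (S J - P) + w x * ((-1) ^ k * (S k - P))"
      unfolding P E by (simp add: Suc algebra_simps)
    also have "\<dots> \<ge> 0" by (intro add_nonneg_nonneg IH mult_nonneg_nonneg[OF wx(1)])
    finally show ?thesis .
  qed
qed

section \<open>Types whose coupons all come early\<close>

lemma fact_mult_binomial_le: "fact m * real (t choose m) \<le> real t ^ m"
  using binomial_fact_pow[of t m] by (metis mult.commute of_nat_fact of_nat_le_iff of_nat_mult of_nat_power)

lemma fact_mult_binomial_ge:
  assumes "t \<ge> 1"
  shows "real t ^ m * (1 - real m ^ 2 / real t) \<le> fact m * real (t choose m)"
proof (cases "m \<le> t")
  case True
  have "(real t - real m) ^ k \<le> fact k * real (t choose k)" if "k \<le> m" for k
    using that
  proof (induction k)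
    case (Suc k)
    have "fact (Suc k) * real (t choose Suc k) = fact k * (real (Suc k) * real (t choose Suc k))"
      by simp
    also have "real (Suc k) * real (t choose Suc k) = real (t choose k) * (real t - real k)"
    proof -
      have "Suc k * (t choose Suc k) = (t choose k) * (t - k)"
        using binomial_absorb_comp[of t k] binomial_absorption[of k t] by (simp add: mult.commute)
      then have "real (Suc k * (t choose Suc k)) = real ((t choose k) * (t - k))" by (rule arg_cong)
      then show ?thesis using Suc.prems True by (simp only: of_nat_mult of_nat_diff)
    qed
    finally have eq: "fact (Suc k) * real (t choose Suc k) = (fact k * real (t choose k)) * (real t - real k)"
      by simp
    have "(real t - real m) ^ k * (real t - real m) \<le> (fact k * real (t choose k)) * (real t - real k)"
      using Suc True by (intro mult_mono) auto
    then show ?case unfolding eq by (simp add: mult.commute)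
  qed simp
  then have 1: "(real t - real m) ^ m \<le> fact m * real (t choose m)" by simp
  have "1 + real m * (- (real m / real t)) \<le> (1 + - (real m / real t)) ^ m"
    using True assms by (intro Bernoulli_inequality) auto
  then have "real t ^ m * (1 - real m ^ 2 / real t) \<le> real t ^ m * (1 - real m / real t) ^ m"
    by (intro mult_left_mono) (auto simp: power2_eq_square)
  also have "\<dots> = (real t * (1 - real m / real t)) ^ m" by (simp add: power_mult_distrib)
  also have "real t * (1 - real m / real t) = real t - real m" using assms by (simp add: field_simps)
  finally show ?thesis using 1 by linarith
next
  case False
  then have "real t * 1 \<le> real m * real m" using assms by (intro mult_mono) auto
  then have "1 - real m ^ 2 / real t \<le> 0" using assms by (simp add: power2_eq_square le_divide_eq)
  then have "real t ^ m * (1 - real m ^ 2 / real t) \<le> 0" by (intro mult_nonneg_nonpos) auto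
  also have "0 \<le> fact m * real (t choose m)" by simp
  finally show ?thesis .
qed

lemma hits_eq_iff_silent:
  assumes "start \<le> t"
  shows "hits c i start = r \<and> hits c i t = r \<longleftrightarrow> hits c i start = r \<and> (\<forall>s\<in>{start<..t}. c s \<noteq> i)"
proof -
  have "{s \<in> {1..t}. c s = i} = {s \<in> {1..start}. c s = i} \<union> {s \<in> {start<..t}. c s = i}"
    using assms by auto
  then have "hits c i t = hits c i start + card {s \<in> {start<..t}. c s = i}"
    unfolding hits_def by (subst card_Un_disjoint[symmetric]) auto
  then show ?thesis by auto
qed

text \<open>The exact probability is essentially a falling factorial times a product over all times \<open>s\<close> of factors \<open>1 - a s\<close>,
where \<open>n * a s\<close> is the number of types \<open>i\<close> with \<open>s \<le> \<tau> i\<close>.  The \<open>a s\<close> sum to the sum of the \<open>\<tau> i / n\<close>, so replacing \<open>1 - x\<close> by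
\<open>exp (- x)\<close> yields the product \<open>B\<close>, the value for independent Poisson counts.  The correction factors depend on
\<open>A\<close> only through its cardinality and on \<open>\<rho>\<close> only through \<open>m\<close>, which makes the bounds uniform in the types.\<close>

lemma freq_early_bounds:
  fixes \<rho> :: "nat \<Rightarrow> nat"
  assumes n: "n \<ge> 1" and A: "A \<subseteq> {1..n}" and start: "start \<ge> 1"
    and \<tau>: "\<And>i. i \<in> A \<Longrightarrow> start \<le> \<tau> i \<and> \<tau> i \<le> T"
    and A2: "2 * card A \<le> n" and T0: "start \<le> T"
  defines "m \<equiv> (\<Sum>i\<in>A. \<rho> i)"
    and "B \<equiv> (\<Prod>i\<in>A. (real start / real n) ^ \<rho> i / fact (\<rho> i) * exp (- (real (\<tau> i) / real n)))"
    and "p \<equiv> freq n T (\<lambda>c. \<forall>i\<in>A. hits c i start = \<rho> i \<and> hits c i (\<tau> i) = \<rho> i)"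
  shows "p \<le> (1 / (1 - real (card A) / real n)) ^ m * B"
    and "(1 - real m ^ 2 / real start) * exp (- (2 * real T * (real (card A) / real n) ^ 2)) * B \<le> p"
proof -
  let ?\<kappa> = "real (card A) / real n" and ?\<epsilon> = "exp (- (2 * real T * (real (card A) / real n) ^ 2))" and ?F = "(\<Prod>i\<in>A. fact (\<rho> i)) :: real"
  have fin: "finite A" using A finite_subset by blast
  define a where "a s = real (card {i\<in>A. s \<le> \<tau> i}) / real n" for s
  let ?X = "exp (- (\<Sum>s\<in>{1..T}. a s))"
  define q where "q = 1 - ?\<kappa>"
  define ff where "ff = fact m * real (start choose m)"
  \<comment> \<open>up to time \<open>start\<close> all types of \<open>A\<close> are watched, so \<open>D\<close> also absorbs the power of \<open>q\<close>\<close>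
  define D where "D = (\<Prod>s\<in>{1..T}. 1 - a s)"
  have q: "0 < q" "q \<le> 1" using A2 n unfolding q_def by (auto simp: field_simps)
  have a_le: "a s \<le> ?\<kappa>" for s
    unfolding a_def using fin by (intro divide_right_mono) (auto intro: card_mono)
  have a0: "0 \<le> a s" for s unfolding a_def by simp
  have half: "?\<kappa> \<le> 1/2" using A2 n by (simp add: field_simps)
  have a_half: "a s \<le> 1/2" for s using a_le[of s] half by linarith
  have p_eq: "p = ff / ?F / real n ^ m * q ^ (start - m) * (\<Prod>s\<in>{start<..T}. 1 - a s)"
  proof -
    have "p = freq n T (\<lambda>c. (\<forall>i\<in>A. hits c i start = \<rho> i) \<and> (\<forall>i\<in>A. \<forall>s\<in>{start<..T}. s \<le> \<tau> i \<longrightarrow> c s \<noteq> i))"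
      unfolding p_def
    proof (rule avg_cong)
      fix c
      have "(\<forall>i\<in>A. hits c i start = \<rho> i \<and> hits c i (\<tau> i) = \<rho> i) \<longleftrightarrow>
         (\<forall>i\<in>A. hits c i start = \<rho> i \<and> (\<forall>s\<in>{start<..\<tau> i}. c s \<noteq> i))"
        using \<tau> hits_eq_iff_silent by (intro ball_cong refl) auto
      also have "\<dots> \<longleftrightarrow> (\<forall>i\<in>A. hits c i start = \<rho> i) \<and> (\<forall>i\<in>A. \<forall>s\<in>{start<..T}. s \<le> \<tau> i \<longrightarrow> c s \<noteq> i)"
        using \<tau> by fastforce
      finally show "of_bool (\<forall>i\<in>A. hits c i start = \<rho> i \<and> hits c i (\<tau> i) = \<rho> i) =
         (of_bool ((\<forall>i\<in>A. hits c i start = \<rho> i) \<and> (\<forall>i\<in>A. \<forall>s\<in>{start<..T}. s \<le> \<tau> i \<longrightarrow> c s \<noteq> i)) :: real)"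
        by (simp only:)
    qed
    then show ?thesis
      using freq_hits_then_silent[OF n A T0 order_refl, of \<rho> \<tau>] freq_hits[OF n A T0, of \<rho>]
      by (simp add: ff_def m_def q_def a_def)
  qed
  have D_eq: "D = q ^ start * (\<Prod>s\<in>{start<..T}. 1 - a s)"
  proof -
    have "{1..T} = {1..start} \<union> {start<..T}" using T0 start by auto
    then have "D = (\<Prod>s\<in>{1..start}. 1 - a s) * (\<Prod>s\<in>{start<..T}. 1 - a s)"
      unfolding D_def by (simp add: prod.union_disjoint ivl_disj_int)
    moreover have "1 - a s = q" if "s \<in> {1..start}" for s
    proof -
      have "{i\<in>A. s \<le> \<tau> i} = A" using \<tau> that by fastforce
      then show ?thesis by (simp add: a_def q_def)
    qed
    ultimately show ?thesis by simp
  qed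
  have sum_a: "(\<Sum>s\<in>{1..T}. a s) = (\<Sum>i\<in>A. real (\<tau> i) / real n)"
  proof -
    have "(\<Sum>s\<in>{1..T}. real (card {i\<in>A. s \<le> \<tau> i})) = (\<Sum>s\<in>{1..T}. \<Sum>i\<in>A. of_bool (s \<le> \<tau> i))"
      using fin by (intro sum.cong refl) (simp add: of_bool_def sum.If_cases Int_def)
    also have "\<dots> = (\<Sum>i\<in>A. \<Sum>s\<in>{1..T}. of_bool (s \<le> \<tau> i))" by (rule sum.swap)
    also have "\<dots> = (\<Sum>i\<in>A. real (\<tau> i))"
    proof (rule sum.cong[OF refl])
      fix i assume "i \<in> A"
      then have "{s \<in> {1..T}. s \<le> \<tau> i} = {1..\<tau> i}" using \<tau> by fastforce
      then show "(\<Sum>s\<in>{1..T}. of_bool (s \<le> \<tau> i)) = real (\<tau> i)"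
        by (simp add: of_bool_def sum.If_cases Int_def)
    qed
    finally show ?thesis by (simp add: a_def flip: sum_divide_distrib)
  qed
  have Eprod: "(\<Prod>i\<in>A. exp (- (real (\<tau> i) / real n))) = ?X"
    unfolding sum_a using fin by (simp add: exp_sum sum_negf[symmetric])
  have D0: "0 \<le> D" unfolding D_def
  proof (rule prod_nonneg)
    fix s show "0 \<le> 1 - a s" using a_le[of s] half by linarith
  qed
  have D_le: "D \<le> ?X"
  proof -
    have "D \<le> (\<Prod>s\<in>{1..T}. exp (- a s))"
      unfolding D_def
    proof (rule prod_mono)
      fix s
      show "0 \<le> 1 - a s \<and> 1 - a s \<le> exp (- a s)"
        using exp_ge_add_one_self[of "- a s"] a_le[of s] half by (intro conjI) linarith+
    qed
    then show ?thesis by (simp add: exp_sum sum_negf[symmetric])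
  qed
  have D_ge: "?\<epsilon> * ?X \<le> D"
  proof -
    have "?\<epsilon> * ?X
       = exp (\<Sum>s\<in>{1..T}. - a s - 2 * (?\<kappa>) ^ 2)"
      by (simp add: exp_add[symmetric] sum_subtractf sum_negf)
    also have "\<dots> = (\<Prod>s\<in>{1..T}. exp (- a s - 2 * (?\<kappa>) ^ 2))"
      by (simp add: exp_sum)
    also have "\<dots> \<le> D" unfolding D_def
    proof (rule prod_mono)
      fix s
      have "- a s - 2 * (a s) ^ 2 \<le> ln (1 - a s)"
        using a0[of s] a_half[of s] by (intro ln_one_minus_pos_lower_bound) auto
      moreover have "(a s) ^ 2 \<le> (?\<kappa>) ^ 2"
        using a0 a_le by (intro power_mono) auto
      ultimately have "- a s - 2 * (?\<kappa>) ^ 2 \<le> ln (1 - a s)" by linarith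
      then have "exp (- a s - 2 * (?\<kappa>) ^ 2) \<le> exp (ln (1 - a s))" by simp
      also have "\<dots> = 1 - a s" using a_half[of s] by (intro exp_ln) auto
      finally show "0 \<le> exp (- a s - 2 * (?\<kappa>) ^ 2) \<and>
         exp (- a s - 2 * (?\<kappa>) ^ 2) \<le> 1 - a s" by simp
    qed
    finally show ?thesis .
  qed
  have B_eq: "B = real start ^ m / real n ^ m / ?F * ?X"
    unfolding B_def m_def
    by (simp add: prod.distrib prod_dividef Eprod power_divide power_sum)
  have F: "?F > 0" by (intro prod_pos) auto
  have ff_le: "ff \<le> real start ^ m" unfolding ff_def by (rule fact_mult_binomial_le)
  have ff_ge: "real start ^ m * (1 - real m ^ 2 / real start) \<le> ff"
    unfolding ff_def by (rule fact_mult_binomial_ge[OF start])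
  have ff0: "0 \<le> ff" unfolding ff_def by simp
  have p_D: "p = ff / ?F / real n ^ m * (1 / q) ^ m * D"
  proof (cases "m \<le> start")
    case True
    then have "q ^ start = q ^ (start - m) * q ^ m" by (simp flip: power_add)
    then have "q ^ (start - m) = (1 / q) ^ m * q ^ start" using q by (simp add: power_divide)
    then show ?thesis unfolding p_eq D_eq by (simp add: mult_ac)
  next
    case False
    then have "ff = 0" by (simp add: ff_def binomial_eq_0)
    then show ?thesis unfolding p_eq by simp
  qed
  have "p \<le> real start ^ m / ?F / real n ^ m * (1 / q) ^ m * ?X"
    unfolding p_D using F q D0 ff0
    by (intro mult_mono divide_right_mono ff_le D_le order_refl) auto
  also have "\<dots> = (1 / q) ^ m * B" unfolding B_eq by (simp add: mult_ac)
  finally show "p \<le> (1 / (1 - ?\<kappa>)) ^ m * B" unfolding q_def .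
  show "(1 - real m ^ 2 / real start) * ?\<epsilon> * B \<le> p"
  proof -
    let ?e = "?\<epsilon> * ?X"
    have "(1 - real m ^ 2 / real start) * ?\<epsilon> * B
      = (real start ^ m * (1 - real m ^ 2 / real start)) / ?F / real n ^ m * ?e"
      unfolding B_eq by (simp add: mult_ac)
    also have "\<dots> \<le> ff / ?F / real n ^ m * ?e"
      using F by (intro mult_right_mono divide_right_mono ff_ge) auto
    also have "\<dots> \<le> ff / ?F / real n ^ m * D"
      using F ff0 by (intro mult_left_mono D_ge) auto
    also have "\<dots> \<le> ff / ?F / real n ^ m * (1 / q) ^ m * D"
    proof -
      have "1 \<le> (1 / q) ^ m" using q by (intro one_le_power) (simp add: field_simps)
      then have "ff / ?F / real n ^ m * 1 \<le> ff / ?F / real n ^ m * (1 / q) ^ m"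
        using F ff0 by (intro mult_left_mono) auto
      then show ?thesis using D0 by (intro mult_right_mono) auto
    qed
    finally show ?thesis unfolding p_D .
  qed
qed

text \<open>For a type with exactly \<open>r\<close> coupons by time \<open>t 0\<close> and none from there to \<open>t r\<close> the weight is \<open>w r\<close>.  At most one
\<open>r\<close> qualifies for a given type.\<close>

definition early_weight :: "nat \<Rightarrow> (nat \<Rightarrow> real) \<Rightarrow> (nat \<Rightarrow> nat) \<Rightarrow> (nat \<Rightarrow> nat) \<Rightarrow> nat \<Rightarrow> real" where
  "early_weight R w t c i = (\<Sum>r\<le>R. w r * of_bool (hits c i (t 0) = r \<and> hits c i (t r) = r))"

text \<open>Expanding the product over the types gives a sum over all assignments \<open>\<rho>\<close> of the \<open>r\<close>'s to the types.  As the
bounds for a single assignment are products over the types, the sum factorises into the power of \<open>b\<close>.\<close>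

lemma avg_prod_early_weight_bounds:
  assumes n: "n \<ge> 1" and A: "A \<subseteq> {1..n}" and start: "t 0 \<ge> 1"
    and t: "\<And>r. r \<le> R \<Longrightarrow> t 0 \<le> t r \<and> t r \<le> T"
    and A2: "2 * card A \<le> n" and w: "\<And>r. r \<le> R \<Longrightarrow> 0 \<le> w r"
  defines "b \<equiv> (\<Sum>r\<le>R. w r * ((real (t 0) / real n) ^ r / fact r * exp (- (real (t r) / real n))))"
  shows "avg n T (\<lambda>c. \<Prod>i\<in>A. early_weight R w t c i) \<le> (1 / (1 - real (card A) / real n)) ^ (card A * R) * b ^ card A"
    and "(1 - real (card A * R) ^ 2 / real (t 0)) * exp (- (2 * real T * (real (card A) / real n) ^ 2)) * b ^ card A
        \<le> avg n T (\<lambda>c. \<Prod>i\<in>A. early_weight R w t c i)"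
proof -
  let ?hi = "(1 / (1 - real (card A) / real n)) ^ (card A * R)"
    and ?lo = "(1 - real (card A * R) ^ 2 / real (t 0)) * exp (- (2 * real T * (real (card A) / real n) ^ 2))"
    and ?W = "avg n T (\<lambda>c. \<Prod>i\<in>A. early_weight R w t c i)"
    and ?V = "\<lambda>c \<rho> i. hits c i (t 0) = \<rho> i \<and> hits c i (t (\<rho> i)) = \<rho> i"
  have fin: "finite A" using A finite_subset by blast
  define \<P> where "\<P> = (A \<rightarrow>\<^sub>E {..R})"
  define f where "f \<rho> = freq n T (\<lambda>c. \<forall>i\<in>A. ?V c \<rho> i)" for \<rho>
  define B where "B \<rho> = (\<Prod>i\<in>A. (real (t 0) / real n) ^ \<rho> i / fact (\<rho> i) * exp (- (real (t (\<rho> i)) / real n)))" for \<rho>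
  have T0: "t 0 \<le> T" using t[of 0] by simp
  have expand: "?W = (\<Sum>\<rho>\<in>\<P>. (\<Prod>i\<in>A. w (\<rho> i)) * f \<rho>)"
  proof -
    have "(\<Prod>i\<in>A. early_weight R w t c i) = (\<Sum>\<rho>\<in>\<P>. (\<Prod>i\<in>A. w (\<rho> i)) *
        of_bool (\<forall>i\<in>A. ?V c \<rho> i))" for c
    proof -
      have "(\<Prod>i\<in>A. early_weight R w t c i) =
        (\<Sum>\<rho>\<in>\<P>. \<Prod>i\<in>A. w (\<rho> i) * of_bool (?V c \<rho> i))"
        unfolding early_weight_def \<P>_def using fin by (subst prod_sum_PiE) auto
      also have "\<dots> = (\<Sum>\<rho>\<in>\<P>. (\<Prod>i\<in>A. w (\<rho> i)) *
        of_bool (\<forall>i\<in>A. ?V c \<rho> i))"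
      proof (rule sum.cong[OF refl])
        fix \<rho>
        have "(\<Prod>i\<in>A. of_bool (P i)) = (of_bool (\<forall>i\<in>A. P i) :: real)" for P
          using fin by (induction A rule: finite_induct) auto
        then show "(\<Prod>i\<in>A. w (\<rho> i) * of_bool (?V c \<rho> i)) =
          (\<Prod>i\<in>A. w (\<rho> i)) * of_bool (\<forall>i\<in>A. ?V c \<rho> i)"
          by (simp only: prod.distrib)
      qed
      finally show ?thesis .
    qed
    then show ?thesis by (simp only: avg_sum avg_cmult f_def)
  qed
  have b_pow: "(\<Sum>\<rho>\<in>\<P>. (\<Prod>i\<in>A. w (\<rho> i)) * B \<rho>) = b ^ card A"
  proof -
    have "(\<Prod>i\<in>A. b) = (\<Sum>\<rho>\<in>\<P>. \<Prod>i\<in>A. w (\<rho> i) * ((real (t 0) / real n) ^ \<rho> i / fact (\<rho> i) * exp (- (real (t (\<rho> i)) / real n))))"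
      unfolding b_def \<P>_def using fin by (subst prod_sum_PiE) auto
    then show ?thesis unfolding B_def by (simp only: prod.distrib prod_constant)
  qed
  have w0: "0 \<le> (\<Prod>i\<in>A. w (\<rho> i))" if "\<rho> \<in> \<P>" for \<rho>
    using that w by (intro prod_nonneg) (auto simp: \<P>_def)
  have B0: "0 \<le> B \<rho>" for \<rho> unfolding B_def by (intro prod_nonneg) auto
  have m_le: "(\<Sum>i\<in>A. \<rho> i) \<le> card A * R" if "\<rho> \<in> \<P>" for \<rho>
  proof -
    have "(\<Sum>i\<in>A. \<rho> i) \<le> (\<Sum>i\<in>A. R)" using that by (intro sum_mono) (auto simp: \<P>_def)
    then show ?thesis by simp
  qed
  have tau: "t 0 \<le> t (\<rho> i) \<and> t (\<rho> i) \<le> T" if "\<rho> \<in> \<P>" "i \<in> A" for \<rho> i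
    using that t[of "\<rho> i"] by (auto simp: \<P>_def)
  have q1: "1 \<le> 1 / (1 - real (card A) / real n)" using A2 n by (auto simp: field_simps)
  have up: "f \<rho> \<le> ?hi * B \<rho>" if \<rho>: "\<rho> \<in> \<P>" for \<rho>
  proof -
    have "f \<rho> \<le> (1 / (1 - real (card A) / real n)) ^ (\<Sum>i\<in>A. \<rho> i) * B \<rho>"
      unfolding f_def B_def using freq_early_bounds(1)[OF n A start tau[OF \<rho>] A2 T0] by simp
    also have "\<dots> \<le> ?hi * B \<rho>"
      by (intro mult_right_mono power_increasing m_le \<rho> q1 B0)
    finally show ?thesis .
  qed
  have low: "?lo * B \<rho> \<le> f \<rho>"
    if \<rho>: "\<rho> \<in> \<P>" for \<rho>
  proof -
    have "real (\<Sum>i\<in>A. \<rho> i) ^ 2 \<le> real (card A * R) ^ 2"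
      using m_le[OF \<rho>] by (intro power_mono) (auto simp del: of_nat_sum of_nat_mult)
    then have "1 - real (card A * R) ^ 2 / real (t 0) \<le> 1 - real (\<Sum>i\<in>A. \<rho> i) ^ 2 / real (t 0)"
      by (intro diff_left_mono divide_right_mono) auto
    then have "?lo * B \<rho>
      \<le> (1 - real (\<Sum>i\<in>A. \<rho> i) ^ 2 / real (t 0)) * exp (- (2 * real T * (real (card A) / real n) ^ 2)) * B \<rho>"
      by (intro mult_right_mono B0) auto
    also have "\<dots> \<le> f \<rho>"
      unfolding f_def B_def using freq_early_bounds(2)[OF n A start tau[OF \<rho>] A2 T0] by simp
    finally show ?thesis .
  qed
  have "(\<Sum>\<rho>\<in>\<P>. (\<Prod>i\<in>A. w (\<rho> i)) * f \<rho>) \<le> (\<Sum>\<rho>\<in>\<P>. (\<Prod>i\<in>A. w (\<rho> i)) * (?hi * B \<rho>))"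
    by (intro sum_mono mult_left_mono up w0)
  also have "\<dots> = ?hi * b ^ card A"
    unfolding b_pow[symmetric] sum_distrib_left by (intro sum.cong) auto
  finally show "?W \<le> ?hi * b ^ card A"
    unfolding expand .
  have "?lo * b ^ card A =
     (\<Sum>\<rho>\<in>\<P>. (\<Prod>i\<in>A. w (\<rho> i)) * (?lo * B \<rho>))"
    unfolding b_pow[symmetric] sum_distrib_left by (intro sum.cong) auto
  also have "\<dots> \<le> (\<Sum>\<rho>\<in>\<P>. (\<Prod>i\<in>A. w (\<rho> i)) * f \<rho>)"
    by (intro sum_mono mult_left_mono low w0)
  finally show "?lo * b ^ card A
        \<le> ?W"
    unfolding expand .
qed

section \<open>Asymptotics at the critical times\<close>

text \<open>The scaling at which the expected number of types with at most \<open>r\<close> coupons by time \<open>t n\<close> stays bounded away from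
\<open>0\<close> and \<open>\<infinity>\<close>: that number is about \<open>n * (ln n) ^ r / r! * exp (- t n / n)\<close>, which tends to \<open>exp (- \<sigma>) / r!\<close>.\<close>

definition critical_time :: "nat \<Rightarrow> real \<Rightarrow> (nat \<Rightarrow> nat) \<Rightarrow> bool" where
  "critical_time r \<sigma> t \<longleftrightarrow>
     (\<lambda>n. (real (t n) - real n * ln (real n) - real r * real n * ln (ln (real n))) / real n) \<longlonglongrightarrow> \<sigma>"

lemma critical_time_over_n:
  assumes "critical_time r \<sigma> t"
  obtains x where "x \<longlonglongrightarrow> \<sigma>"
    and "\<And>n. n \<ge> 1 \<Longrightarrow> real (t n) / real n = ln (real n) + real r * ln (ln (real n)) + x n"
proof
  show "(\<lambda>n. (real (t n) - real n * ln (real n) - real r * real n * ln (ln (real n))) / real n) \<longlonglongrightarrow> \<sigma>"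
    using assms unfolding critical_time_def .
  show "real (t n) / real n = ln (real n) + real r * ln (ln (real n)) +
     (real (t n) - real n * ln (real n) - real r * real n * ln (ln (real n))) / real n" if "n \<ge> 1" for n
    using that by (simp add: field_simps)
qed

lemma critical_time_ratio:
  assumes "critical_time r \<sigma> t"
  shows "(\<lambda>n. real (t n) / real n / ln (real n)) \<longlonglongrightarrow> 1"
proof -
  obtain x where x: "x \<longlonglongrightarrow> \<sigma>"
    and eq: "\<And>n. n \<ge> 1 \<Longrightarrow> real (t n) / real n = ln (real n) + real r * ln (ln (real n)) + x n"
    using critical_time_over_n[OF assms] by blast
  have "(\<lambda>n. (ln (real n) + real r * ln (ln (real n))) / ln (real n)) \<longlonglongrightarrow> 1" by real_asymp
  moreover have "(\<lambda>n. x n * (1 / ln (real n))) \<longlonglongrightarrow> \<sigma> * 0"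
    by (intro tendsto_mult x) real_asymp
  ultimately have "(\<lambda>n. (ln (real n) + real r * ln (ln (real n))) / ln (real n) + x n * (1 / ln (real n))) \<longlonglongrightarrow> 1 + \<sigma> * 0"
    by (rule tendsto_add)
  moreover have "\<forall>\<^sub>F n in sequentially. (ln (real n) + real r * ln (ln (real n))) / ln (real n) + x n * (1 / ln (real n))
      = real (t n) / real n / ln (real n)"
    using eventually_ge_at_top[of 1] by eventually_elim (simp add: eq add_divide_distrib)
  ultimately show ?thesis by (auto dest: Lim_transform_eventually)
qed

lemma critical_time_exp:
  assumes "critical_time r \<sigma> t"
  shows "(\<lambda>n. real n * ln (real n) ^ r * exp (- (real (t n) / real n))) \<longlonglongrightarrow> exp (- \<sigma>)"
proof -
  obtain x where x: "x \<longlonglongrightarrow> \<sigma>"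
    and eq: "\<And>n. n \<ge> 1 \<Longrightarrow> real (t n) / real n = ln (real n) + real r * ln (ln (real n)) + x n"
    using critical_time_over_n[OF assms] by blast
  have "(\<lambda>n. exp (- x n)) \<longlonglongrightarrow> exp (- \<sigma>)" by (intro tendsto_intros x)
  moreover have "\<forall>\<^sub>F n in sequentially. exp (- x n) = real n * ln (real n) ^ r * exp (- (real (t n) / real n))"
    using eventually_ge_at_top[of 3]
  proof eventually_elim
    case (elim n)
    have l: "ln (real n) > 0" using elim by simp
    have "exp (- (real (t n) / real n)) = exp (- ln (real n)) * exp (- (real r * ln (ln (real n)))) * exp (- x n)"
      using elim by (simp add: eq flip: exp_add)
    also have "exp (- ln (real n)) = 1 / real n" using elim by (simp add: exp_minus inverse_eq_divide)
    also have "exp (- (real r * ln (ln (real n)))) = 1 / ln (real n) ^ r"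
      using l by (simp add: exp_minus exp_of_nat_mult inverse_eq_divide)
    finally show ?case using elim l by simp
  qed
  ultimately show ?thesis by (auto dest: Lim_transform_eventually)
qed

text \<open>Types with \<open>k < r\<close> coupons contribute a factor \<open>(ln n) ^ (k - r)\<close> less than those with \<open>r\<close> coupons.\<close>

lemma critical_time_monomial:
  assumes s: "critical_time r' \<sigma>' s" and t: "critical_time r \<sigma> t" and k: "k \<le> r"
  shows "(\<lambda>n. real n * ((real (s n) / real n) ^ k * exp (- (real (t n) / real n))))
     \<longlonglongrightarrow> (if k = r then exp (- \<sigma>) else 0)"
proof -
  have 1: "(\<lambda>n. 1 / ln (real n) ^ (r - k)) \<longlonglongrightarrow> (if k = r then 1 else 0)"
  proof (cases "k = r")
    case False
    then have "r - k > 0" using k by simp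
    then have "(\<lambda>n. (1 / ln (real n)) ^ (r - k)) \<longlonglongrightarrow> 0 ^ (r - k)"
      by (intro tendsto_power) real_asymp
    then show ?thesis using False k by (simp add: power_divide power_0_left)
  qed simp
  have "(\<lambda>n. (real n * ln (real n) ^ r * exp (- (real (t n) / real n))) * (real (s n) / real n / ln (real n)) ^ k
      * (1 / ln (real n) ^ (r - k))) \<longlonglongrightarrow> exp (- \<sigma>) * 1 ^ k * (if k = r then 1 else 0)"
    by (intro tendsto_mult tendsto_power critical_time_exp critical_time_ratio 1) (fact s t)+
  moreover have "\<forall>\<^sub>F n in sequentially. (real n * ln (real n) ^ r * exp (- (real (t n) / real n))) * (real (s n) / real n / ln (real n)) ^ k
      * (1 / ln (real n) ^ (r - k)) = real n * ((real (s n) / real n) ^ k * exp (- (real (t n) / real n)))"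
    using eventually_ge_at_top[of 3]
  proof eventually_elim
    case (elim n)
    have l: "ln (real n) > 0" using elim by simp
    have "ln (real n) ^ r = ln (real n) ^ k * ln (real n) ^ (r - k)" using k by (simp flip: power_add)
    then show ?case using elim l by (simp add: power_divide power_mult_distrib)
  qed
  ultimately show ?thesis by (auto dest: Lim_transform_eventually)
qed

lemma critical_time_at_top:
  assumes "critical_time r \<sigma> t"
  shows "filterlim (\<lambda>n. real (t n)) at_top sequentially"
proof -
  have lim: "filterlim (\<lambda>n. (real (t n) / real n / ln (real n)) * (real n * ln (real n))) at_top sequentially"
    by (rule filterlim_tendsto_pos_mult_at_top[OF critical_time_ratio[OF assms]]) (simp, real_asymp)
  have eq: "\<forall>\<^sub>F n in sequentially. (real (t n) / real n / ln (real n)) * (real n * ln (real n)) = real (t n)"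
    using eventually_ge_at_top[of 3] by eventually_elim simp
  show ?thesis using lim unfolding filterlim_cong[OF refl refl eq] .
qed

lemma critical_time_square:
  assumes "critical_time r \<sigma> t"
  shows "(\<lambda>n. real (t n) / real n ^ 2) \<longlonglongrightarrow> 0"
proof -
  have "(\<lambda>n. (real (t n) / real n / ln (real n)) * (ln (real n) / real n)) \<longlonglongrightarrow> 1 * 0"
    by (intro tendsto_mult critical_time_ratio[OF assms]) real_asymp
  moreover have "\<forall>\<^sub>F n in sequentially. (real (t n) / real n / ln (real n)) * (ln (real n) / real n) = real (t n) / real n ^ 2"
    using eventually_ge_at_top[of 3] by eventually_elim (simp add: power2_eq_square)
  ultimately show ?thesis by (auto dest: Lim_transform_eventually)
qed

lemma critical_time_less:
  assumes s: "critical_time r' \<sigma>' s" and t: "critical_time r \<sigma> t" and "r' < r"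
  shows "\<forall>\<^sub>F n in sequentially. s n \<le> t n"
proof -
  obtain x where x: "x \<longlonglongrightarrow> \<sigma>"
    and eqx: "\<And>n. n \<ge> 1 \<Longrightarrow> real (t n) / real n = ln (real n) + real r * ln (ln (real n)) + x n"
    using critical_time_over_n[OF t] by blast
  obtain y where y: "y \<longlonglongrightarrow> \<sigma>'"
    and eqy: "\<And>n. n \<ge> 1 \<Longrightarrow> real (s n) / real n = ln (real n) + real r' * ln (ln (real n)) + y n"
    using critical_time_over_n[OF s] by blast
  have "filterlim (\<lambda>n. (x n - y n) + (real r - real r') * ln (ln (real n))) at_top sequentially"
    by (rule filterlim_tendsto_add_at_top[OF tendsto_diff[OF x y]])
       (rule filterlim_tendsto_pos_mult_at_top[OF tendsto_const], use \<open>r' < r\<close> in simp, real_asymp)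
  then have "\<forall>\<^sub>F n in sequentially. 0 \<le> (x n - y n) + (real r - real r') * ln (ln (real n))"
    by (simp add: filterlim_at_top)
  then show ?thesis using eventually_ge_at_top[of 1]
  proof eventually_elim
    case (elim n)
    have "real (s n) / real n \<le> real (t n) / real n"
      using elim by (simp add: eqx eqy algebra_simps)
    then show ?case using elim by (simp add: divide_le_cancel)
  qed
qed

section \<open>Poisson limit for the scarce types\<close>

lemma binomial_over_power:
  "(\<lambda>n. real (n choose j) / real n ^ j) \<longlonglongrightarrow> 1 / fact j"
proof (rule tendsto_sandwich)
  show "\<forall>\<^sub>F n in sequentially. (1 - real j ^ 2 / real n) / fact j \<le> real (n choose j) / real n ^ j"
    using eventually_ge_at_top[of 1]
  proof eventually_elim
    case (elim n)
    then show ?case using fact_mult_binomial_ge[OF elim, of j] by (simp add: field_simps)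
  qed
  show "\<forall>\<^sub>F n in sequentially. real (n choose j) / real n ^ j \<le> 1 / fact j"
    using eventually_ge_at_top[of 1]
  proof eventually_elim
    case (elim n)
    then show ?case using fact_mult_binomial_le[of j n] by (simp add: field_simps)
  qed
  have "(\<lambda>n. (1 - real j ^ 2 / real n) / fact j) \<longlonglongrightarrow> (1 - 0) / fact j"
    by (intro tendsto_intros) (real_asymp | simp)+
  then show "(\<lambda>n. (1 - real j ^ 2 / real n) / fact j) \<longlonglongrightarrow> 1 / fact j" by simp
qed simp

text \<open>For each level \<open>J\<close> the bounds may hold only for \<open>n\<close> beyond some point depending on \<open>J\<close>; a single pair of
consecutive levels suffices for a given precision.\<close>

lemma tendsto_of_alternating_bounds:
  fixes f :: "nat \<Rightarrow> real"
  assumes b: "\<And>J. \<forall>\<^sub>F n in sequentially. 0 \<le> (-1) ^ J * (s J n - f n)"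
    and s: "\<And>J. s J \<longlonglongrightarrow> \<sigma> J" and \<sigma>: "\<sigma> \<longlonglongrightarrow> l"
  shows "f \<longlonglongrightarrow> l"
proof (rule tendstoI)
  fix e :: real assume e: "e > 0"
  then have "\<forall>\<^sub>F J in sequentially. dist (\<sigma> J) l < e / 2" using \<sigma> by (intro tendstoD) auto
  then obtain N where N: "\<And>J. J \<ge> N \<Longrightarrow> dist (\<sigma> J) l < e / 2"
    unfolding eventually_sequentially by blast
  have d: "\<forall>\<^sub>F n in sequentially. dist (s J n) (\<sigma> J) < e / 2" for J
    using s[of J] e by (intro tendstoD) auto
  show "\<forall>\<^sub>F n in sequentially. dist (f n) l < e"
    using b[of "2 * N"] b[of "Suc (2 * N)"] d[of "2 * N"] d[of "Suc (2 * N)"]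
  proof eventually_elim
    case (elim n)
    have "f n \<le> s (2 * N) n" "s (Suc (2 * N)) n \<le> f n" using elim by simp_all
    moreover have "dist (\<sigma> (2 * N)) l < e / 2" "dist (\<sigma> (Suc (2 * N))) l < e / 2" by (rule N, simp)+
    ultimately show ?case using elim(3,4) unfolding dist_real_def by linarith
  qed
qed

text \<open>Since at most one \<open>r\<close> qualifies, a sum of weights \<open>1 - u r\<close> is the complement of a product of powers of \<open>u r\<close>.
This is how generating functions become products over the types.\<close>

lemma early_weight_disjoint:
  assumes "\<And>r. r \<le> R \<Longrightarrow> u r \<in> {0..1}"
  shows "1 - early_weight R (\<lambda>r. 1 - u r) t c i
     = (\<Prod>r\<le>R. u r ^ of_bool (hits c i (t 0) = r \<and> hits c i (t r) = r))"
    and "0 \<le> early_weight R (\<lambda>r. 1 - u r) t c i" "early_weight R (\<lambda>r. 1 - u r) t c i \<le> 1"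
proof -
  let ?h = "hits c i (t 0)"
  let ?P = "?h \<le> R \<and> hits c i (t ?h) = ?h"
  have 1: "early_weight R (\<lambda>r. 1 - u r) t c i = (if ?P then 1 - u ?h else 0)"
  proof -
    have "early_weight R (\<lambda>r. 1 - u r) t c i = (\<Sum>r\<le>R. if r = ?h then (1 - u ?h) * of_bool (hits c i (t ?h) = ?h) else 0)"
      unfolding early_weight_def by (intro sum.cong) auto
    also have "\<dots> = (if ?P then 1 - u ?h else 0)" by (simp add: sum.delta)
    finally show ?thesis .
  qed
  have 2: "(\<Prod>r\<le>R. u r ^ of_bool (hits c i (t 0) = r \<and> hits c i (t r) = r)) = (if ?P then u ?h else 1)"
  proof -
    have "(\<Prod>r\<le>R. u r ^ of_bool (hits c i (t 0) = r \<and> hits c i (t r) = r)) =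
      (\<Prod>r\<le>R. if r = ?h then u ?h ^ of_bool (hits c i (t ?h) = ?h) else 1)"
      by (intro prod.cong) auto
    also have "\<dots> = (if ?P then u ?h else 1)" by (simp add: prod.delta)
    finally show ?thesis .
  qed
  show "1 - early_weight R (\<lambda>r. 1 - u r) t c i
     = (\<Prod>r\<le>R. u r ^ of_bool (hits c i (t 0) = r \<and> hits c i (t r) = r))"
    unfolding 1 2 by simp
  show "0 \<le> early_weight R (\<lambda>r. 1 - u r) t c i" "early_weight R (\<lambda>r. 1 - u r) t c i \<le> 1"
    unfolding 1 using assms[of ?h] by auto
qed

lemma freq_hits_le:
  assumes "n \<ge> 2" "i \<in> {1..n}" "t \<ge> 1" "t \<le> T"
  shows "freq n T (\<lambda>c. hits c i t \<le> r) \<le>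
    (\<Sum>k\<le>r. (1 / (1 - 1 / real n)) ^ k * ((real t / real n) ^ k / fact k * exp (- (real t / real n))))"
proof -
  have "freq n T (\<lambda>c. hits c i t \<le> r) = (\<Sum>k\<le>r. freq n T (\<lambda>c. \<forall>i'\<in>{i}. hits c i' t = k \<and> hits c i' t = k))"
    unfolding avg_sum[symmetric] by (intro avg_cong) (simp add: of_bool_def sum.delta')
  also have "\<dots> \<le> (\<Sum>k\<le>r. (1 / (1 - 1 / real n)) ^ k * ((real t / real n) ^ k / fact k * exp (- (real t / real n))))"
  proof (rule sum_mono)
    fix k
    show "freq n T (\<lambda>c. \<forall>i'\<in>{i}. hits c i' t = k \<and> hits c i' t = k) \<le>
       (1 / (1 - 1 / real n)) ^ k * ((real t / real n) ^ k / fact k * exp (- (real t / real n)))"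
      using freq_early_bounds(1)[where n = n and A = "{i}" and start = t and \<tau> = "\<lambda>_. t" and T = T and \<rho> = "\<lambda>_. k"] assms by simp
  qed
  finally show ?thesis .
qed

text \<open>The number of empty spots in the album of collector \<open>r\<close> at the fixed time \<open>t\<close>.\<close>

definition scarce :: "nat \<Rightarrow> nat \<Rightarrow> nat \<Rightarrow> (nat \<Rightarrow> nat) \<Rightarrow> nat" where
  "scarce n r t p = card {i\<in>{1..n}. hits p i t \<le> r}"

locale critical_window =
  fixes R :: nat and t :: "nat \<Rightarrow> nat \<Rightarrow> nat" and \<sigma> :: "nat \<Rightarrow> real"
  assumes critical: "\<And>r. r \<le> R \<Longrightarrow> critical_time r (\<sigma> r) (t r)"
begin

text \<open>A common length of coupon sequences that covers all the times \<open>t r n\<close>.\<close>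

definition horizon :: "nat \<Rightarrow> nat" where "horizon n = (\<Sum>r\<le>R. t r n)"

lemma horizon_ge: "r \<le> R \<Longrightarrow> t r n \<le> horizon n"
  unfolding horizon_def by (rule member_le_sum) auto

lemma horizon_square: "(\<lambda>n. real (horizon n) / real n ^ 2) \<longlonglongrightarrow> 0"
proof -
  have "(\<lambda>n. \<Sum>r\<le>R. real (t r n) / real n ^ 2) \<longlonglongrightarrow> (\<Sum>r\<le>R. 0)"
    by (intro tendsto_sum critical_time_square[OF critical]) auto
  then show ?thesis by (simp add: horizon_def sum_divide_distrib)
qed

lemma eventually_ordered: "\<forall>\<^sub>F n in sequentially. \<forall>r\<le>R. 1 \<le> t 0 n \<and> t 0 n \<le> t r n"
proof -
  have 1: "\<forall>\<^sub>F n in sequentially. 1 \<le> t 0 n"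
    using critical_time_at_top[OF critical[of 0]] unfolding filterlim_at_top
    by (auto elim!: eventually_mono[OF spec[of _ 1]])
  have "\<forall>\<^sub>F n in sequentially. \<forall>r\<in>{..R}. t 0 n \<le> t r n"
  proof (rule eventually_ball_finite, simp, rule ballI)
    fix r assume "r \<in> {..R}"
    then show "\<forall>\<^sub>F n in sequentially. t 0 n \<le> t r n"
      using critical_time_less[OF critical[of 0] critical[of r]] by (cases "r = 0") auto
  qed
  then show ?thesis using 1 by eventually_elim auto
qed

lemma lower_factor:
  "(\<lambda>n. (1 - real (j * R) ^ 2 / real (t 0 n)) * exp (- (2 * real (horizon n) * (real j / real n) ^ 2))) \<longlonglongrightarrow> 1"
proof -
  have 1: "(\<lambda>n. real (j * R) ^ 2 / real (t 0 n)) \<longlonglongrightarrow> 0"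
    by (rule real_tendsto_divide_at_top[OF tendsto_const critical_time_at_top[OF critical[of 0]]]) simp
  have "(\<lambda>n. 2 * real j ^ 2 * (real (horizon n) / real n ^ 2)) \<longlonglongrightarrow> 2 * real j ^ 2 * 0"
    by (intro tendsto_intros horizon_square)
  then have 2: "(\<lambda>n. 2 * real (horizon n) * (real j / real n) ^ 2) \<longlonglongrightarrow> 0"
    by (simp add: power_divide mult_ac)
  have "(\<lambda>n. (1 - real (j * R) ^ 2 / real (t 0 n)) * exp (- (2 * real (horizon n) * (real j / real n) ^ 2)))
     \<longlonglongrightarrow> (1 - 0) * exp (- 0)"
    by (intro tendsto_mult tendsto_diff tendsto_const tendsto_exp tendsto_minus 1 2)
  then show ?thesis by simp
qed

lemma upper_factor: "(\<lambda>n. (1 / (1 - real j / real n)) ^ k) \<longlonglongrightarrow> 1"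
proof -
  have "(\<lambda>n. (1 / (1 - real j / real n)) ^ k) \<longlonglongrightarrow> 1 ^ k"
    by (intro tendsto_power) real_asymp
  then show ?thesis by simp
qed

text \<open>Convergence of the factorial moments.  All \<open>j\<close>-subsets of types share the same bounds, so only their number
\<open>n choose j\<close>, which is asymptotic to \<open>n ^ j / j!\<close>, enters.\<close>

lemma expected_esym:
  assumes u: "\<And>r. r \<le> R \<Longrightarrow> u r \<in> {0..1}"
  defines "c \<equiv> (\<Sum>r\<le>R. (1 - u r) * exp (- \<sigma> r) / fact r)"
  shows "(\<lambda>n. avg n (horizon n) (\<lambda>p. esym {1..n} (early_weight R (\<lambda>r. 1 - u r) (\<lambda>r. t r n) p) j))
     \<longlonglongrightarrow> c ^ j / fact j"
proof -
  define b where "b n = (\<Sum>r\<le>R. (1 - u r) * ((real (t 0 n) / real n) ^ r / fact r * exp (- (real (t r n) / real n))))" for n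
  define lo where "lo n = (1 - real (j * R) ^ 2 / real (t 0 n)) * exp (- (2 * real (horizon n) * (real j / real n) ^ 2))" for n
  define hi where "hi n = (1 / (1 - real j / real n)) ^ (j * R)" for n
  let ?W = "\<lambda>n p. early_weight R (\<lambda>r. 1 - u r) (\<lambda>r. t r n) p"
  let ?e = "\<lambda>n. avg n (horizon n) (\<lambda>p. esym {1..n} (?W n p) j)" and ?EA = "\<lambda>n A. avg n (horizon n) (\<lambda>p. \<Prod>i\<in>A. ?W n p i)"
  have nb: "(\<lambda>n. real n * b n) \<longlonglongrightarrow> c"
  proof -
    have "(\<lambda>n. \<Sum>r\<le>R. (1 - u r) / fact r * (real n * ((real (t 0 n) / real n) ^ r * exp (- (real (t r n) / real n)))))
       \<longlonglongrightarrow> (\<Sum>r\<le>R. (1 - u r) / fact r * (if r = r then exp (- \<sigma> r) else 0))"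
      by (intro tendsto_sum tendsto_mult tendsto_const critical_time_monomial[OF critical critical]) auto
    then show ?thesis by (simp add: b_def c_def sum_distrib_left mult_ac)
  qed
  have main: "(\<lambda>n. real (n choose j) * b n ^ j) \<longlonglongrightarrow> c ^ j / fact j"
  proof -
    have "(\<lambda>n. (real (n choose j) / real n ^ j) * (real n * b n) ^ j) \<longlonglongrightarrow> 1 / fact j * c ^ j"
      by (intro tendsto_mult tendsto_power nb binomial_over_power)
    moreover have "\<forall>\<^sub>F n in sequentially. (real (n choose j) / real n ^ j) * (real n * b n) ^ j = real (n choose j) * b n ^ j"
      using eventually_ge_at_top[of 1] by eventually_elim (simp add: power_mult_distrib)
    ultimately show ?thesis by (auto dest: Lim_transform_eventually)
  qed
  have lo: "lo \<longlonglongrightarrow> 1" unfolding lo_def by (rule lower_factor)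
  have hi: "hi \<longlonglongrightarrow> 1" unfolding hi_def by (rule upper_factor)
  have bounds: "\<forall>\<^sub>F n in sequentially.
      lo n * (real (n choose j) * b n ^ j) \<le> ?e n \<and>
      ?e n \<le> hi n * (real (n choose j) * b n ^ j)"
    using eventually_ordered eventually_ge_at_top[of "2 * j + 1"]
  proof eventually_elim
    case (elim n)
    let ?S = "{A. A \<subseteq> {1..n} \<and> card A = j}"
    have cS: "card ?S = n choose j" using n_subsets[of "{1..n}" j] by simp
    have eq: "?e n = (\<Sum>A\<in>?S. ?EA n A)"
      unfolding esym_def avg_sum ..
    have A: "lo n * b n ^ j \<le> ?EA n A"
       "?EA n A \<le> hi n * b n ^ j" if "A \<in> ?S" for A
    proof -
      have a: "n \<ge> 1" "A \<subseteq> {1..n}" "1 \<le> t 0 n" "2 * card A \<le> n" "card A = j" using that elim by auto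
      have tt: "t 0 n \<le> t r n \<and> t r n \<le> horizon n" if "r \<le> R" for r using that elim horizon_ge by auto
      have w: "0 \<le> 1 - u r" if "r \<le> R" for r using u[OF that] by simp
      note B = avg_prod_early_weight_bounds[where t = "\<lambda>r. t r n" and w = "\<lambda>r. 1 - u r" and R = R, OF a(1,2,3) tt a(4) w]
      show "lo n * b n ^ j \<le> ?EA n A"
        "?EA n A \<le> hi n * b n ^ j"
        using B unfolding a(5) lo_def hi_def b_def by auto
    qed
    have "(\<Sum>A\<in>?S. lo n * b n ^ j) \<le> (\<Sum>A\<in>?S. ?EA n A)"
      by (intro sum_mono A)
    moreover have "(\<Sum>A\<in>?S. ?EA n A) \<le> (\<Sum>A\<in>?S. hi n * b n ^ j)"
      by (intro sum_mono A)
    ultimately show ?case unfolding eq by (simp only: sum_constant cS mult_ac conj_absorb simp_thms)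
  qed
  show ?thesis
  proof (rule tendsto_sandwich)
    show "(\<lambda>n. lo n * (real (n choose j) * b n ^ j)) \<longlonglongrightarrow> c ^ j / fact j"
      using tendsto_mult[OF lo main] by simp
    show "(\<lambda>n. hi n * (real (n choose j) * b n ^ j)) \<longlonglongrightarrow> c ^ j / fact j"
      using tendsto_mult[OF hi main] by simp
  qed (use bounds in \<open>auto elim: eventually_mono\<close>)
qed

text \<open>The number of types that are scarce at time \<open>t r n\<close> in the typical way: the \<open>r\<close> coupons come before \<open>t 0 n\<close>.\<close>

definition early :: "nat \<Rightarrow> nat \<Rightarrow> (nat \<Rightarrow> nat) \<Rightarrow> nat" where
  "early n r p = card {i\<in>{1..n}. hits p i (t 0 n) = r \<and> hits p i (t r n) = r}"

lemma early_pgf_limit: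
  assumes u: "\<And>r. r \<le> R \<Longrightarrow> u r \<in> {0..1}"
  shows "(\<lambda>n. avg n (horizon n) (\<lambda>p. \<Prod>r\<le>R. u r ^ early n r p))
     \<longlonglongrightarrow> exp (- (\<Sum>r\<le>R. (1 - u r) * exp (- \<sigma> r) / fact r))"
proof -
  let ?W = "\<lambda>n p. early_weight R (\<lambda>r. 1 - u r) (\<lambda>r. t r n) p"
  let ?e = "\<lambda>n j. avg n (horizon n) (\<lambda>p. esym {1..n} (?W n p) j)"
  let ?c = "\<Sum>r\<le>R. (1 - u r) * exp (- \<sigma> r) / fact r"
  have eq: "(\<Prod>r\<le>R. u r ^ early n r p) = (\<Prod>i\<in>{1..n}. 1 - ?W n p i)" for n p
  proof -
    have "(\<Prod>i\<in>{1..n}. 1 - ?W n p i) = (\<Prod>i\<in>{1..n}. \<Prod>r\<le>R. u r ^ of_bool (hits p i (t 0 n) = r \<and> hits p i (t r n) = r))"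
      by (intro prod.cong refl early_weight_disjoint(1)[OF u])
    also have "\<dots> = (\<Prod>r\<le>R. \<Prod>i\<in>{1..n}. u r ^ of_bool (hits p i (t 0 n) = r \<and> hits p i (t r n) = r))"
      by (rule prod.swap)
    also have "\<dots> = (\<Prod>r\<le>R. u r ^ early n r p)"
    proof (rule prod.cong[OF refl])
      fix r
      have "(\<Prod>i\<in>{1..n}. u r ^ of_bool (hits p i (t 0 n) = r \<and> hits p i (t r n) = r)) =
         u r ^ (\<Sum>i\<in>{1..n}. of_bool (hits p i (t 0 n) = r \<and> hits p i (t r n) = r))"
        by (rule power_sum[symmetric])
      also have "(\<Sum>i\<in>{1..n}. of_bool (hits p i (t 0 n) = r \<and> hits p i (t r n) = r)) = early n r p"
        by (simp add: early_def of_bool_def sum.If_cases Int_def)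
      finally show "(\<Prod>i\<in>{1..n}. u r ^ of_bool (hits p i (t 0 n) = r \<and> hits p i (t r n) = r)) =
         u r ^ early n r p" .
    qed
    finally show ?thesis ..
  qed
  show ?thesis unfolding eq
  proof (rule tendsto_of_alternating_bounds)
    fix J
    show "\<forall>\<^sub>F n in sequentially. 0 \<le> (-1) ^ J *
       ((\<Sum>j\<le>J. (-1) ^ j * ?e n j) - avg n (horizon n) (\<lambda>p. \<Prod>i\<in>{1..n}. 1 - ?W n p i))"
      using eventually_ge_at_top[of 1]
    proof eventually_elim
      case (elim n)
      have "avg n (horizon n) (\<lambda>_. 0) \<le> avg n (horizon n) (\<lambda>p. (-1) ^ J *
       ((\<Sum>j\<le>J. (-1) ^ j * esym {1..n} (?W n p) j) - (\<Prod>i\<in>{1..n}. 1 - ?W n p i)))"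
        using early_weight_disjoint(2,3)[OF u] by (intro avg_mono bonferroni) auto
      also have "\<dots> = (-1) ^ J *
       ((\<Sum>j\<le>J. (-1) ^ j * ?e n j) - avg n (horizon n) (\<lambda>p. \<Prod>i\<in>{1..n}. 1 - ?W n p i))"
        by (simp only: avg_cmult avg_diff avg_sum)
      finally show ?case using elim by (simp add: avg_const)
    qed
    show "(\<lambda>n. \<Sum>j\<le>J. (-1) ^ j * ?e n j) \<longlonglongrightarrow> (\<Sum>j\<le>J. (-1) ^ j * (?c ^ j / fact j))"
      by (intro tendsto_sum tendsto_mult tendsto_const expected_esym u)
  next
    have "(\<lambda>j. (- ?c) ^ j /\<^sub>R fact j) sums exp (- ?c)" by (rule exp_converges)
    then have "(\<lambda>J. \<Sum>j\<le>J. (- ?c) ^ j /\<^sub>R fact j) \<longlonglongrightarrow> exp (- ?c)" by (simp add: sums_def_le)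
    moreover have "(- x) ^ j /\<^sub>R fact j = (-1) ^ j * (x ^ j / fact j)" for j and x :: real
      by (subst power_minus) (simp add: divide_inverse mult_ac)
    ultimately show "(\<lambda>J. \<Sum>j\<le>J. (-1) ^ j * (?c ^ j / fact j)) \<longlonglongrightarrow> exp (- ?c)" by (simp only:)
  qed
qed

text \<open>Types that count as scarce at time \<open>t r n\<close> without having all of their \<open>r\<close> coupons by time \<open>t 0 n\<close> can be ignored.
Instead of estimating these types directly, it suffices to compare expectations: both counts have the limiting mean
\<open>exp (- \<sigma> r) / r!\<close>, and one count dominates the other.\<close>

lemma late_hits_negligible:
  assumes r: "r \<le> R"
  shows "(\<lambda>n. avg n (horizon n) (\<lambda>p. real (scarce n r (t r n) p) -
       real (early n r p))) \<longlonglongrightarrow> 0"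
proof -
  define up where "up n = (\<Sum>k\<le>r. (1 / (1 - 1 / real n)) ^ k * ((real (t r n) / real n) ^ k / fact k * exp (- (real (t r n) / real n))))" for n
  define low where "low n = (1 - real (1 * R) ^ 2 / real (t 0 n)) * exp (- (2 * real (horizon n) * (real 1 / real n) ^ 2)) *
     ((real (t 0 n) / real n) ^ r / fact r * exp (- (real (t r n) / real n)))" for n
  have "(\<lambda>n. \<Sum>k\<le>r. (1 / (1 - real 1 / real n)) ^ k / fact k * (real n * ((real (t r n) / real n) ^ k * exp (- (real (t r n) / real n)))))
    \<longlonglongrightarrow> (\<Sum>k\<le>r. 1 / fact k * (if k = r then exp (- \<sigma> r) else 0))"
    by (intro tendsto_sum tendsto_mult tendsto_divide tendsto_const upper_factor critical_time_monomial[OF critical critical] r) auto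
  moreover have "(\<Sum>k\<le>r. 1 / fact k * (if k = r then exp (- \<sigma> r) else 0)) = exp (- \<sigma> r) / fact r"
    by (simp add: if_distrib[of "\<lambda>x. _ * x"] cong: if_cong)
  ultimately have nup: "(\<lambda>n. real n * up n) \<longlonglongrightarrow> exp (- \<sigma> r) / fact r"
    by (simp add: up_def sum_distrib_left mult_ac)
  have "(\<lambda>n. ((1 - real (1 * R) ^ 2 / real (t 0 n)) * exp (- (2 * real (horizon n) * (real 1 / real n) ^ 2))) *
     (1 / fact r * (real n * ((real (t 0 n) / real n) ^ r * exp (- (real (t r n) / real n)))))) \<longlonglongrightarrow> 1 * (1 / fact r * (if r = r then exp (- \<sigma> r) else 0))"
    by (intro tendsto_mult lower_factor tendsto_const critical_time_monomial[OF critical critical] r) auto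
  then have nlow: "(\<lambda>n. real n * low n) \<longlonglongrightarrow> exp (- \<sigma> r) / fact r"
    by (simp add: low_def mult_ac)
  have eq: "avg n (horizon n) (\<lambda>p. real (scarce n r (t r n) p) -
       real (early n r p)) =
     (\<Sum>i\<in>{1..n}. freq n (horizon n) (\<lambda>p. hits p i (t r n) \<le> r) -
        freq n (horizon n) (\<lambda>p. hits p i (t 0 n) = r \<and> hits p i (t r n) = r))" for n
  proof -
    have cd: "real (card {i\<in>{1..n}. P i}) = (\<Sum>i\<in>{1..n}. of_bool (P i))" for P
      by (simp add: of_bool_def sum.If_cases Int_def)
    show ?thesis unfolding scarce_def early_def cd sum_subtractf avg_diff avg_sum ..
  qed
  show ?thesis
  proof (rule tendsto_sandwich)
    show "\<forall>\<^sub>F n in sequentially. avg n (horizon n) (\<lambda>p. real (scarce n r (t r n) p) -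
       real (early n r p)) \<le> real n * up n - real n * low n"
      using eventually_ordered eventually_ge_at_top[of 2]
    proof eventually_elim
      case (elim n)
      have "freq n (horizon n) (\<lambda>p. hits p i (t r n) \<le> r) - freq n (horizon n) (\<lambda>p. hits p i (t 0 n) = r \<and> hits p i (t r n) = r)
        \<le> up n - low n" if i: "i \<in> {1..n}" for i
      proof -
        have a: "1 \<le> t 0 n" "t 0 n \<le> t r n" "t 0 n \<le> horizon n" using elim r horizon_ge[of 0] by auto
        have "freq n (horizon n) (\<lambda>p. hits p i (t r n) \<le> r) \<le> up n"
          unfolding up_def using elim i r horizon_ge a by (intro freq_hits_le) auto
        moreover have "low n \<le> freq n (horizon n) (\<lambda>p. hits p i (t 0 n) = r \<and> hits p i (t r n) = r)"
        proof -
          have "(1 - real r ^ 2 / real (t 0 n)) * exp (- (2 * real (horizon n) * (real 1 / real n) ^ 2)) *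
            ((real (t 0 n) / real n) ^ r / fact r * exp (- (real (t r n) / real n))) \<le>
             freq n (horizon n) (\<lambda>p. hits p i (t 0 n) = r \<and> hits p i (t r n) = r)"
            using freq_early_bounds(2)[where n = n and A = "{i}" and start = "t 0 n" and \<tau> = "\<lambda>_. t r n" and T = "horizon n" and \<rho> = "\<lambda>_. r"]
              a elim i horizon_ge[OF r] by simp
          moreover have "low n \<le> (1 - real r ^ 2 / real (t 0 n)) * exp (- (2 * real (horizon n) * (real 1 / real n) ^ 2)) *
            ((real (t 0 n) / real n) ^ r / fact r * exp (- (real (t r n) / real n)))"
            unfolding low_def using r by (intro mult_right_mono diff_left_mono divide_right_mono power_mono) auto
          ultimately show ?thesis by linarith
        qed
        ultimately show ?thesis by linarith
      qed
      then have "(\<Sum>i\<in>{1..n}. freq n (horizon n) (\<lambda>p. hits p i (t r n) \<le> r) -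
        freq n (horizon n) (\<lambda>p. hits p i (t 0 n) = r \<and> hits p i (t r n) = r)) \<le> (\<Sum>i\<in>{1..n}. up n - low n)"
        by (intro sum_mono)
      then show ?case unfolding eq by (simp add: algebra_simps)
    qed
    show "\<forall>\<^sub>F n in sequentially. 0 \<le> avg n (horizon n) (\<lambda>p. real (scarce n r (t r n) p) -
       real (early n r p))"
      using eventually_ge_at_top[of 1]
    proof eventually_elim
      case (elim n)
      have "avg n (horizon n) (\<lambda>_. 0) \<le> avg n (horizon n) (\<lambda>p. real (scarce n r (t r n) p) -
       real (early n r p))"
        by (intro avg_mono) (auto simp: scarce_def early_def intro!: card_mono)
      then show ?case using elim by (simp add: avg_const)
    qed
    show "(\<lambda>n. real n * up n - real n * low n) \<longlonglongrightarrow> 0"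
      using tendsto_diff[OF nup nlow] by simp
  qed simp
qed

text \<open>Asymptotic independence and Poisson limits of the numbers of scarce types, expressed by the joint generating
function.\<close>

theorem scarce_types_pgf_limit:
  assumes u: "\<And>r. r \<le> R \<Longrightarrow> u r \<in> {0..1}"
  shows "(\<lambda>n. avg n (horizon n) (\<lambda>p. \<Prod>r\<le>R. u r ^ scarce n r (t r n) p))
     \<longlonglongrightarrow> exp (- (\<Sum>r\<le>R. (1 - u r) * exp (- \<sigma> r) / fact r))"
proof -
  let ?Z = "\<lambda>n p r. scarce n r (t r n) p" and ?V = "\<lambda>n p r. early n r p"
  have VZ: "?V n p r \<le> ?Z n p r" for n p r unfolding early_def scarce_def by (intro card_mono) auto
  have close: "\<bar>(\<Prod>r\<le>R. u r ^ ?Z n p r) - (\<Prod>r\<le>R. u r ^ ?V n p r)\<bar> \<le> (\<Sum>r\<le>R. real (?Z n p r) - real (?V n p r))" for n p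
  proof -
    have "norm ((\<Prod>r\<le>R. u r ^ ?Z n p r) - (\<Prod>r\<le>R. u r ^ ?V n p r)) \<le> (\<Sum>r\<le>R. norm (u r ^ ?Z n p r - u r ^ ?V n p r))"
      using u by (intro norm_prod_diff) (auto simp: power_le_one norm_power intro!: power_le_one)
    also have "\<dots> \<le> (\<Sum>r\<le>R. real (?Z n p r) - real (?V n p r))"
    proof (rule sum_mono)
      fix r assume "r \<in> {..R}"
      then have ur: "0 \<le> u r" "u r \<le> 1" using u[of r] by auto
      show "norm (u r ^ ?Z n p r - u r ^ ?V n p r) \<le> real (?Z n p r) - real (?V n p r)"
      proof (cases "?Z n p r = ?V n p r")
        case False
        then have "1 \<le> real (?Z n p r) - real (?V n p r)" using VZ[of n r p] by linarith
        moreover have "0 \<le> u r ^ k" "u r ^ k \<le> 1" for k using ur by (auto intro: power_le_one)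
        then have "norm (u r ^ ?Z n p r - u r ^ ?V n p r) \<le> 1" by (simp add: abs_le_iff) (smt (verit))
        ultimately show ?thesis by linarith
      qed simp
    qed
    finally show ?thesis by simp
  qed
  have "(\<lambda>n. avg n (horizon n) (\<lambda>p. \<Prod>r\<le>R. u r ^ ?Z n p r) - avg n (horizon n) (\<lambda>p. \<Prod>r\<le>R. u r ^ ?V n p r)) \<longlonglongrightarrow> 0"
  proof (rule Lim_null_comparison)
    have "(\<lambda>n. \<Sum>r\<le>R. avg n (horizon n) (\<lambda>p. real (?Z n p r) - real (?V n p r))) \<longlonglongrightarrow> (\<Sum>r\<le>R. 0)"
      by (intro tendsto_sum late_hits_negligible) auto
    then show "(\<lambda>n. \<Sum>r\<le>R. avg n (horizon n) (\<lambda>p. real (?Z n p r) - real (?V n p r))) \<longlonglongrightarrow> 0" by simp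
    have abs: "\<bar>avg n T \<Phi>\<bar> \<le> avg n T \<Psi>" if "\<And>p. \<bar>\<Phi> p\<bar> \<le> \<Psi> p" for n T \<Phi> \<Psi>
      using avg_mono[of n T \<Phi> \<Psi>] avg_mono[of n T "\<lambda>p. - \<Psi> p" \<Phi>] avg_cmult[of n T "-1" \<Psi>] that
      by (auto simp: abs_le_iff) (smt (verit))
    show "\<forall>\<^sub>F n in sequentially. norm (avg n (horizon n) (\<lambda>p. \<Prod>r\<le>R. u r ^ ?Z n p r) - avg n (horizon n) (\<lambda>p. \<Prod>r\<le>R. u r ^ ?V n p r))
       \<le> (\<Sum>r\<le>R. avg n (horizon n) (\<lambda>p. real (?Z n p r) - real (?V n p r)))"
    proof (rule always_eventually, rule allI)
      fix n
      show "norm (avg n (horizon n) (\<lambda>p. \<Prod>r\<le>R. u r ^ ?Z n p r) - avg n (horizon n) (\<lambda>p. \<Prod>r\<le>R. u r ^ ?V n p r))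
       \<le> (\<Sum>r\<le>R. avg n (horizon n) (\<lambda>p. real (?Z n p r) - real (?V n p r)))"
        unfolding real_norm_def avg_diff[symmetric] avg_sum[symmetric] by (rule abs, rule close)
    qed
  qed
  moreover have "(\<lambda>n. avg n (horizon n) (\<lambda>p. \<Prod>r\<le>R. u r ^ ?V n p r)) \<longlonglongrightarrow> exp (- (\<Sum>r\<le>R. (1 - u r) * exp (- \<sigma> r) / fact r))"
    by (rule early_pgf_limit[OF u])
  ultimately show ?thesis by (rule Lim_transform[rotated])
qed

end

section \<open>Arrival times and scarce types\<close>

lemma scarce_mono: "s \<le> t \<Longrightarrow> scarce n r t p \<le> scarce n r s p"
  unfolding scarce_def by (intro card_mono) (auto intro: order_trans[OF hits_mono])

lemma hits_cong: "(\<And>s. s \<in> {1..t} \<Longrightarrow> p s = p' s) \<Longrightarrow> hits p i t = hits p' i t"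
  unfolding hits_def by (rule arg_cong[where f = card]) auto

lemma scarce_cong: "(\<And>s. s \<in> {1..t} \<Longrightarrow> p s = p' s) \<Longrightarrow> scarce n r t p = scarce n r t p'"
  unfolding scarce_def using hits_cong[of t p p'] by simp

text \<open>A count that starts at \<open>0\<close> and grows by steps of at most \<open>1\<close> passes through the value \<open>r + 1\<close>.\<close>

lemma arrival_time_le_iff: "arrival_time C i r \<omega> \<le> enat t \<longleftrightarrow> r + 1 \<le> hits (\<lambda>s. C s \<omega>) i t"
proof -
  let ?p = "\<lambda>s. C s \<omega>"
  let ?S = "{t. 1 \<le> t \<and> C t \<omega> = i \<and> hits ?p i t = r + 1}"
  have arr: "arrival_time C i r \<omega> = Inf (enat ` ?S)"
    unfolding arrival_time_def hits_def ..
  show ?thesis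
  proof
    assume le: "arrival_time C i r \<omega> \<le> enat t"
    have "\<exists>t'\<in>?S. t' \<le> t"
    proof (rule ccontr)
      assume "\<not> ?thesis"
      then have "enat (Suc t) \<le> Inf (enat ` ?S)" by (intro Inf_greatest) force
      then have "enat (Suc t) \<le> enat t" using le unfolding arr by (rule order_trans)
      then show False by simp
    qed
    then show "r + 1 \<le> hits ?p i t" using hits_mono by (metis (mono_tags, lifting) mem_Collect_eq)
  next
    assume ge: "r + 1 \<le> hits ?p i t"
    define t' where "t' = (LEAST t. r + 1 \<le> hits ?p i t)"
    have t': "r + 1 \<le> hits ?p i t'" "t' \<le> t"
      unfolding t'_def using ge by (auto intro: LeastI Least_le)
    then obtain k where k: "t' = Suc k" by (cases t') auto
    then have "\<not> r + 1 \<le> hits ?p i k" unfolding t'_def by (metis lessI not_less_Least)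
    then have "t' \<in> ?S" using t'(1) unfolding k by (cases "C (Suc k) \<omega> = i") (auto simp: hits_Suc)
    then have "Inf (enat ` ?S) \<le> enat t'" by (intro Inf_lower) auto
    then show "arrival_time C i r \<omega> \<le> enat t" unfolding arr using order_trans[of _ "enat t'" "enat t"] t'(2) by simp
  qed
qed

lemma completion_time_le_iff:
  assumes "n \<ge> 1"
  shows "completion_time n C \<omega> \<le> enat t \<longleftrightarrow> scarce n 0 t (\<lambda>s. C s \<omega>) = 0"
proof -
  have *: "(\<forall>j\<in>S. 1 \<le> f j) \<longleftrightarrow> {i\<in>S. f i \<le> (0::nat)} = {}" for S :: "nat set" and f
    by (auto simp: Suc_le_eq)
  have "completion_time n C \<omega> \<le> enat t \<longleftrightarrow> (\<forall>j\<in>{1..n}. 1 \<le> hits (\<lambda>s. C s \<omega>) j t)"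
    unfolding completion_time_def using assms by (subst Max_le_iff) (auto simp: arrival_time_le_iff)
  also have "\<dots> \<longleftrightarrow> {i\<in>{1..n}. hits (\<lambda>s. C s \<omega>) i t \<le> 0} = {}"
    using *[of "{1..n}"] .
  also have "\<dots> \<longleftrightarrow> scarce n 0 t (\<lambda>s. C s \<omega>) = 0" unfolding scarce_def by (rule card_0_eq[symmetric]) simp
  finally show ?thesis .
qed

lemma empty_spots_eq:
  "empty_spots n C r d \<omega> =
     (case completion_time n C \<omega> of enat T \<Rightarrow> scarce n r (T + d) (\<lambda>s. C s \<omega>) | \<infinity> \<Rightarrow> 0)"
proof (cases "completion_time n C \<omega>")
  case (enat T)
  have "(enat T + enat d < arrival_time C i r \<omega>) \<longleftrightarrow> hits (\<lambda>s. C s \<omega>) i (T + d) \<le> r" for i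
    using arrival_time_le_iff[of C i r \<omega> "T + d"] by (simp add: not_le[symmetric] not_less_eq_eq)
  then show ?thesis unfolding empty_spots_def scarce_def enat by simp
qed (simp add: empty_spots_def)

locale coupon_collector =
  fixes M :: "'a measure" and n :: nat and C :: "nat \<Rightarrow> 'a \<Rightarrow> nat"
  assumes coupons: "coupon_sequence M n C" and n_pos: "n \<ge> 1"
begin

sublocale prob_space M using coupons unfolding coupon_sequence_def by blast

lemma coupons_indep: "indep_vars (\<lambda>_. count_space UNIV) C {1..}"
  using coupons unfolding coupon_sequence_def by blast

lemma coupon_measurable: "t \<ge> 1 \<Longrightarrow> C t \<in> measurable M (count_space UNIV)"
  using coupons_indep unfolding indep_vars_def by simp

lemma coupon_uniform:
  assumes "t \<ge> 1" "i \<in> {1..n}"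
  shows "prob (C t -` {i} \<inter> space M) = 1 / real n"
proof -
  have "prob (C t -` {i} \<inter> space M) = measure (distr M (count_space UNIV) (C t)) {i}"
    using coupon_measurable assms by (subst measure_distr) auto
  also have "distr M (count_space UNIV) (C t) = measure_pmf (pmf_of_set {1..n})"
    using coupons assms unfolding coupon_sequence_def by blast
  also have "measure (measure_pmf (pmf_of_set {1..n})) {i} = 1 / real n"
    using assms by (simp add: measure_pmf_single indicator_def)
  finally show ?thesis .
qed

text \<open>Finitely many coupons generate a discrete \<open>\<sigma>\<close>-algebra, on which every function is measurable.\<close>

lemma path_measurable:
  fixes \<Phi> :: "(nat \<Rightarrow> nat) \<Rightarrow> 'b"
  assumes "\<And>p p'. (\<And>s. s \<in> {1..T} \<Longrightarrow> p s = p' s) \<Longrightarrow> \<Phi> p = \<Phi> p'" and sp: "space N = UNIV"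
  shows "(\<lambda>\<omega>. \<Phi> (\<lambda>s. C s \<omega>)) \<in> measurable M N"
proof -
  let ?P = "PiM {1..T} (\<lambda>_. count_space (UNIV :: nat set))"
  have P: "?P = count_space ({1..T} \<rightarrow>\<^sub>E UNIV)" by (rule count_space_PiM_finite) auto
  have "(\<lambda>\<omega>. \<lambda>s\<in>{1..T}. C s \<omega>) \<in> measurable M ?P"
    by (intro measurable_restrict coupon_measurable) auto
  moreover have "\<Phi> \<in> measurable ?P N" unfolding P by (simp add: sp)
  ultimately have "(\<lambda>\<omega>. \<Phi> (\<lambda>s\<in>{1..T}. C s \<omega>)) \<in> measurable M N" by (rule measurable_compose)
  also have "(\<lambda>\<omega>. \<Phi> (\<lambda>s\<in>{1..T}. C s \<omega>)) = (\<lambda>\<omega>. \<Phi> (\<lambda>s. C s \<omega>))"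
    by (intro ext assms) simp
  finally show ?thesis .
qed

lemma expectation_path:
  fixes \<Phi> :: "(nat \<Rightarrow> nat) \<Rightarrow> real"
  assumes dep: "\<And>p p'. (\<And>s. s \<in> {1..T} \<Longrightarrow> p s = p' s) \<Longrightarrow> \<Phi> p = \<Phi> p'"
  shows "expectation (\<lambda>\<omega>. \<Phi> (\<lambda>s. C s \<omega>)) = avg n T \<Phi>"
proof -
  define E where "E p = {\<omega> \<in> space M. \<forall>s\<in>{1..T}. C s \<omega> = p s}" for p
  have E_sets: "E p \<in> events" for p
  proof -
    have "(\<lambda>\<omega>. \<forall>s\<in>{1..T}. C s \<omega> = p s) \<in> measurable M (count_space UNIV)"
      using path_measurable[of T "\<lambda>q. \<forall>s\<in>{1..T}. q s = p s"] by simp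
    then show ?thesis unfolding E_def by simp
  qed
  have E_prob: "prob (E p) = 1 / real n ^ T" if p: "p \<in> paths n T" for p
  proof (cases "T = 0")
    case False
    have "E p = (\<Inter>s\<in>{1..T}. C s -` {p s} \<inter> space M)" using False unfolding E_def by auto
    then have "prob (E p) = prob (\<Inter>s\<in>{1..T}. C s -` {p s} \<inter> space M)" by (rule arg_cong)
    also have "\<dots> = (\<Prod>s\<in>{1..T}. prob (C s -` {p s} \<inter> space M))"
      using False by (intro indep_varsD[OF coupons_indep]) auto
    also have "\<dots> = (\<Prod>s\<in>{1..T}. 1 / real n)"
      using paths_mem[OF p] by (intro prod.cong coupon_uniform) auto
    finally show ?thesis by (simp add: power_one_over)
  qed (simp add: E_def prob_space)
  have disj: "p = q" if "p \<in> paths n T" "q \<in> paths n T" "\<omega> \<in> E p" "\<omega> \<in> E q" for p q \<omega>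
    using that unfolding paths_def E_def by (intro PiE_ext) auto
  have "prob (\<Union>p\<in>paths n T. E p) = (\<Sum>p\<in>paths n T. prob (E p))"
    using E_sets disj by (intro finite_measure_finite_Union) (auto simp: disjoint_family_on_def)
  also have "\<dots> = 1" using n_pos by (simp add: E_prob card_paths)
  finally have U: "prob (\<Union>p\<in>paths n T. E p) = 1" .
  have "AE \<omega> in M. \<omega> \<in> (\<Union>p\<in>paths n T. E p)"
    using U E_sets by (subst prob_eq_1[symmetric]) (auto intro!: sets.finite_UN)
  then have "AE \<omega> in M. \<Phi> (\<lambda>s. C s \<omega>) = (\<Sum>p\<in>paths n T. \<Phi> p * indicator (E p) \<omega>)"
  proof (rule AE_mp, intro AE_I2 impI)
    fix \<omega> assume "\<omega> \<in> (\<Union>p\<in>paths n T. E p)"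
    then obtain p where p: "p \<in> paths n T" "\<omega> \<in> E p" by blast
    have "(\<Sum>q\<in>paths n T. \<Phi> q * indicator (E q) \<omega>) = (\<Sum>q\<in>paths n T. if q = p then \<Phi> p else 0)"
      using disj p by (intro sum.cong) (auto simp: indicator_def)
    also have "\<dots> = \<Phi> p" using p by simp
    also have "\<Phi> p = \<Phi> (\<lambda>s. C s \<omega>)" using p by (intro dep) (auto simp: E_def)
    finally show "\<Phi> (\<lambda>s. C s \<omega>) = (\<Sum>q\<in>paths n T. \<Phi> q * indicator (E q) \<omega>)" ..
  qed
  then have "expectation (\<lambda>\<omega>. \<Phi> (\<lambda>s. C s \<omega>)) = expectation (\<lambda>\<omega>. \<Sum>p\<in>paths n T. \<Phi> p * indicator (E p) \<omega>)"
  proof (intro integral_cong_AE)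
    show "(\<lambda>\<omega>. \<Phi> (\<lambda>s. C s \<omega>)) \<in> borel_measurable M"
      by (rule path_measurable[of T \<Phi> borel, OF dep]) auto
    show "(\<lambda>\<omega>. \<Sum>p\<in>paths n T. \<Phi> p * indicator (E p) \<omega>) \<in> borel_measurable M"
      by (intro borel_measurable_sum borel_measurable_times borel_measurable_const borel_measurable_indicator E_sets)
  qed
  also have "\<dots> = (\<Sum>p\<in>paths n T. \<Phi> p * prob (E p))"
  proof -
    have "integrable M (indicator (E p) :: _ \<Rightarrow> real)" for p
      by (rule integrable_real_indicator[OF E_sets]) (simp add: less_top[symmetric])
    then show ?thesis using E_sets by (subst Bochner_Integration.integral_sum) auto
  qed
  also have "\<dots> = avg n T \<Phi>" unfolding avg_def sum_divide_distrib by (intro sum.cong) (simp_all add: E_prob)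
  finally show ?thesis .
qed

lemma empty_spots_measurable: "(\<lambda>\<omega>. empty_spots n C r d \<omega>) \<in> measurable M (count_space UNIV)"
proof -
  have sc: "(\<lambda>\<omega>. scarce n r t (\<lambda>s. C s \<omega>)) \<in> measurable M (count_space UNIV)" for r t
    by (rule path_measurable[of t]) (auto intro: scarce_cong)
  have le: "(\<lambda>\<omega>. completion_time n C \<omega> \<le> enat t) \<in> measurable M (count_space UNIV)" for t
    unfolding completion_time_le_iff[OF n_pos] by (rule measurable_compose[OF sc]) simp
  have eq: "(completion_time n C \<omega> = enat t) \<longleftrightarrow> completion_time n C \<omega> \<le> enat t \<and> (\<forall>s<t. \<not> completion_time n C \<omega> \<le> enat s)" for t \<omega>
    by (cases "completion_time n C \<omega>") (auto simp: not_le, metis le_neq_implies_less less_irrefl)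
  have eqm: "Measurable.pred M (\<lambda>\<omega>. completion_time n C \<omega> = enat t)" for t
    unfolding eq using le by measurable
  have "(\<lambda>\<omega>. empty_spots n C r d \<omega> = k) \<in> measurable M (count_space UNIV)" for k
  proof -
    have "empty_spots n C r d \<omega> = k \<longleftrightarrow>
      (\<exists>t. completion_time n C \<omega> = enat t \<and> scarce n r (t + d) (\<lambda>s. C s \<omega>) = k) \<or>
      ((\<forall>t. completion_time n C \<omega> \<noteq> enat t) \<and> k = 0)" for \<omega>
      unfolding empty_spots_eq by (cases "completion_time n C \<omega>") auto
    then have eqv: "(\<lambda>\<omega>. empty_spots n C r d \<omega> = k) = (\<lambda>\<omega>.
      (\<exists>t. completion_time n C \<omega> = enat t \<and> scarce n r (t + d) (\<lambda>s. C s \<omega>) = k) \<or>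
      ((\<forall>t. completion_time n C \<omega> \<noteq> enat t) \<and> k = 0))" by (intro ext)
    have scm: "Measurable.pred M (\<lambda>\<omega>. scarce n r (t + d) (\<lambda>s. C s \<omega>) = k)" for t
      by (rule measurable_compose[OF sc]) simp
    note eqm[measurable] scm[measurable]
    show ?thesis unfolding eqv by measurable
  qed
  then have "(\<lambda>\<omega>. empty_spots n C r d \<omega>) -` {k} \<inter> space M \<in> sets M" for k
    by (simp add: pred_def vimage_def Int_def conj_commute)
  then show ?thesis by (simp add: measurable_count_space_eq2_countable)
qed

text \<open>If collector \<open>0\<close> finishes between \<open>s\<close> and \<open>s'\<close>, then monotonicity in time encloses the empty spots at the random
time between the numbers of scarce types at two deterministic times.\<close>

lemma empty_spots_between:
  assumes "s \<le> s'" "scarce n 0 s' (\<lambda>s. C s \<omega>) = 0" "scarce n 0 s (\<lambda>s. C s \<omega>) \<noteq> 0"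
  shows "scarce n r (s' + d) (\<lambda>s. C s \<omega>) \<le> empty_spots n C r d \<omega>"
    and "empty_spots n C r d \<omega> \<le> scarce n r (s + d) (\<lambda>s. C s \<omega>)"
proof -
  have "completion_time n C \<omega> \<le> enat s'" "\<not> completion_time n C \<omega> \<le> enat s"
    using assms by (simp_all add: completion_time_le_iff[OF n_pos])
  then obtain T where T: "completion_time n C \<omega> = enat T" "s \<le> T" "T \<le> s'"
    by (cases "completion_time n C \<omega>") auto
  then show "scarce n r (s' + d) (\<lambda>s. C s \<omega>) \<le> empty_spots n C r d \<omega>"
    "empty_spots n C r d \<omega> \<le> scarce n r (s + d) (\<lambda>s. C s \<omega>)"
    by (auto simp: empty_spots_eq intro!: scarce_mono)
qed

text \<open>Here \<open>Y (Suc k) l - Y k l\<close> is the expectation of the product of the \<open>u r ^ scarce n r (s l + d r)\<close> on the event that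
collector \<open>0\<close> finishes between \<open>s k\<close> and \<open>s (Suc k)\<close>.  Since \<open>u r \<le> 1\<close>, fewer empty spots give a larger product, so
\<open>l = k\<close> is the lower and \<open>l = Suc k\<close> the upper bound.  The two extra terms of the upper bound are the probabilities of
finishing before the first or after the last grid point.\<close>

lemma empty_spots_pgf_bounds:
  fixes s :: "nat \<Rightarrow> nat" and d :: "nat \<Rightarrow> nat"
  assumes u: "\<And>r. r \<in> {1..R} \<Longrightarrow> u r \<in> {0..1::real}" and s: "\<And>k. k < m \<Longrightarrow> s k \<le> s (Suc k)"
    and T: "\<And>k r. k \<le> m \<Longrightarrow> r \<in> {1..R} \<Longrightarrow> s k + d r \<le> T" and T': "\<And>k. k \<le> m \<Longrightarrow> s k \<le> T"
  defines "X \<equiv> \<lambda>\<omega>. \<Prod>r\<in>{1..R}. u r ^ empty_spots n C r (d r) \<omega>"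
    and "Y \<equiv> \<lambda>k l. avg n T (\<lambda>p. of_bool (scarce n 0 (s k) p = 0) * (\<Prod>r\<in>{1..R}. u r ^ scarce n r (s l + d r) p))"
    and "A \<equiv> \<lambda>k. avg n T (\<lambda>p. of_bool (scarce n 0 (s k) p = 0))"
  shows "(\<Sum>k<m. Y (Suc k) k - Y k k) \<le> expectation X"
    and "expectation X \<le> A 0 + (\<Sum>k<m. Y (Suc k) (Suc k) - Y k (Suc k)) + (1 - A m)"
proof -
  define a where "a k p = (of_bool (scarce n 0 (s k) p = 0) :: real)" for k p
  define q where "q l p = (\<Prod>r\<in>{1..R}. u r ^ scarce n r (s l + d r) p)" for l p
  let ?c = "\<lambda>\<omega> s. C s \<omega>"
  let ?D = "\<lambda>k \<omega>. a (Suc k) (?c \<omega>) - a k (?c \<omega>)"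
  have a_mono: "a k p \<le> a (Suc k) p" if "k < m" for k p
    using scarce_mono[OF s[OF that], of n 0 p] unfolding a_def by auto
  have X01: "0 \<le> X \<omega>" "X \<omega> \<le> 1" for \<omega>
    unfolding X_def using u by (auto intro!: prod_nonneg prod_le_1 power_le_one)
  have step: "?D k \<omega> * q k (?c \<omega>) \<le> ?D k \<omega> * X \<omega> \<and>
     ?D k \<omega> * X \<omega> \<le> ?D k \<omega> * q (Suc k) (?c \<omega>)"
    if k: "k < m" for k \<omega>
  proof (cases "scarce n 0 (s (Suc k)) (?c \<omega>) = 0 \<and> scarce n 0 (s k) (?c \<omega>) \<noteq> 0")
    case True
    note b = empty_spots_between[OF s[OF k] conjunct1[OF True] conjunct2[OF True]]
    have "q k (?c \<omega>) \<le> X \<omega>" unfolding q_def X_def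
      using u b(2) by (intro prod_mono) (auto intro!: power_decreasing)
    moreover have "X \<omega> \<le> q (Suc k) (?c \<omega>)" unfolding q_def X_def
      using u b(1) by (intro prod_mono) (auto intro!: power_decreasing)
    ultimately show ?thesis using True by (simp add: a_def)
  next
    case False
    then have "?D k \<omega> = 0" using a_mono[OF k, of "?c \<omega>"] unfolding a_def by (auto split: if_splits)
    then show ?thesis by simp
  qed
  have tele: "(\<Sum>k<m. (a (Suc k) p - a k p) * x) = (a m p - a 0 p) * x" for p x
    using sum_lessThan_telescope[of "\<lambda>k. a k p" m] by (simp flip: sum_distrib_right)
  have a01: "0 \<le> a k p" "a k p \<le> 1" for k p by (auto simp: a_def)
  have lower: "(\<Sum>k<m. ?D k \<omega> * q k (?c \<omega>)) \<le> X \<omega>" for \<omega>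
  proof -
    have "(\<Sum>k<m. ?D k \<omega> * q k (?c \<omega>)) \<le> (a m (?c \<omega>) - a 0 (?c \<omega>)) * X \<omega>"
      unfolding tele[symmetric] using step by (intro sum_mono) auto
    also have "\<dots> \<le> 1 * X \<omega>" using a01[of m "?c \<omega>"] a01[of 0 "?c \<omega>"] X01 by (intro mult_right_mono) auto
    finally show ?thesis by simp
  qed
  have upper: "X \<omega> \<le> a 0 (?c \<omega>) + (\<Sum>k<m. ?D k \<omega> * q (Suc k) (?c \<omega>)) + (1 - a m (?c \<omega>))" for \<omega>
  proof -
    have "X \<omega> = a 0 (?c \<omega>) * X \<omega> + (a m (?c \<omega>) - a 0 (?c \<omega>)) * X \<omega> + (1 - a m (?c \<omega>)) * X \<omega>"
      by (simp add: algebra_simps)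
    also have "\<dots> \<le> a 0 (?c \<omega>) * 1 + (\<Sum>k<m. ?D k \<omega> * q (Suc k) (?c \<omega>)) + (1 - a m (?c \<omega>)) * 1"
    proof (intro add_mono)
      show "(a m (?c \<omega>) - a 0 (?c \<omega>)) * X \<omega> \<le> (\<Sum>k<m. ?D k \<omega> * q (Suc k) (?c \<omega>))"
        unfolding tele[symmetric] using step by (intro sum_mono) auto
    qed (use a01 X01 in \<open>auto intro!: mult_left_le\<close>)
    finally show ?thesis by simp
  qed
  have X_meas: "X \<in> borel_measurable M"
  proof -
    have "(\<lambda>\<omega>. u r ^ empty_spots n C r (d r) \<omega>) \<in> borel_measurable M" for r
      by (rule measurable_compose[OF empty_spots_measurable]) simp
    then show ?thesis unfolding X_def by measurable
  qed
  have X_int: "integrable M X"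
    using X01 X_meas by (intro integrable_const_bound[where B = 1]) auto
  have q01: "0 \<le> q k p" "q k p \<le> 1" for k p
    unfolding q_def using u by (auto intro!: prod_nonneg prod_le_1 power_le_one)
  have dep_a: "a k p = a k p'" if "k \<le> m" "\<And>s. s \<in> {1..T} \<Longrightarrow> p s = p' s" for k p p'
  proof -
    have "scarce n 0 (s k) p = scarce n 0 (s k) p'"
      using that(2) T'[OF that(1)] by (intro scarce_cong) auto
    then show ?thesis by (simp add: a_def)
  qed
  have dep_q: "q l p = q l p'" if "l \<le> m" "\<And>s. s \<in> {1..T} \<Longrightarrow> p s = p' s" for l p p'
    unfolding q_def
  proof (rule prod.cong[OF refl])
    fix r assume r: "r \<in> {1..R}"
    have "scarce n r (s l + d r) p = scarce n r (s l + d r) p'"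
      using that(2) T[OF that(1) r] by (intro scarce_cong) auto
    then show "u r ^ scarce n r (s l + d r) p = u r ^ scarce n r (s l + d r) p'" by simp
  qed
  have dep_aq: "a k p * q l p = a k p' * q l p'"
    if "k \<le> m" "l \<le> m" "\<And>s. s \<in> {1..T} \<Longrightarrow> p s = p' s" for k l p p'
    by (simp only: dep_a[OF that(1,3)] dep_q[OF that(2,3)])
  have aq_int: "integrable M (\<lambda>\<omega>. a k (?c \<omega>) * q l (?c \<omega>))" and a_int: "integrable M (\<lambda>\<omega>. a k (?c \<omega>))"
    and aq_E: "expectation (\<lambda>\<omega>. a k (?c \<omega>) * q l (?c \<omega>)) = Y k l" and a_E: "expectation (\<lambda>\<omega>. a k (?c \<omega>)) = A k"
    if "k \<le> m" "l \<le> m" for k l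
  proof -
    have 1: "(\<lambda>\<omega>. a k (?c \<omega>) * q l (?c \<omega>)) \<in> borel_measurable M"
      by (rule path_measurable[of T "\<lambda>p. a k p * q l p" borel, OF dep_aq[OF that]]) auto
    have 2: "(\<lambda>\<omega>. a k (?c \<omega>)) \<in> borel_measurable M"
      by (rule path_measurable[of T "a k" borel, OF dep_a[OF that(1)]]) auto
    have "a k p * q l p \<le> 1" for p using a01[of k p] q01[of l p] by (intro mult_le_one) auto
    then show "integrable M (\<lambda>\<omega>. a k (?c \<omega>) * q l (?c \<omega>))"
      using a01 q01 by (intro integrable_const_bound[where B = 1] 1) auto
    show "integrable M (\<lambda>\<omega>. a k (?c \<omega>))"
      using a01 by (intro integrable_const_bound[where B = 1] 2) auto
    have "expectation (\<lambda>\<omega>. a k (?c \<omega>) * q l (?c \<omega>)) = avg n T (\<lambda>p. a k p * q l p)"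
      by (rule expectation_path[of T "\<lambda>p. a k p * q l p", OF dep_aq[OF that]]) auto
    then show "expectation (\<lambda>\<omega>. a k (?c \<omega>) * q l (?c \<omega>)) = Y k l" unfolding Y_def a_def q_def .
    have "expectation (\<lambda>\<omega>. a k (?c \<omega>)) = avg n T (a k)"
      by (rule expectation_path[of T "a k", OF dep_a[OF that(1)]]) auto
    then show "expectation (\<lambda>\<omega>. a k (?c \<omega>)) = A k" unfolding A_def a_def .
  qed
  have sum_int: "integrable M (\<lambda>\<omega>. \<Sum>k<m. ?D k \<omega> * q (f k) (?c \<omega>))"
    and sum_E: "expectation (\<lambda>\<omega>. \<Sum>k<m. ?D k \<omega> * q (f k) (?c \<omega>)) =
      (\<Sum>k<m. Y (Suc k) (f k) - Y k (f k))" if f: "\<And>k. k < m \<Longrightarrow> f k \<le> m" for f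
  proof -
    have i: "integrable M (\<lambda>\<omega>. ?D k \<omega> * q (f k) (?c \<omega>))" if "k < m" for k
      using that f[OF that] unfolding left_diff_distrib by (intro Bochner_Integration.integrable_diff aq_int) auto
    then show "integrable M (\<lambda>\<omega>. \<Sum>k<m. ?D k \<omega> * q (f k) (?c \<omega>))"
      by (intro Bochner_Integration.integrable_sum) auto
    have "expectation (\<lambda>\<omega>. ?D k \<omega> * q (f k) (?c \<omega>)) = Y (Suc k) (f k) - Y k (f k)" if "k < m" for k
      using that f[OF that] unfolding left_diff_distrib
      by (subst Bochner_Integration.integral_diff) (auto simp: aq_int aq_E)
    then show "expectation (\<lambda>\<omega>. \<Sum>k<m. ?D k \<omega> * q (f k) (?c \<omega>)) =
      (\<Sum>k<m. Y (Suc k) (f k) - Y k (f k))"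
      using i by (subst Bochner_Integration.integral_sum) auto
  qed
  have "expectation (\<lambda>\<omega>. \<Sum>k<m. ?D k \<omega> * q k (?c \<omega>)) \<le> expectation X"
    using sum_int[of "\<lambda>k. k"] X_int lower by (intro integral_mono) auto
  then show "(\<Sum>k<m. Y (Suc k) k - Y k k) \<le> expectation X" using sum_E[of "\<lambda>k. k"] by simp
  let ?S = "\<lambda>\<omega>. \<Sum>k<m. ?D k \<omega> * q (Suc k) (?c \<omega>)"
  have S: "integrable M ?S" "expectation ?S = (\<Sum>k<m. Y (Suc k) (Suc k) - Y k (Suc k))"
    using sum_int[of Suc] sum_E[of Suc] by auto
  have ai: "integrable M (\<lambda>\<omega>. a 0 (?c \<omega>))" "integrable M (\<lambda>\<omega>. a m (?c \<omega>))"
    using a_int[of 0 0] a_int[of m m] by simp_all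
  have aE: "expectation (\<lambda>\<omega>. a 0 (?c \<omega>)) = A 0" "expectation (\<lambda>\<omega>. a m (?c \<omega>)) = A m"
    using a_E[of 0 0] a_E[of m m] by simp_all
  have "expectation X \<le> expectation (\<lambda>\<omega>. a 0 (?c \<omega>) + ?S \<omega> + (1 - a m (?c \<omega>)))"
    using S X_int upper ai by (intro integral_mono) auto
  also have "\<dots> = A 0 + (\<Sum>k<m. Y (Suc k) (Suc k) - Y k (Suc k)) + (1 - A m)"
    using S ai aE by (simp add: prob_space)
  finally show "expectation X \<le> A 0 + (\<Sum>k<m. Y (Suc k) (Suc k) - Y k (Suc k)) + (1 - A m)" .
qed

end

section \<open>Summation over the completion time\<close>

lemma powr_riemann_step:
  fixes a b c :: real
  assumes "0 \<le> a" "a < b" "0 \<le> c"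
  shows "(b - a) * a powr c \<le> (b powr (1 + c) - a powr (1 + c)) / (1 + c)"
    and "(b powr (1 + c) - a powr (1 + c)) / (1 + c) \<le> (b - a) * b powr c"
proof -
  have "(b - a) * a powr c \<le> (b powr (1 + c) - a powr (1 + c)) / (1 + c) \<and>
    (b powr (1 + c) - a powr (1 + c)) / (1 + c) \<le> (b - a) * b powr c"
  proof (cases "a = 0")
    case True
    have "b powr (1 + c) = b * b powr c" using assms by (simp add: powr_add)
    moreover have "b * b powr c / (1 + c) \<le> b * b powr c / 1"
      using assms by (intro divide_left_mono) auto
    ultimately show ?thesis using True assms by simp
  next
    case False
    then have a: "a > 0" using assms by simp
    have "\<exists>z>a. z < b \<and> b powr (1 + c) / (1 + c) - a powr (1 + c) / (1 + c) = (b - a) * z powr c"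
    proof (rule MVT2[OF \<open>a < b\<close>])
      fix x assume "a \<le> x"
      then have "x > 0" using a by simp
      then show "((\<lambda>x. x powr (1 + c) / (1 + c)) has_real_derivative x powr c) (at x)"
        using assms by (auto intro!: derivative_eq_intros)
    qed
    then obtain z where z: "a < z" "z < b" "(b powr (1 + c) - a powr (1 + c)) / (1 + c) = (b - a) * z powr c"
      by (auto simp: diff_divide_distrib)
    then show ?thesis using a assms by (auto intro!: powr_mono2)
  qed
  then show "(b - a) * a powr c \<le> (b powr (1 + c) - a powr (1 + c)) / (1 + c)"
    "(b powr (1 + c) - a powr (1 + c)) / (1 + c) \<le> (b - a) * b powr c" by auto
qed

text \<open>Lower and upper Riemann sums for the integral of \<open>x powr c\<close> over \<open>{0..1}\<close>.\<close>

lemma powr_riemann_sum: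
  fixes c :: real and K :: nat
  assumes K: "K \<ge> 1" and c: "0 \<le> c"
  shows "(\<Sum>j<K. (real j / real K) powr c / real K) \<le> 1 / (1 + c)"
    and "1 / (1 + c) \<le> (\<Sum>j<K. (real (Suc j) / real K) powr c / real K)"
proof -
  let ?x = "\<lambda>j. real j / real K"
  have w: "?x (Suc j) - ?x j = 1 / real K" for j using K by (simp add: field_simps)
  have lt: "?x j < ?x (Suc j)" for j using K by (intro divide_strict_right_mono) auto
  have tele: "(\<Sum>j<K. (?x (Suc j) powr (1 + c) - ?x j powr (1 + c)) / (1 + c)) = 1 / (1 + c)"
    using K c sum_lessThan_telescope[of "\<lambda>j. ?x j powr (1 + c)" K]
    by (simp flip: sum_divide_distrib)
  have "(\<Sum>j<K. ?x j powr c / real K) \<le> (\<Sum>j<K. (?x (Suc j) powr (1 + c) - ?x j powr (1 + c)) / (1 + c))"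
  proof (rule sum_mono)
    fix j
    have "0 \<le> ?x j" by simp
    from powr_riemann_step(1)[OF this lt c]
    show "?x j powr c / real K \<le> (?x (Suc j) powr (1 + c) - ?x j powr (1 + c)) / (1 + c)"
      unfolding w by simp
  qed
  then show "(\<Sum>j<K. ?x j powr c / real K) \<le> 1 / (1 + c)" unfolding tele .
  have "(\<Sum>j<K. (?x (Suc j) powr (1 + c) - ?x j powr (1 + c)) / (1 + c)) \<le> (\<Sum>j<K. ?x (Suc j) powr c / real K)"
  proof (rule sum_mono)
    fix j
    have "0 \<le> ?x j" by simp
    from powr_riemann_step(2)[OF this lt c]
    show "(?x (Suc j) powr (1 + c) - ?x j powr (1 + c)) / (1 + c) \<le> ?x (Suc j) powr c / real K"
      unfolding w by simp
  qed
  then show "1 / (1 + c) \<le> (\<Sum>j<K. ?x (Suc j) powr c / real K)" unfolding tele .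
qed

text \<open>The grid times; the completion time of collector \<open>0\<close> is at most \<open>gumbel_time \<sigma> n\<close> with a probability that tends to
the Gumbel distribution function \<open>exp (- exp (- \<sigma>))\<close>.\<close>

definition gumbel_time :: "real \<Rightarrow> nat \<Rightarrow> nat" where
  "gumbel_time \<sigma> n = nat \<lfloor>real n * ln (real n) + \<sigma> * real n\<rfloor>"

lemma gumbel_time_mono: "\<sigma> \<le> \<sigma>' \<Longrightarrow> gumbel_time \<sigma> n \<le> gumbel_time \<sigma>' n"
  unfolding gumbel_time_def by (intro nat_mono floor_mono add_left_mono mult_right_mono) auto

lemma critical_gumbel_time_add:
  assumes d: "(\<lambda>n. real (d n) - real r * real n * ln (ln (real n))) \<in> o(\<lambda>n. real n)"
  shows "critical_time r \<sigma> (\<lambda>n. gumbel_time \<sigma> n + d n)"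
proof -
  let ?y = "\<lambda>n. real n * ln (real n) + \<sigma> * real n"
  have "(\<lambda>n. (real (d n) - real r * real n * ln (ln (real n))) / real n) \<longlonglongrightarrow> 0"
    using smalloD_tendsto[OF d] .
  moreover have "(\<lambda>n. (real (gumbel_time \<sigma> n) - ?y n) / real n) \<longlonglongrightarrow> 0"
  proof (rule Lim_null_comparison)
    have "\<forall>\<^sub>F n in sequentially. 0 \<le> ?y n" by real_asymp
    then show "\<forall>\<^sub>F n in sequentially. norm ((real (gumbel_time \<sigma> n) - ?y n) / real n) \<le> 1 / real n"
    proof eventually_elim
      case (elim n)
      then have "real (gumbel_time \<sigma> n) = of_int \<lfloor>?y n\<rfloor>" unfolding gumbel_time_def by simp
      then have "\<bar>real (gumbel_time \<sigma> n) - ?y n\<bar> \<le> 1" by linarith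
      then show ?case by (simp add: divide_right_mono)
    qed
  qed real_asymp
  ultimately have "(\<lambda>n. (real (d n) - real r * real n * ln (ln (real n))) / real n +
     (real (gumbel_time \<sigma> n) - ?y n) / real n + \<sigma>) \<longlonglongrightarrow> 0 + 0 + \<sigma>"
    by (intro tendsto_add tendsto_const)
  moreover have "\<forall>\<^sub>F n in sequentially. (real (d n) - real r * real n * ln (ln (real n))) / real n +
     (real (gumbel_time \<sigma> n) - ?y n) / real n + \<sigma> =
     (real (gumbel_time \<sigma> n + d n) - real n * ln (real n) - real r * real n * ln (ln (real n))) / real n"
    using eventually_ge_at_top[of 1] by eventually_elim (simp add: field_simps)
  ultimately show ?thesis unfolding critical_time_def by (auto dest: Lim_transform_eventually)
qed

lemma critical_gumbel_time: "critical_time 0 \<sigma> (gumbel_time \<sigma>)"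
  using critical_gumbel_time_add[of "\<lambda>_. 0" 0 \<sigma>] by simp

lemma (in coupon_collector) avg_horizon_irrelevant:
  assumes "\<And>p p'. (\<And>s. s \<in> {1..T} \<Longrightarrow> p s = p' s) \<Longrightarrow> \<Phi> p = \<Phi> p'"
    and "\<And>p p'. (\<And>s. s \<in> {1..T'} \<Longrightarrow> p s = p' s) \<Longrightarrow> \<Phi> p = \<Phi> p'"
  shows "avg n T \<Phi> = avg n T' \<Phi>"
  using expectation_path[of T \<Phi>] expectation_path[of T' \<Phi>] assms by metis

text \<open>The Poisson limit for the time \<open>gumbel_time \<sigma> n\<close> of collector \<open>0\<close> together with the times
\<open>gumbel_time \<sigma>' n + d r n\<close> of the other collectors.  The choice \<open>u 0 = 0\<close> for collector \<open>0\<close> turns the power into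
the indicator of a complete collection, because \<open>0 ^ 0 = 1\<close>.\<close>

lemma completion_and_scarce_limit:
  assumes cc: "\<And>n. n \<ge> 1 \<Longrightarrow> coupon_collector (M n) n (C n)"
    and d: "\<And>r. r \<in> {1..R} \<Longrightarrow> (\<lambda>n. real (d r n) - real r * real n * ln (ln (real n))) \<in> o(\<lambda>n. real n)"
    and u: "\<And>r. r \<in> {1..R} \<Longrightarrow> u r \<in> {0..1}"
    and T: "\<And>n. gumbel_time \<sigma> n \<le> T n" "\<And>n r. r \<in> {1..R} \<Longrightarrow> gumbel_time \<sigma>' n + d r n \<le> T n"
  shows "(\<lambda>n. avg n (T n) (\<lambda>p. of_bool (scarce n 0 (gumbel_time \<sigma> n) p = 0) *
        (\<Prod>r\<in>{1..R}. u r ^ scarce n r (gumbel_time \<sigma>' n + d r n) p)))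
    \<longlonglongrightarrow> exp (- exp (- \<sigma>)) * exp (- (exp (- \<sigma>') * (\<Sum>r\<in>{1..R}. (1 - u r) / fact r)))"
proof -
  let ?Q = "\<lambda>n p. \<Prod>r\<in>{1..R}. u r ^ scarce n r (gumbel_time \<sigma>' n + d r n) p"
    and ?c = "\<Sum>r\<in>{1..R}. (1 - u r) / fact r"
  define t where "t r n = (if r = 0 then gumbel_time \<sigma> n else gumbel_time \<sigma>' n + d r n)" for r n
  define \<sigma>s where "\<sigma>s r = (if r = 0 then \<sigma> else \<sigma>')" for r :: nat
  define us where "us r = (if r = 0 then 0 else u r)" for r :: nat
  interpret critical_window R t \<sigma>s
  proof
    fix r assume "r \<le> R"
    then show "critical_time r (\<sigma>s r) (t r)"
      using critical_gumbel_time[of \<sigma>] critical_gumbel_time_add[OF d[of r], of \<sigma>']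
      by (cases "r = 0") (auto simp: \<sigma>s_def t_def[abs_def])
  qed
  have ins: "{..R} = insert 0 {1..R}" by auto
  define \<Phi> where "\<Phi> n p = of_bool (scarce n 0 (gumbel_time \<sigma> n) p = 0) * ?Q n p" for n p
  have \<Phi>_eq: "\<Phi> n p = (\<Prod>r\<le>R. us r ^ scarce n r (t r n) p)" for n p
  proof -
    have "(\<Prod>r\<le>R. us r ^ scarce n r (t r n) p) = 0 ^ scarce n 0 (gumbel_time \<sigma> n) p * ?Q n p"
      unfolding ins by (simp add: us_def t_def)
    then show ?thesis by (simp add: \<Phi>_def power_0_left)
  qed
  have "us r \<in> {0..1}" if "r \<le> R" for r using u[of r] that by (auto simp: us_def)
  then have "(\<lambda>n. avg n (horizon n) (\<Phi> n)) \<longlonglongrightarrow> exp (- (\<Sum>r\<le>R. (1 - us r) * exp (- \<sigma>s r) / fact r))"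
    unfolding \<Phi>_eq[abs_def] by (rule scarce_types_pgf_limit)
  moreover have "exp (- (\<Sum>r\<le>R. (1 - us r) * exp (- \<sigma>s r) / fact r)) =
     exp (- exp (- \<sigma>)) * exp (- (exp (- \<sigma>') * ?c))"
  proof -
    have "(\<Sum>r\<le>R. (1 - us r) * exp (- \<sigma>s r) / fact r) = exp (- \<sigma>) + (\<Sum>r\<in>{1..R}. (1 - u r) * exp (- \<sigma>') / fact r)"
      unfolding ins by (simp add: us_def \<sigma>s_def)
    also have "(\<Sum>r\<in>{1..R}. (1 - u r) * exp (- \<sigma>') / fact r) = exp (- \<sigma>') * ?c"
      by (simp add: sum_distrib_left mult_ac)
    finally show ?thesis by (simp add: exp_add[symmetric])
  qed
  ultimately have lim: "(\<lambda>n. avg n (horizon n) (\<Phi> n)) \<longlonglongrightarrow> exp (- exp (- \<sigma>)) * exp (- (exp (- \<sigma>') * ?c))"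
    by (simp only:)
  have "\<forall>\<^sub>F n in sequentially. avg n (horizon n) (\<Phi> n) = avg n (T n) (\<Phi> n)"
    using eventually_ge_at_top[of 1]
  proof eventually_elim
    case (elim n)
    interpret coupon_collector "M n" n "C n" using cc[OF elim] .
    have dep: "\<Phi> n p = \<Phi> n p'" if "\<And>s. s \<in> {1..S} \<Longrightarrow> p s = p' s"
      "gumbel_time \<sigma> n \<le> S" "\<And>r. r \<in> {1..R} \<Longrightarrow> gumbel_time \<sigma>' n + d r n \<le> S" for p p' S
    proof -
      have "scarce n 0 (gumbel_time \<sigma> n) p = scarce n 0 (gumbel_time \<sigma> n) p'"
        using that by (intro scarce_cong) auto
      moreover have "?Q n p = ?Q n p'"
      proof (rule prod.cong[OF refl])
        fix r assume "r \<in> {1..R}"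
        then have "scarce n r (gumbel_time \<sigma>' n + d r n) p = scarce n r (gumbel_time \<sigma>' n + d r n) p'"
          using that(1) that(3)[of r] by (intro scarce_cong) auto
        then show "u r ^ scarce n r (gumbel_time \<sigma>' n + d r n) p = u r ^ scarce n r (gumbel_time \<sigma>' n + d r n) p'" by simp
      qed
      ultimately show ?thesis by (simp add: \<Phi>_def)
    qed
    show ?case
    proof (rule avg_horizon_irrelevant)
      show "\<Phi> n p = \<Phi> n p'" if "\<And>s. s \<in> {1..horizon n} \<Longrightarrow> p s = p' s" for p p'
      proof (rule dep[OF that])
        show "gumbel_time \<sigma> n \<le> horizon n" using horizon_ge[of 0 n] by (simp add: t_def)
        show "gumbel_time \<sigma>' n + d r n \<le> horizon n" if "r \<in> {1..R}" for r using horizon_ge[of r n] that by (simp add: t_def)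
      qed
      show "\<Phi> n p = \<Phi> n p'" if "\<And>s. s \<in> {1..T n} \<Longrightarrow> p s = p' s" for p p'
        by (rule dep[OF that T])
    qed
  qed
  with lim show ?thesis unfolding \<Phi>_def[symmetric] by (auto dest: Lim_transform_eventually)
qed

text \<open>With grid points at which the Gumbel distribution function takes the values \<open>x = 1 / K, 2 / K, \<dots>\<close>, the factor
\<open>exp (- c * exp (- \<sigma>))\<close> is \<open>x powr c\<close>, and the bounds of \<open>empty_spots_pgf_bounds\<close> tend to Riemann sums.  If \<open>x\<close>
is read as a uniform random variable, then \<open>- ln x\<close> is the exponential time of the mixed Poisson sequence.\<close>

theorem empty_spots_pgf_limit:
  assumes cc: "\<And>n. n \<ge> 1 \<Longrightarrow> coupon_collector (M n) n (C n)"
    and d: "\<And>r. r \<in> {1..R} \<Longrightarrow> (\<lambda>n. real (d r n) - real r * real n * ln (ln (real n))) \<in> o(\<lambda>n. real n)"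
    and u: "\<And>r. r \<in> {1..R} \<Longrightarrow> u r \<in> {0..1::real}"
  shows "(\<lambda>n. \<integral>\<omega>. (\<Prod>r\<in>{1..R}. u r ^ empty_spots n (C n) r (d r n) \<omega>) \<partial>M n)
    \<longlonglongrightarrow> 1 / (1 + (\<Sum>r\<in>{1..R}. (1 - u r) / fact r))"
proof -
  define c where "c = (\<Sum>r\<in>{1..R}. (1 - u r) / fact r)"
  have c0: "0 \<le> c" unfolding c_def using u by (intro sum_nonneg) auto
  define I where "I n = (\<integral>\<omega>. (\<Prod>r\<in>{1..R}. u r ^ empty_spots n (C n) r (d r n) \<omega>) \<partial>M n)" for n
  have approx: "\<forall>\<^sub>F n in sequentially. \<bar>I n - 1 / (1 + c)\<bar> \<le> 3 / real (m + 2)" for m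
  proof -
    define K where "K = m + 2"
    define x where "x k = real (Suc k) / real K" for k
    \<comment> \<open>the quantile of the Gumbel distribution: \<open>exp (- exp (- \<sigma> k)) = x k\<close>\<close>
    define \<sigma> where "\<sigma> k = - ln (- ln (x k))" for k
    define s where "s k n = gumbel_time (\<sigma> k) n" for k n
    \<comment> \<open>any length that covers all grid times with all delays\<close>
    define T where "T n = (\<Sum>k\<le>m. s k n + (\<Sum>r\<in>{1..R}. d r n))" for n
    define Y where "Y n k l = avg n (T n) (\<lambda>p. of_bool (scarce n 0 (s k n) p = 0) *
        (\<Prod>r\<in>{1..R}. u r ^ scarce n r (s l n + d r n) p))" for n k l
    define A where "A n k = avg n (T n) (\<lambda>p. of_bool (scarce n 0 (s k n) p = 0))" for n k
    have x: "0 < x k" "x k < 1" if "k \<le> m" for k using that by (auto simp: x_def K_def)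
    have exp\<sigma>: "exp (- \<sigma> k) = - ln (x k)" if "k \<le> m" for k
      using x[OF that] unfolding \<sigma>_def by simp
    have sT: "s k n + (\<Sum>r\<in>{1..R}. d r n) \<le> T n" if "k \<le> m" for k n
      unfolding T_def using that by (intro member_le_sum) auto
    have sT1: "s k n \<le> T n" if "k \<le> m" for k n using sT[OF that, of n] by simp
    have sT2: "s k n + d r n \<le> T n" if "k \<le> m" "r \<in> {1..R}" for k r n
    proof -
      have "d r n \<le> (\<Sum>r\<in>{1..R}. d r n)" using that by (intro member_le_sum) auto
      then show ?thesis using sT[OF that(1), of n] by linarith
    qed
    have Y: "(\<lambda>n. Y n k l) \<longlonglongrightarrow> x k * x l powr c" if "k \<le> m" "l \<le> m" for k l
    proof -
      have "(\<lambda>n. Y n k l) \<longlonglongrightarrow> exp (- exp (- \<sigma> k)) * exp (- (exp (- \<sigma> l) * c))"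
        unfolding Y_def s_def c_def
        using sT1[OF that(1)] sT2[OF that(2)] unfolding s_def
        by (intro completion_and_scarce_limit[OF cc d u]) auto
      also have "exp (- exp (- \<sigma> k)) = x k" using x[OF that(1)] by (simp add: exp\<sigma>[OF that(1)])
      also have "exp (- (exp (- \<sigma> l) * c)) = x l powr c"
        using x[OF that(2)] by (simp add: exp\<sigma>[OF that(2)] powr_def mult.commute)
      finally show ?thesis .
    qed
    have A: "(\<lambda>n. A n k) \<longlonglongrightarrow> x k" if "k \<le> m" for k
    proof -
      have "(\<lambda>n. avg n (T n) (\<lambda>p. of_bool (scarce n 0 (gumbel_time (\<sigma> k) n) p = 0) *
        (\<Prod>r\<in>{1..0}. u r ^ scarce n r (gumbel_time 0 n + d r n) p)))
        \<longlonglongrightarrow> exp (- exp (- \<sigma> k)) * exp (- (exp (- 0) * (\<Sum>r\<in>{1..0}. (1 - u r) / fact r)))"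
        using sT1[OF that] unfolding s_def by (intro completion_and_scarce_limit[OF cc]) auto
      also have "exp (- exp (- \<sigma> k)) = x k" using x[OF that] by (simp add: exp\<sigma>[OF that])
      finally show ?thesis by (simp add: A_def s_def)
    qed
    have s_mono: "s k n \<le> s (Suc k) n" if "k < m" for k n
    proof -
      have "x k \<le> x (Suc k)" unfolding x_def by (intro divide_right_mono) auto
      moreover have "0 < x k" "x k < 1" "x (Suc k) < 1" using that x[of k] x[of "Suc k"] by auto
      ultimately have "\<sigma> k \<le> \<sigma> (Suc k)" unfolding \<sigma>_def by simp
      then show ?thesis unfolding s_def by (rule gumbel_time_mono)
    qed
    define L where "L = (\<Sum>k<m. x (Suc k) * x k powr c - x k * x k powr c)"
    define U where "U = x 0 + (\<Sum>k<m. x (Suc k) * x (Suc k) powr c - x k * x (Suc k) powr c) + (1 - x m)"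
    have dx: "x (Suc k) - x k = 1 / real K" for k unfolding x_def K_def by (simp add: field_simps)
    have L_ge: "1 / (1 + c) - 2 / real K \<le> L"
    proof -
      have L: "L = (\<Sum>k<m. x k powr c / real K)"
        unfolding L_def left_diff_distrib[symmetric] dx by simp
      have "1 / (1 + c) \<le> (\<Sum>j<K. x j powr c / real K)"
        using powr_riemann_sum(2)[of K c] c0 unfolding x_def K_def by simp
      also have "\<dots> = L + x m powr c / real K + x (Suc m) powr c / real K"
        unfolding L K_def by simp
      also have "\<dots> \<le> L + 1 / real K + 1 / real K"
        using c0 unfolding x_def K_def
        by (intro add_mono order_refl divide_right_mono powr_le1) auto
      finally show ?thesis by simp
    qed
    have U_le: "U \<le> 1 / (1 + c) + 2 / real K"
    proof -
      have "(\<Sum>k<m. x (Suc k) * x (Suc k) powr c - x k * x (Suc k) powr c) = (\<Sum>k<m. x (Suc k) powr c / real K)"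
        unfolding left_diff_distrib[symmetric] dx by simp
      also have "\<dots> = (\<Sum>k<m. (real (Suc (Suc k)) / real K) powr c / real K)" unfolding x_def ..
      also have "\<dots> \<le> (\<Sum>j<K. (real j / real K) powr c / real K)"
        unfolding K_def numeral_2_eq_2 add_Suc_right add_0_right sum.lessThan_Suc_shift by simp
      also have "\<dots> \<le> 1 / (1 + c)" using c0 by (intro powr_riemann_sum(1)) (auto simp: K_def)
      finally have "(\<Sum>k<m. x (Suc k) * x (Suc k) powr c - x k * x (Suc k) powr c) \<le> 1 / (1 + c)" .
      moreover have "x 0 = 1 / real K" "1 - x m = 1 / real K" by (auto simp: x_def K_def field_simps)
      ultimately show ?thesis unfolding U_def by simp
    qed
    have limL: "(\<lambda>n. \<Sum>k<m. Y n (Suc k) k - Y n k k) \<longlonglongrightarrow> L"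
      unfolding L_def by (intro tendsto_sum tendsto_diff Y) auto
    have limU: "(\<lambda>n. A n 0 + (\<Sum>k<m. Y n (Suc k) (Suc k) - Y n k (Suc k)) + (1 - A n m)) \<longlonglongrightarrow> U"
      unfolding U_def by (intro tendsto_add tendsto_sum tendsto_diff tendsto_const Y A) auto
    have "1 / real K > 0" by (simp add: K_def)
    then have "\<forall>\<^sub>F n in sequentially. L - 1 / real K < (\<Sum>k<m. Y n (Suc k) k - Y n k k)"
      "\<forall>\<^sub>F n in sequentially. A n 0 + (\<Sum>k<m. Y n (Suc k) (Suc k) - Y n k (Suc k)) + (1 - A n m) < U + 1 / real K"
      by (auto intro!: order_tendstoD[OF limL] order_tendstoD[OF limU])
    then show ?thesis using eventually_ge_at_top[of 1]
    proof eventually_elim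
      case (elim n)
      interpret coupon_collector "M n" n "C n" using cc elim by auto
      have "(\<Sum>k<m. Y n (Suc k) k - Y n k k) \<le> I n"
        unfolding I_def Y_def using u s_mono sT1 sT2
        by (intro empty_spots_pgf_bounds(1)[where s = "\<lambda>k. s k n" and d = "\<lambda>r. d r n" and T = "T n"]) auto
      moreover have "I n \<le> A n 0 + (\<Sum>k<m. Y n (Suc k) (Suc k) - Y n k (Suc k)) + (1 - A n m)"
        unfolding I_def Y_def A_def using u s_mono sT1 sT2
        by (intro empty_spots_pgf_bounds(2)[where s = "\<lambda>k. s k n" and d = "\<lambda>r. d r n" and T = "T n"]) auto
      ultimately have "\<bar>I n - 1 / (1 + c)\<bar> \<le> 2 / real K + 1 / real K" using elim L_ge U_le by linarith
      then show ?case by (simp add: K_def add_divide_distrib[symmetric])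
    qed
  qed
  have "I \<longlonglongrightarrow> 1 / (1 + c)"
  proof (rule tendstoI)
    fix e :: real assume e: "e > 0"
    have "(\<lambda>m. 3 / real (m + 2)) \<longlonglongrightarrow> 0" by real_asymp
    then have "\<forall>\<^sub>F m in sequentially. 3 / real (m + 2) < e" using e by (rule order_tendstoD)
    then obtain m where m: "3 / real (m + 2) < e" by (auto dest: eventually_happens)
    show "\<forall>\<^sub>F n in sequentially. dist (I n) (1 / (1 + c)) < e"
      using approx[of m] by eventually_elim (use m in \<open>simp add: dist_real_def\<close>)
  qed
  then show ?thesis unfolding I_def c_def .
qed

section \<open>Generating functions and convergence in distribution\<close>

lemma tendsto_of_approximations:
  fixes a :: "nat \<Rightarrow> real"
  assumes "\<And>e. e > 0 \<Longrightarrow> \<exists>b B. b \<longlonglongrightarrow> B \<and> (\<forall>\<^sub>F n in sequentially. \<bar>a n - b n\<bar> \<le> e) \<and> \<bar>A - B\<bar> \<le> e"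
  shows "a \<longlonglongrightarrow> A"
proof (rule tendstoI)
  fix e :: real assume "e > 0"
  then have e: "e / 4 > 0" by simp
  obtain b B where b: "b \<longlonglongrightarrow> B" "\<forall>\<^sub>F n in sequentially. \<bar>a n - b n\<bar> \<le> e / 4" "\<bar>A - B\<bar> \<le> e / 4"
    using assms[OF e] by blast
  have "\<forall>\<^sub>F n in sequentially. dist (b n) B < e / 4" using b(1) e by (rule tendstoD)
  with b(2) show "\<forall>\<^sub>F n in sequentially. dist (a n) A < e"
  proof eventually_elim
    case (elim n)
    then show ?case using b(3) \<open>e > 0\<close> unfolding dist_real_def by linarith
  qed
qed

text \<open>The points \<open>2 ^ (- x)\<close> and their limit \<open>0\<close> form a compact subset of \<open>{0..1}\<close> on which \<open>2 ^ (- v)\<close> is isolated, so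
the indicator extends to a continuous function and the Weierstrass theorem applies.\<close>

lemma point_indicator_approx:
  assumes "e > 0"
  obtains a :: "nat \<Rightarrow> real" and N where
    "\<And>x :: nat. \<bar>of_bool (x = v) - (\<Sum>i\<le>N. a i * ((1/2) ^ i) ^ x)\<bar> \<le> e"
proof -
  \<comment> \<open>a tent at \<open>2 ^ (- v)\<close>; its half-width \<open>2 ^ (- v - 1)\<close> is the distance to the nearest other power\<close>
  define f where "f s = max 0 (1 - \<bar>s - (1/2) ^ v\<bar> * 2 ^ Suc v)" for s :: real
  have f: "f ((1/2) ^ x) = of_bool (x = v)" for x :: nat
  proof (cases "x = v")
    case False
    have "1 \<le> \<bar>(1/2) ^ x - (1/2) ^ v\<bar> * (2::real) ^ Suc v"
    proof (cases "x < v")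
      case True
      then have "(1/2) ^ v \<le> ((1/2) ^ Suc x :: real)" by (intro power_decreasing) auto
      moreover have "(1/2) ^ v \<le> ((1/2) ^ x :: real)" using True by (intro power_decreasing) auto
      ultimately have "(1/2) ^ v \<le> \<bar>(1/2) ^ x - (1/2) ^ v :: real\<bar>" by simp
      then have "(1/2) ^ v * 2 ^ Suc v \<le> \<bar>(1/2) ^ x - (1/2) ^ v\<bar> * (2::real) ^ Suc v"
        by (intro mult_right_mono) auto
      moreover have "(1/2) ^ v * 2 ^ Suc v = (2::real)" by (simp add: power_one_over)
      ultimately show ?thesis by linarith
    next
      case F: False
      then have "(1/2) ^ x \<le> ((1/2) ^ Suc v :: real)" using False by (intro power_decreasing) auto
      moreover have "(1/2) ^ v = 2 * ((1/2) ^ Suc v :: real)" by simp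
      ultimately have "(1/2) ^ Suc v \<le> \<bar>(1/2) ^ x - (1/2) ^ v :: real\<bar>" by linarith
      then have "(1/2) ^ Suc v * 2 ^ Suc v \<le> \<bar>(1/2) ^ x - (1/2) ^ v\<bar> * (2::real) ^ Suc v"
        by (intro mult_right_mono) auto
      moreover have "(1/2) ^ Suc v * 2 ^ Suc v = (1::real)" by (simp add: power_one_over)
      ultimately show ?thesis by linarith
    qed
    then show ?thesis using False by (simp add: f_def)
  qed (simp add: f_def)
  have "continuous_on {0..1} f" unfolding f_def by (intro continuous_intros)
  then obtain g where g: "real_polynomial_function g" "\<And>s. s \<in> {0..1} \<Longrightarrow> \<bar>f s - g s\<bar> < e"
    using Stone_Weierstrass_real_polynomial_function[of "{0..1}" f e] assms by auto
  then obtain a N where gs: "g = (\<lambda>s. \<Sum>i\<le>N. a i * s ^ i)"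
    using real_polynomial_function_iff_sum by blast
  show thesis
  proof
    fix x :: nat
    have "\<bar>f ((1/2) ^ x) - g ((1/2) ^ x)\<bar> < e" by (rule g(2)) (auto intro: power_le_one)
    moreover have "g ((1/2) ^ x) = (\<Sum>i\<le>N. a i * ((1/2) ^ i) ^ x)"
      unfolding gs by (simp add: power_mult[symmetric] mult.commute)
    ultimately show "\<bar>of_bool (x = v) - (\<Sum>i\<le>N. a i * ((1/2) ^ i) ^ x)\<bar> \<le> e"
      unfolding f by simp
  qed
qed

lemma borel_measurable_nat_fun:
  "X \<in> measurable M (count_space UNIV) \<Longrightarrow> (\<lambda>\<omega>. (f :: nat \<Rightarrow> real) (X \<omega>)) \<in> borel_measurable M"
  by (rule measurable_compose) auto

lemma (in prob_space) integrable_unit_valued: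
  "f \<in> borel_measurable M \<Longrightarrow> (\<And>\<omega>. f \<omega> \<in> {0..1::real}) \<Longrightarrow> integrable M f"
  by (intro integrable_const_bound[where B = 1]) auto

lemma (in prob_space) expectation_point_indicator_approx:
  assumes X: "X \<in> measurable M (count_space UNIV)"
    and g: "g \<in> borel_measurable M" "\<And>\<omega>. g \<omega> \<in> {0..1::real}"
    and a: "\<And>x :: nat. \<bar>of_bool (x = v) - (\<Sum>i\<le>N. a i * ((1/2) ^ i) ^ x)\<bar> \<le> e"
  shows "\<bar>expectation (\<lambda>\<omega>. of_bool (X \<omega> = v) * g \<omega>) - (\<Sum>i\<le>N. a i * expectation (\<lambda>\<omega>. ((1/2) ^ i) ^ X \<omega> * g \<omega>))\<bar> \<le> e"
proof -
  have m: "(\<lambda>\<omega>. f (X \<omega>) * g \<omega>) \<in> borel_measurable M" for f :: "nat \<Rightarrow> real"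
    by (intro borel_measurable_times borel_measurable_nat_fun X g)
  have int: "integrable M (\<lambda>\<omega>. f (X \<omega>) * g \<omega>)" if "\<And>x. f x \<in> {0..1}" for f :: "nat \<Rightarrow> real"
    using that g by (intro integrable_unit_valued m) (auto intro: mult_le_one)
  have i1: "integrable M (\<lambda>\<omega>. of_bool (X \<omega> = v) * g \<omega>)" by (rule int[of "\<lambda>x. of_bool (x = v)"]) auto
  have i2: "integrable M (\<lambda>\<omega>. ((1/2) ^ i) ^ X \<omega> * g \<omega>)" for i
    by (rule int[of "\<lambda>x. ((1/2) ^ i) ^ x"]) (auto intro!: power_le_one)
  let ?D = "\<lambda>\<omega>. of_bool (X \<omega> = v) * g \<omega> - (\<Sum>i\<le>N. a i * (((1/2) ^ i) ^ X \<omega> * g \<omega>))"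
  have "expectation (\<lambda>\<omega>. of_bool (X \<omega> = v) * g \<omega>) - (\<Sum>i\<le>N. a i * expectation (\<lambda>\<omega>. ((1/2) ^ i) ^ X \<omega> * g \<omega>)) = expectation ?D"
    using i1 i2 by simp
  moreover have "\<bar>expectation ?D\<bar> \<le> e"
  proof -
    have D: "\<bar>?D \<omega>\<bar> \<le> e" for \<omega>
    proof -
      have "?D \<omega> = (of_bool (X \<omega> = v) - (\<Sum>i\<le>N. a i * ((1/2) ^ i) ^ X \<omega>)) * g \<omega>"
        by (simp add: left_diff_distrib sum_distrib_right mult.assoc)
      then have "\<bar>?D \<omega>\<bar> = \<bar>of_bool (X \<omega> = v) - (\<Sum>i\<le>N. a i * ((1/2) ^ i) ^ X \<omega>)\<bar> * g \<omega>"
        using g(2)[of \<omega>] by (simp add: abs_mult)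
      also have "\<dots> \<le> e * 1" using a[of "X \<omega>"] g(2)[of \<omega>] by (intro mult_mono) auto
      finally show ?thesis by simp
    qed
    have "integrable M ?D" using i1 i2 by (intro Bochner_Integration.integrable_diff Bochner_Integration.integrable_sum integrable_mult_right) auto
    then have "\<bar>expectation ?D\<bar> \<le> expectation (\<lambda>\<omega>. \<bar>?D \<omega>\<bar>)" using integral_norm_bound[of M ?D] by simp
    also have "\<dots> \<le> expectation (\<lambda>_. e)"
      using D \<open>integrable M ?D\<close> by (intro integral_mono) auto
    finally show ?thesis by (simp add: prob_space)
  qed
  ultimately show ?thesis by simp
qed

lemma cylinder_product_measurable:
  fixes u :: "nat \<Rightarrow> real"
  assumes "\<And>k. Y k \<in> measurable N (count_space UNIV)"
  shows "(\<lambda>\<omega>. (\<Prod>k\<in>A. of_bool (Y k \<omega> = v k)) * (\<Prod>k\<in>B. u k ^ Y k \<omega>)) \<in> borel_measurable N"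
proof -
  have [measurable]: "(\<lambda>\<omega>. of_bool (Y k \<omega> = v k) :: real) \<in> borel_measurable N" for k
    by (rule borel_measurable_nat_fun[OF assms, of "\<lambda>x. of_bool (x = v k)"])
  have [measurable]: "(\<lambda>\<omega>. u k ^ Y k \<omega>) \<in> borel_measurable N" for k
    by (rule borel_measurable_nat_fun[OF assms, of "\<lambda>x. u k ^ x"])
  show ?thesis by measurable
qed

text \<open>The mode of convergence is stated by generating functions of finitely many coordinates.  The spaces may vary with
\<open>n\<close>, and only \<open>n \<ge> 1\<close> matters.\<close>

locale pgf_convergence =
  fixes M :: "nat \<Rightarrow> 'a measure" and X :: "nat \<Rightarrow> nat \<Rightarrow> 'a \<Rightarrow> nat"
    and L :: "'b measure" and Z :: "nat \<Rightarrow> 'b \<Rightarrow> nat"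
  assumes M: "\<And>n. n \<ge> 1 \<Longrightarrow> prob_space (M n)"
    and X: "\<And>n k. n \<ge> 1 \<Longrightarrow> X n k \<in> measurable (M n) (count_space UNIV)"
    and L: "prob_space L" and Z: "\<And>k. Z k \<in> measurable L (count_space UNIV)"
    and pgf: "\<And>R u. (\<And>k. k < R \<Longrightarrow> u k \<in> {0..1::real}) \<Longrightarrow>
      (\<lambda>n. \<integral>\<omega>. (\<Prod>k<R. u k ^ X n k \<omega>) \<partial>M n) \<longlonglongrightarrow> (\<integral>\<omega>. (\<Prod>k<R. u k ^ Z k \<omega>) \<partial>L)"
begin

text \<open>Passes from powers to point indicators one coordinate at a time.  By \<open>point_indicator_approx\<close> the indicator in
coordinate \<open>j\<close> is, up to \<open>e\<close>, a combination of powers \<open>((1/2) ^ i) ^ x\<close>, for which the induction hypothesis holds with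
\<open>u j = (1/2) ^ i\<close>.\<close>

lemma cylinder_expectation_limit:
  assumes "j \<le> R" "\<And>k. k < R \<Longrightarrow> u k \<in> {0..1::real}"
  shows "(\<lambda>n. \<integral>\<omega>. (\<Prod>k<j. of_bool (X n k \<omega> = v k)) * (\<Prod>k\<in>{j..<R}. u k ^ X n k \<omega>) \<partial>M n)
    \<longlonglongrightarrow> (\<integral>\<omega>. (\<Prod>k<j. of_bool (Z k \<omega> = v k)) * (\<Prod>k\<in>{j..<R}. u k ^ Z k \<omega>) \<partial>L)"
  using assms
proof (induction j arbitrary: u)
  case 0
  then show ?case using pgf[of R u] by (simp add: lessThan_atLeast0)
next
  case (Suc j)
  define G where "G x = (\<Prod>k<j. of_bool (x k = v k)) * (\<Prod>k\<in>{Suc j..<R}. u k ^ x k)" for x :: "nat \<Rightarrow> nat"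
  have G01: "G x \<in> {0..1}" for x
  proof -
    have "(\<Prod>k<j. of_bool (x k = v k)) \<in> {0..1::real}" by (auto intro!: prod_nonneg prod_le_1)
    moreover have "(\<Prod>k\<in>{Suc j..<R}. u k ^ x k) \<in> {0..1}" using Suc.prems by (auto intro!: prod_nonneg prod_le_1 power_le_one)
    ultimately show ?thesis unfolding G_def by (auto intro: mult_le_one)
  qed
  have G_meas_L: "(\<lambda>\<omega>. G (\<lambda>k. Z k \<omega>)) \<in> borel_measurable L"
    unfolding G_def by (rule cylinder_product_measurable[OF Z])
  have last: "(\<Prod>k<Suc j. of_bool (x k = v k)) * (\<Prod>k\<in>{Suc j..<R}. u k ^ x k) = of_bool (x j = v j) * G x" for x
    unfolding G_def by (simp add: mult_ac)
  have first: "(\<Prod>k<j. of_bool (x k = v k)) * (\<Prod>k\<in>{j..<R}. (u(j := w)) k ^ x k) = w ^ x j * G x" for x w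
  proof -
    have "{j..<R} = insert j {Suc j..<R}" using Suc.prems by auto
    then show ?thesis unfolding G_def by (simp add: mult_ac)
  qed
  have lim: "(\<lambda>n. \<integral>\<omega>. ((1/2) ^ i) ^ X n j \<omega> * G (\<lambda>k. X n k \<omega>) \<partial>M n) \<longlonglongrightarrow> (\<integral>\<omega>. ((1/2) ^ i) ^ Z j \<omega> * G (\<lambda>k. Z k \<omega>) \<partial>L)" for i
  proof -
    have "(u(j := (1/2) ^ i)) k \<in> {0..1}" if "k < R" for k
      using Suc.prems(2)[OF that] by (auto intro: power_le_one)
    from Suc.IH[of "u(j := (1/2) ^ i)", OF _ this] show ?thesis using Suc.prems(1) unfolding first by simp
  qed
  show ?case unfolding last
  proof (rule tendsto_of_approximations)
    fix e :: real assume "e > 0"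
    then obtain a N where a: "\<And>x :: nat. \<bar>of_bool (x = v j) - (\<Sum>i\<le>N. a i * ((1/2) ^ i) ^ x)\<bar> \<le> e"
      using point_indicator_approx by blast
    have "(\<lambda>n. \<Sum>i\<le>N. a i * (\<integral>\<omega>. ((1/2) ^ i) ^ X n j \<omega> * G (\<lambda>k. X n k \<omega>) \<partial>M n)) \<longlonglongrightarrow>
       (\<Sum>i\<le>N. a i * (\<integral>\<omega>. ((1/2) ^ i) ^ Z j \<omega> * G (\<lambda>k. Z k \<omega>) \<partial>L))"
      by (intro tendsto_sum tendsto_mult tendsto_const lim)
    moreover have "\<forall>\<^sub>F n in sequentially. \<bar>(\<integral>\<omega>. of_bool (X n j \<omega> = v j) * G (\<lambda>k. X n k \<omega>) \<partial>M n) -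
        (\<Sum>i\<le>N. a i * (\<integral>\<omega>. ((1/2) ^ i) ^ X n j \<omega> * G (\<lambda>k. X n k \<omega>) \<partial>M n))\<bar> \<le> e"
      using eventually_ge_at_top[of 1]
    proof eventually_elim
      case (elim n)
      have m: "(\<lambda>\<omega>. G (\<lambda>k. X n k \<omega>)) \<in> borel_measurable (M n)"
        unfolding G_def by (rule cylinder_product_measurable[OF X[OF elim]])
      show ?case
        by (rule prob_space.expectation_point_indicator_approx[OF M[OF elim] X[OF elim] m G01 a])
    qed
    moreover have "\<bar>(\<integral>\<omega>. of_bool (Z j \<omega> = v j) * G (\<lambda>k. Z k \<omega>) \<partial>L) - (\<Sum>i\<le>N. a i * (\<integral>\<omega>. ((1/2) ^ i) ^ Z j \<omega> * G (\<lambda>k. Z k \<omega>) \<partial>L))\<bar> \<le> e"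
      by (rule prob_space.expectation_point_indicator_approx[OF L Z G_meas_L G01 a])
    ultimately show "\<exists>b B. b \<longlonglongrightarrow> B \<and> (\<forall>\<^sub>F n in sequentially. \<bar>(\<integral>\<omega>. of_bool (X n j \<omega> = v j) * G (\<lambda>k. X n k \<omega>) \<partial>M n) - b n\<bar> \<le> e) \<and>
        \<bar>(\<integral>\<omega>. of_bool (Z j \<omega> = v j) * G (\<lambda>k. Z k \<omega>) \<partial>L) - B\<bar> \<le> e" by blast
  qed
qed

end

text \<open>Lists serve as a countable type that contains the values of all finite-dimensional marginals.\<close>

definition initial_segment :: "nat \<Rightarrow> (nat \<Rightarrow> 'a \<Rightarrow> nat) \<Rightarrow> 'a \<Rightarrow> nat list" where
  "initial_segment R Y \<omega> = map (\<lambda>k. Y k \<omega>) [0..<R]"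

lemma initial_segment_eq_iff: "initial_segment R Y \<omega> = l \<longleftrightarrow> length l = R \<and> (\<forall>k<R. Y k \<omega> = l ! k)"
  unfolding initial_segment_def by (auto simp: list_eq_iff_nth_eq)

lemma initial_segment_measurable:
  assumes "\<And>k. Y k \<in> measurable N (count_space UNIV)"
  shows "initial_segment R Y \<in> measurable N (count_space UNIV)"
proof -
  have "Measurable.pred N (\<lambda>\<omega>. Y k \<omega> = x)" for k x
    by (rule measurable_compose[OF assms]) simp
  then have "Measurable.pred N (\<lambda>\<omega>. initial_segment R Y \<omega> = l)" for l
    unfolding initial_segment_eq_iff by measurable
  then have "initial_segment R Y -` {l} \<inter> space N \<in> sets N" for l
    by (simp add: pred_def vimage_def Int_def conj_commute)
  then show ?thesis by (simp add: measurable_count_space_eq2_countable)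
qed

lemma (in prob_space) prob_initial_segment:
  assumes "\<And>k. Y k \<in> measurable M (count_space UNIV)"
  shows "prob {\<omega> \<in> space M. initial_segment R Y \<omega> = l} =
    (if length l = R then expectation (\<lambda>\<omega>. \<Prod>k<R. of_bool (Y k \<omega> = l ! k)) else 0)"
proof (cases "length l = R")
  case True
  have s: "{\<omega> \<in> space M. initial_segment R Y \<omega> = l} \<in> events"
    using measurable_sets[OF initial_segment_measurable[OF assms], of "{l}" R] by (simp add: vimage_def Int_def conj_commute)
  have "(\<Prod>k<R. of_bool (Y k \<omega> = l ! k)) = (of_bool (\<forall>k<R. Y k \<omega> = l ! k) :: real)" for \<omega>
    by (induction R) (auto simp: less_Suc_eq)
  then have "(\<Prod>k<R. of_bool (Y k \<omega> = l ! k)) = (indicator {\<omega> \<in> space M. initial_segment R Y \<omega> = l} \<omega> :: real)" if "\<omega> \<in> space M" for \<omega>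
    using that True by (simp add: indicator_def initial_segment_eq_iff)
  then have "expectation (\<lambda>\<omega>. \<Prod>k<R. of_bool (Y k \<omega> = l ! k)) = expectation (indicator {\<omega> \<in> space M. initial_segment R Y \<omega> = l} :: _ \<Rightarrow> real)"
    by (intro Bochner_Integration.integral_cong) auto
  then show ?thesis using s True by simp
qed (simp add: initial_segment_eq_iff)

lemma (in pgf_convergence) prob_initial_segment_limit:
  "(\<lambda>n. measure (M n) {\<omega> \<in> space (M n). initial_segment R (X n) \<omega> = l}) \<longlonglongrightarrow> measure L {\<omega> \<in> space L. initial_segment R Z \<omega> = l}"
proof -
  have "\<forall>\<^sub>F n in sequentially. (if length l = R then \<integral>\<omega>. (\<Prod>k<R. of_bool (X n k \<omega> = l ! k)) \<partial>M n else 0) =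
      measure (M n) {\<omega> \<in> space (M n). initial_segment R (X n) \<omega> = l}"
    using eventually_ge_at_top[of 1] by eventually_elim (rule prob_space.prob_initial_segment[OF M X, symmetric])
  moreover have "(\<lambda>n. if length l = R then \<integral>\<omega>. (\<Prod>k<R. of_bool (X n k \<omega> = l ! k)) \<partial>M n else 0) \<longlonglongrightarrow>
     measure L {\<omega> \<in> space L. initial_segment R Z \<omega> = l}"
    unfolding prob_space.prob_initial_segment[OF L Z]
    using cylinder_expectation_limit[of R R "\<lambda>_. 1" "\<lambda>k. l ! k"] by simp
  ultimately show ?thesis by (auto dest: Lim_transform_eventually)
qed

lemma (in prob_space) expectation_finitely_many_segments:
  assumes Y: "\<And>k. Y k \<in> measurable M (count_space UNIV)" and F: "finite F"
  shows "expectation (\<lambda>\<omega>. if initial_segment R Y \<omega> \<in> F then h (initial_segment R Y \<omega>) else 0) =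
    (\<Sum>l\<in>F. h l * prob {\<omega> \<in> space M. initial_segment R Y \<omega> = l})"
proof -
  let ?S = "\<lambda>l. {\<omega> \<in> space M. initial_segment R Y \<omega> = l}"
  have s: "?S l \<in> events" for l
    using measurable_sets[OF initial_segment_measurable[OF Y], of "{l}" R] by (simp add: vimage_def Int_def conj_commute)
  have i: "integrable M (indicator (?S l) :: _ \<Rightarrow> real)" for l
    by (rule integrable_real_indicator[OF s]) (simp add: less_top[symmetric])
  have "expectation (\<lambda>\<omega>. if initial_segment R Y \<omega> \<in> F then h (initial_segment R Y \<omega>) else 0) =
    expectation (\<lambda>\<omega>. \<Sum>l\<in>F. h l * indicator (?S l) \<omega>)"
  proof (rule Bochner_Integration.integral_cong[OF refl])
    fix \<omega> assume \<omega>: "\<omega> \<in> space M"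
    have "(\<Sum>l\<in>F. h l * indicator (?S l) \<omega>) =
       (\<Sum>l\<in>F. if l = initial_segment R Y \<omega> then h (initial_segment R Y \<omega>) else 0)"
      using \<omega> by (intro sum.cong) (auto simp: indicator_def)
    then show "(if initial_segment R Y \<omega> \<in> F then h (initial_segment R Y \<omega>) else 0) =
       (\<Sum>l\<in>F. h l * indicator (?S l) \<omega>)"
      using F by simp
  qed
  also have "\<dots> = (\<Sum>l\<in>F. h l * prob (?S l))"
    using i s by (subst Bochner_Integration.integral_sum) auto
  finally show ?thesis .
qed

text \<open>The largest minorant of \<open>f\<close> on sequences of natural numbers that depends only on the first \<open>R\<close> coordinates.\<close>

definition inf_over_prefix :: "((nat \<Rightarrow> real) \<Rightarrow> real) \<Rightarrow> nat \<Rightarrow> nat list \<Rightarrow> real" where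
  "inf_over_prefix f R l = (INF y\<in>{y :: nat \<Rightarrow> nat. map y [0..<R] = l}. f (\<lambda>k. real (y k)))"

lemma inf_over_prefix_bounds:
  assumes f: "\<And>x. 0 \<le> f x"
  shows "0 \<le> inf_over_prefix f R (map x [0..<R])" "inf_over_prefix f R (map x [0..<R]) \<le> f (\<lambda>k. real (x k))"
proof -
  show "0 \<le> inf_over_prefix f R (map x [0..<R])"
    unfolding inf_over_prefix_def by (intro cINF_greatest) (auto simp: f)
  show "inf_over_prefix f R (map x [0..<R]) \<le> f (\<lambda>k. real (x k))"
    unfolding inf_over_prefix_def by (intro cINF_lower bdd_belowI2[where m = 0]) (auto simp: f)
qed

text \<open>Sequences that almost attain the infimum agree with \<open>x\<close> on longer and longer initial segments, hence converge to \<open>x\<close>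
in the product topology.\<close>

lemma inf_over_prefix_tendsto:
  fixes f :: "(nat \<Rightarrow> real) \<Rightarrow> real" and x :: "nat \<Rightarrow> nat"
  assumes f: "\<And>x. 0 \<le> f x" and cont: "continuous_on UNIV f"
  shows "(\<lambda>R. inf_over_prefix f R (map x [0..<R])) \<longlonglongrightarrow> f (\<lambda>k. real (x k))"
proof -
  have "\<exists>y :: nat \<Rightarrow> nat. map y [0..<R] = map x [0..<R] \<and> f (\<lambda>k. real (y k)) \<le> inf_over_prefix f R (map x [0..<R]) + 1 / real (Suc R)" for R
  proof -
    let ?S = "{y :: nat \<Rightarrow> nat. map y [0..<R] = map x [0..<R]}"
    have "(INF y\<in>?S. f (\<lambda>k. real (y k))) < inf_over_prefix f R (map x [0..<R]) + 1 / real (Suc R)"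
      unfolding inf_over_prefix_def by simp
    then obtain y where "y \<in> ?S" "f (\<lambda>k. real (y k)) < inf_over_prefix f R (map x [0..<R]) + 1 / real (Suc R)"
      by (subst (asm) cINF_less_iff) (auto intro!: bdd_belowI2[where m = 0] f)
    then show ?thesis by auto
  qed
  then obtain y :: "nat \<Rightarrow> nat \<Rightarrow> nat" where y: "\<And>R. map (y R) [0..<R] = map x [0..<R]"
    "\<And>R. f (\<lambda>k. real (y R k)) \<le> inf_over_prefix f R (map x [0..<R]) + 1 / real (Suc R)" by metis
  have "(\<lambda>R k. real (y R k)) \<longlonglongrightarrow> (\<lambda>k. real (x k))"
  proof -
    have "(\<lambda>R. real (y R k)) \<longlonglongrightarrow> real (x k)" for k
    proof (rule tendsto_eventually)
      show "\<forall>\<^sub>F R in sequentially. real (y R k) = real (x k)"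
        using eventually_gt_at_top[of k]
      proof eventually_elim
        case (elim R)
        have "map (y R) [0..<R] ! k = map x [0..<R] ! k" by (simp only: y(1))
        then show ?case using elim by simp
      qed
    qed
    then have "limitin (product_topology (\<lambda>_. euclidean) UNIV) (\<lambda>R k. real (y R k)) (\<lambda>k. real (x k)) sequentially"
      by (simp add: limitin_componentwise)
    then show ?thesis by (simp add: euclidean_product_topology)
  qed
  then have "(\<lambda>R. f (\<lambda>k. real (y R k))) \<longlonglongrightarrow> f (\<lambda>k. real (x k))"
    by (rule continuous_on_tendsto_compose[OF cont]) auto
  then have "(\<lambda>R. f (\<lambda>k. real (y R k)) - 1 / real (Suc R)) \<longlonglongrightarrow> f (\<lambda>k. real (x k)) - 0"
    by (intro tendsto_diff) (assumption, real_asymp)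
  then have lo: "(\<lambda>R. f (\<lambda>k. real (y R k)) - 1 / real (Suc R)) \<longlonglongrightarrow> f (\<lambda>k. real (x k))" by simp
  show ?thesis
  proof (rule tendsto_sandwich[OF _ _ lo tendsto_const])
    show "\<forall>\<^sub>F R in sequentially. f (\<lambda>k. real (y R k)) - 1 / real (Suc R) \<le> inf_over_prefix f R (map x [0..<R])"
      using y(2) by (intro always_eventually allI) (simp add: diff_le_eq)
    show "\<forall>\<^sub>F R in sequentially. inf_over_prefix f R (map x [0..<R]) \<le> f (\<lambda>k. real (x k))"
      using inf_over_prefix_bounds(2)[OF f] by (intro always_eventually allI)
  qed
qed

lemma real_sequence_measurable:
  fixes Y :: "nat \<Rightarrow> 'a \<Rightarrow> nat"
  assumes "\<And>k. Y k \<in> measurable N (count_space UNIV)"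
  shows "(\<lambda>\<omega> k. real (Y k \<omega>)) \<in> borel_measurable N"
  by (rule measurable_coordinatewise_then_product) (rule borel_measurable_nat_fun[OF assms])

context pgf_convergence
begin

text \<open>Bound \<open>f\<close> from below by a function of an initial segment, and restrict that function to finitely many segments; the
expectation of the result is a finite combination of convergent probabilities.\<close>

lemma expectation_liminf:
  fixes f :: "(nat \<Rightarrow> real) \<Rightarrow> real"
  assumes f: "\<And>x. 0 \<le> f x" "\<And>x. f x \<le> B" and cont: "continuous_on UNIV f" and e: "e > 0"
  shows "\<forall>\<^sub>F n in sequentially. (\<integral>\<omega>. f (\<lambda>k. real (Z k \<omega>)) \<partial>L) - e < (\<integral>\<omega>. f (\<lambda>k. real (X n k \<omega>)) \<partial>M n)"
proof -
  interpret L: prob_space L by (rule L)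
  have fm: "f \<in> borel_measurable borel" using cont by (rule borel_measurable_continuous_onI)
  have fZ: "(\<lambda>\<omega>. f (\<lambda>k. real (Z k \<omega>))) \<in> borel_measurable L"
    by (rule measurable_compose[OF real_sequence_measurable[OF Z] fm])
  have pm: "(\<lambda>\<omega>. h (initial_segment R Z \<omega>)) \<in> borel_measurable L" for h :: "nat list \<Rightarrow> real" and R
    by (rule measurable_compose[OF initial_segment_measurable[OF Z]]) simp
  have pbL: "0 \<le> inf_over_prefix f R (initial_segment R Z \<omega>)" "inf_over_prefix f R (initial_segment R Z \<omega>) \<le> B" for R \<omega>
    using inf_over_prefix_bounds[where f = f and R = R and x = "\<lambda>k. Z k \<omega>", OF f(1)] f(2)[of "\<lambda>k. real (Z k \<omega>)"]
    unfolding initial_segment_def by auto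
  have "(\<lambda>R. \<integral>\<omega>. inf_over_prefix f R (initial_segment R Z \<omega>) \<partial>L) \<longlonglongrightarrow> (\<integral>\<omega>. f (\<lambda>k. real (Z k \<omega>)) \<partial>L)"
  proof (rule integral_dominated_convergence[where w = "\<lambda>_. B"])
    show "AE \<omega> in L. (\<lambda>R. inf_over_prefix f R (initial_segment R Z \<omega>)) \<longlonglongrightarrow> f (\<lambda>k. real (Z k \<omega>))"
      unfolding initial_segment_def by (intro AE_I2 inf_over_prefix_tendsto f cont)
  qed (use fZ pm pbL in auto)
  then have "\<forall>\<^sub>F R in sequentially. (\<integral>\<omega>. f (\<lambda>k. real (Z k \<omega>)) \<partial>L) - e / 2 < (\<integral>\<omega>. inf_over_prefix f R (initial_segment R Z \<omega>) \<partial>L)"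
    using e by (intro order_tendstoD) auto
  then obtain R where R: "(\<integral>\<omega>. f (\<lambda>k. real (Z k \<omega>)) \<partial>L) - e / 2 < (\<integral>\<omega>. inf_over_prefix f R (initial_segment R Z \<omega>) \<partial>L)"
    by (auto dest: eventually_happens)
  define F where "F m = {l :: nat list. to_nat l \<le> m}" for m
  have F: "finite (F m)" for m
  proof (rule finite_subset)
    show "F m \<subseteq> from_nat ` {..m}" unfolding F_def by (metis (no_types, lifting) atMost_iff from_nat_to_nat image_eqI mem_Collect_eq subsetI)
  qed simp
  let ?cut = "\<lambda>m l. if l \<in> F m then inf_over_prefix f R l else 0"
  have "(\<lambda>m. \<integral>\<omega>. ?cut m (initial_segment R Z \<omega>) \<partial>L) \<longlonglongrightarrow> (\<integral>\<omega>. inf_over_prefix f R (initial_segment R Z \<omega>) \<partial>L)"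
  proof (rule integral_dominated_convergence[where w = "\<lambda>_. B"])
    show "AE \<omega> in L. (\<lambda>m. ?cut m (initial_segment R Z \<omega>)) \<longlonglongrightarrow> inf_over_prefix f R (initial_segment R Z \<omega>)"
    proof (intro AE_I2 tendsto_eventually)
      fix \<omega>
      show "\<forall>\<^sub>F m in sequentially. ?cut m (initial_segment R Z \<omega>) = inf_over_prefix f R (initial_segment R Z \<omega>)"
        using eventually_ge_at_top[of "to_nat (initial_segment R Z \<omega>)"] by eventually_elim (simp add: F_def)
    qed
    show "AE \<omega> in L. norm (?cut m (initial_segment R Z \<omega>)) \<le> B" for m
      using pbL order_trans[OF pbL] by (intro AE_I2) auto
    show "(\<lambda>\<omega>. ?cut m (initial_segment R Z \<omega>)) \<in> borel_measurable L" for m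
      by (rule pm)
  qed (use pm in auto)
  then have "\<forall>\<^sub>F m in sequentially. (\<integral>\<omega>. inf_over_prefix f R (initial_segment R Z \<omega>) \<partial>L) - e / 2 <
      (\<integral>\<omega>. ?cut m (initial_segment R Z \<omega>) \<partial>L)"
    using e by (intro order_tendstoD) auto
  then obtain m where m: "(\<integral>\<omega>. inf_over_prefix f R (initial_segment R Z \<omega>) \<partial>L) - e / 2 <
      (\<integral>\<omega>. ?cut m (initial_segment R Z \<omega>) \<partial>L)"
    by (auto dest: eventually_happens)
  have partL: "(\<Sum>l\<in>F m. inf_over_prefix f R l * measure L {\<omega> \<in> space L. initial_segment R Z \<omega> = l}) =
      (\<integral>\<omega>. ?cut m (initial_segment R Z \<omega>) \<partial>L)"
    by (rule L.expectation_finitely_many_segments[OF Z F, symmetric])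
  have "(\<lambda>n. \<Sum>l\<in>F m. inf_over_prefix f R l * measure (M n) {\<omega> \<in> space (M n). initial_segment R (X n) \<omega> = l})
     \<longlonglongrightarrow> (\<Sum>l\<in>F m. inf_over_prefix f R l * measure L {\<omega> \<in> space L. initial_segment R Z \<omega> = l})"
    by (intro tendsto_sum tendsto_mult tendsto_const prob_initial_segment_limit)
  then have "\<forall>\<^sub>F n in sequentially. (\<integral>\<omega>. f (\<lambda>k. real (Z k \<omega>)) \<partial>L) - e <
      (\<Sum>l\<in>F m. inf_over_prefix f R l * measure (M n) {\<omega> \<in> space (M n). initial_segment R (X n) \<omega> = l})"
    using R m unfolding partL[symmetric] by (intro order_tendstoD(1)) auto
  then show ?thesis using eventually_ge_at_top[of 1]
  proof eventually_elim
    case (elim n)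
    interpret Mn: prob_space "M n" using M elim by simp
    have pbn: "0 \<le> inf_over_prefix f R (initial_segment R (X n) \<omega>)" "inf_over_prefix f R (initial_segment R (X n) \<omega>) \<le> f (\<lambda>k. real (X n k \<omega>))" for \<omega>
      using inf_over_prefix_bounds[where f = f and R = R and x = "\<lambda>k. X n k \<omega>", OF f(1)] unfolding initial_segment_def by auto
    have "(\<integral>\<omega>. ?cut m (initial_segment R (X n) \<omega>) \<partial>M n)
       \<le> (\<integral>\<omega>. f (\<lambda>k. real (X n k \<omega>)) \<partial>M n)"
    proof (rule integral_mono)
      have "(\<lambda>\<omega>. (\<lambda>l. if l \<in> F m then inf_over_prefix f R l else 0) (initial_segment R (X n) \<omega>)) \<in> borel_measurable (M n)"
        by (rule measurable_compose[OF initial_segment_measurable[OF X]]) (use elim in auto)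
      moreover have "norm (?cut m (initial_segment R (X n) \<omega>)) \<le> B" for \<omega>
        using pbn[of \<omega>] f[of "\<lambda>k. real (X n k \<omega>)"] by simp
      ultimately show "integrable (M n) (\<lambda>\<omega>. ?cut m (initial_segment R (X n) \<omega>))"
        by (intro Mn.integrable_const_bound[where B = B]) auto
      show "integrable (M n) (\<lambda>\<omega>. f (\<lambda>k. real (X n k \<omega>)))"
        using f by (intro Mn.integrable_const_bound[where B = B] measurable_compose[OF real_sequence_measurable fm] X) (use elim in auto)
      show "?cut m (initial_segment R (X n) \<omega>) \<le> f (\<lambda>k. real (X n k \<omega>))" for \<omega>
        using pbn[of \<omega>] f(1) by simp
    qed
    then show ?case using elim Mn.expectation_finitely_many_segments[where Y = "X n" and F = "F m" and R = R and h = "inf_over_prefix f R", OF X F] by simp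
  qed
qed

text \<open>Apply the lower bound to \<open>B + f\<close> and to \<open>B - f\<close>.\<close>

theorem convergence_in_distribution:
  fixes f :: "(nat \<Rightarrow> real) \<Rightarrow> real"
  assumes cont: "continuous_on UNIV f" and bdd: "bounded (range f)"
  shows "(\<lambda>n. \<integral>\<omega>. f (\<lambda>k. real (X n k \<omega>)) \<partial>M n) \<longlonglongrightarrow> (\<integral>\<omega>. (f (\<lambda>k. real (Z k \<omega>)) :: real) \<partial>L)"
proof (rule tendstoI)
  fix e :: real assume e: "e > 0"
  interpret L: prob_space L by (rule L)
  obtain B where B: "\<And>x. \<bar>f x\<bar> \<le> B" using bdd unfolding bounded_iff by auto
  have fm: "f \<in> borel_measurable borel" using cont by (rule borel_measurable_continuous_onI)
  have iZ: "integrable L (\<lambda>\<omega>. f (\<lambda>k. real (Z k \<omega>)))"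
    using B by (intro L.integrable_const_bound[where B = B] measurable_compose[OF real_sequence_measurable[OF Z] fm]) auto
  have iX: "integrable (M n) (\<lambda>\<omega>. f (\<lambda>k. real (X n k \<omega>)))" if "n \<ge> 1" for n
  proof -
    interpret prob_space "M n" using M that .
    show ?thesis using B by (intro integrable_const_bound[where B = B] measurable_compose[OF real_sequence_measurable[OF X[OF that]] fm]) auto
  qed
  have b1: "0 \<le> B + f x" "B + f x \<le> 2 * B" for x using B[of x] by auto
  have b2: "0 \<le> B - f x" "B - f x \<le> 2 * B" for x using B[of x] by auto
  have 1: "\<forall>\<^sub>F n in sequentially. (\<integral>\<omega>. B + f (\<lambda>k. real (Z k \<omega>)) \<partial>L) - e < (\<integral>\<omega>. B + f (\<lambda>k. real (X n k \<omega>)) \<partial>M n)"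
    by (rule expectation_liminf[where f = "\<lambda>x. B + f x", OF b1 _ e]) (intro continuous_intros cont)
  have 2: "\<forall>\<^sub>F n in sequentially. (\<integral>\<omega>. B - f (\<lambda>k. real (Z k \<omega>)) \<partial>L) - e < (\<integral>\<omega>. B - f (\<lambda>k. real (X n k \<omega>)) \<partial>M n)"
    by (rule expectation_liminf[where f = "\<lambda>x. B - f x", OF b2 _ e]) (intro continuous_intros cont)
  from 1 2 eventually_ge_at_top[of 1]
  show "\<forall>\<^sub>F n in sequentially. dist (\<integral>\<omega>. f (\<lambda>k. real (X n k \<omega>)) \<partial>M n) (\<integral>\<omega>. f (\<lambda>k. real (Z k \<omega>)) \<partial>L) < e"
  proof eventually_elim
    case (elim n)
    interpret Mn: prob_space "M n" using M elim(3) .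
    show ?case using elim(1,2) iZ iX[OF elim(3)]
      by (simp add: L.prob_space Mn.prob_space dist_real_def abs_less_iff)
  qed
qed

end

text \<open>The convergence result for a constant sequence of laws identifies the laws of initial segments, and these generate the
product \<open>\<sigma>\<close>-algebra.\<close>

theorem equal_pgfs_imp_equal_laws:
  fixes Y :: "nat \<Rightarrow> 'a \<Rightarrow> nat" and Z :: "nat \<Rightarrow> 'b \<Rightarrow> nat"
  assumes N: "prob_space N" and L: "prob_space L"
    and Y: "\<And>k. Y k \<in> measurable N (count_space UNIV)" and Z: "\<And>k. Z k \<in> measurable L (count_space UNIV)"
    and pgf: "\<And>R u. (\<And>k. k < R \<Longrightarrow> u k \<in> {0..1::real}) \<Longrightarrow>
      (\<integral>\<omega>. (\<Prod>k<R. u k ^ Y k \<omega>) \<partial>N) = (\<integral>\<omega>. (\<Prod>k<R. u k ^ Z k \<omega>) \<partial>L)"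
  shows "distr N borel (\<lambda>\<omega> k. real (Y k \<omega>)) = distr L borel (\<lambda>\<omega> k. real (Z k \<omega>))"
proof -
  interpret N: prob_space N by (rule N)
  interpret L: prob_space L by (rule L)
  interpret pgf_convergence "\<lambda>_. N" "\<lambda>_. Y" L Z
    by unfold_locales (use N L Y Z pgf in auto)
  have segment_law: "distr N (count_space UNIV) (initial_segment R Y) = distr L (count_space UNIV) (initial_segment R Z)" for R
  proof (rule measure_eqI_countable[where A = UNIV])
    fix l :: "nat list"
    have "measure N {\<omega> \<in> space N. initial_segment R Y \<omega> = l} = measure L {\<omega> \<in> space L. initial_segment R Z \<omega> = l}"
      using LIMSEQ_unique[OF tendsto_const prob_initial_segment_limit] .
    then show "emeasure (distr N (count_space UNIV) (initial_segment R Y)) {l} = emeasure (distr L (count_space UNIV) (initial_segment R Z)) {l}"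
      using initial_segment_measurable[OF Y, of R] initial_segment_measurable[OF Z, of R]
      by (simp add: emeasure_distr N.emeasure_eq_measure L.emeasure_eq_measure vimage_def Int_def conj_commute)
  qed auto
  let ?y = "\<lambda>\<omega> k. real (Y k \<omega>)" and ?z = "\<lambda>\<omega> k. real (Z k \<omega>)"
  have my: "?y \<in> borel_measurable N" by (rule real_sequence_measurable[OF Y])
  have mz: "?z \<in> borel_measurable L" by (rule real_sequence_measurable[OF Z])
  show ?thesis
  proof (rule measure_eqI_PiM_infinite[where I = UNIV and M = "\<lambda>_. borel"])
    show "sets (distr N borel ?y) = sets (PiM UNIV (\<lambda>_. borel))" "sets (distr L borel ?z) = sets (PiM UNIV (\<lambda>_. borel))"
      by (simp_all add: sets_PiM_equal_borel)
    show "finite_measure (distr N borel ?y)"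
      using N.prob_space_distr[OF my] by (simp add: prob_space_def)
    fix A :: "nat \<Rightarrow> real set" and J :: "nat set"
    assume J: "finite J" and A: "\<And>i. i \<in> J \<Longrightarrow> A i \<in> sets borel"
    let ?C = "prod_emb UNIV (\<lambda>_. borel) J (Pi\<^sub>E J A)"
    have C: "?C \<in> sets borel"
      using sets_PiM_I[of J UNIV A "\<lambda>_. borel"] J A by (simp add: sets_PiM_equal_borel)
    have memC: "x \<in> ?C \<longleftrightarrow> (\<forall>i\<in>J. x i \<in> A i)" for x
      by (auto simp: prod_emb_def PiE_iff)
    define R where "R = Suc (Max (insert 0 J))"
    have R: "i < R" if "i \<in> J" for i using that J unfolding R_def by (auto simp: less_Suc_eq_le)
    let ?B = "{l :: nat list. \<forall>i\<in>J. real (l ! i) \<in> A i}"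
    have "emeasure (distr N borel ?y) ?C = emeasure (distr N (count_space UNIV) (initial_segment R Y)) ?B"
    proof -
      have "?y -` ?C \<inter> space N = initial_segment R Y -` ?B \<inter> space N"
        using R by (auto simp: memC initial_segment_def)
      then show ?thesis using C my initial_segment_measurable[OF Y, of R] by (simp add: emeasure_distr)
    qed
    also have "\<dots> = emeasure (distr L (count_space UNIV) (initial_segment R Z)) ?B" unfolding segment_law ..
    also have "\<dots> = emeasure (distr L borel ?z) ?C"
    proof -
      have "?z -` ?C \<inter> space L = initial_segment R Z -` ?B \<inter> space L"
        using R by (auto simp: memC initial_segment_def)
      then show ?thesis using C mz initial_segment_measurable[OF Z, of R] by (simp add: emeasure_distr)
    qed
    finally show "emeasure (distr N borel ?y) ?C = emeasure (distr L borel ?z) ?C" .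
  qed
qed

section \<open>The mixed Poisson sequence\<close>

lemma expectation_power_poisson:
  assumes t: "t > 0" and u: "u \<in> {0..1::real}"
  shows "(\<integral>k. u ^ k \<partial>measure_pmf (poisson_pmf t)) = exp (- ((1 - u) * t))"
proof -
  have eq: "pmf (poisson_pmf t) k *\<^sub>R u ^ k = exp (- t) * ((u * t) ^ k /\<^sub>R fact k)" for k
    using t by (simp add: power_mult_distrib divide_inverse mult_ac)
  have sums: "(\<lambda>k. exp (- t) * ((u * t) ^ k /\<^sub>R fact k)) sums (exp (- t) * exp (u * t))"
    by (intro sums_mult exp_converges)
  have "(\<lambda>k. pmf (poisson_pmf t) k *\<^sub>R u ^ k) sums (exp (- t) * exp (u * t))"
    unfolding eq by (rule sums)
  moreover have "integrable (count_space UNIV) (\<lambda>k. pmf (poisson_pmf t) k *\<^sub>R u ^ k)"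
  proof -
    have "summable (\<lambda>k. norm (pmf (poisson_pmf t) k *\<^sub>R u ^ k))"
      using calculation u by (simp add: sums_iff)
    then show ?thesis by (simp add: integrable_count_space_nat_iff)
  qed
  then have "(\<lambda>k. pmf (poisson_pmf t) k *\<^sub>R u ^ k) sums (\<integral>k. pmf (poisson_pmf t) k *\<^sub>R u ^ k \<partial>count_space UNIV)"
    by (rule sums_integral_count_space_nat)
  ultimately have "(\<integral>k. pmf (poisson_pmf t) k *\<^sub>R u ^ k \<partial>count_space UNIV) = exp (- t) * exp (u * t)"
    by (rule sums_unique2[rotated])
  moreover have "(\<integral>k. u ^ k \<partial>measure_pmf (poisson_pmf t)) = (\<integral>k. pmf (poisson_pmf t) k *\<^sub>R u ^ k \<partial>count_space UNIV)"
    unfolding measure_pmf_eq_density by (subst integral_density) auto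
  ultimately show ?thesis by (simp add: exp_add[symmetric] algebra_simps)
qed

lemma expectation_exp_exponential:
  assumes "prob_space P" and E: "distributed P lborel E (exponential_density 1)" and c: "c \<ge> 0"
  shows "(\<integral>\<omega>. exp (- (c * E \<omega>)) \<partial>P) = 1 / (1 + c)"
proof -
  interpret prob_space "density lborel (exponential_density (1 + c))"
    using c by (intro prob_space_exponential_density) auto
  have "(\<integral>x. (1::real) \<partial>density lborel (exponential_density (1 + c))) = 1"
    using prob_space by simp
  then have 1: "(\<integral>x. exponential_density (1 + c) x \<partial>lborel) = 1"
    using c by (subst (asm) integral_density) (auto simp: exponential_density_def intro!: AE_I2)
  have "(\<integral>\<omega>. exp (- (c * E \<omega>)) \<partial>P) = (\<integral>x. exponential_density 1 x * exp (- (c * x)) \<partial>lborel)"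
    by (rule distributed_integral[OF E, symmetric]) (auto simp: exponential_density_def)
  also have "\<dots> = (\<integral>x. 1 / (1 + c) * exponential_density (1 + c) x \<partial>lborel)"
  proof (rule Bochner_Integration.integral_cong[OF refl])
    fix x
    have "exp (- x) * exp (- (c * x)) = exp (- x * (1 + c))" by (simp add: exp_add[symmetric] algebra_simps)
    moreover have "1 + c \<noteq> 0" using c by linarith
    ultimately show "exponential_density 1 x * exp (- (c * x)) = 1 / (1 + c) * exponential_density (1 + c) x"
      by (simp add: exponential_density_def)
  qed
  also have "\<dots> = 1 / (1 + c)" by (simp add: 1)
  finally show ?thesis .
qed

locale exp_poisson =
  fixes P :: "'c measure" and E :: "'c \<Rightarrow> real" and N :: "nat \<Rightarrow> real \<Rightarrow> 'c \<Rightarrow> nat"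
  assumes model: "exp_poisson_model P E N"
begin

sublocale prob_space P using model unfolding exp_poisson_model_def by blast

lemma E_distributed: "distributed P lborel E (exponential_density 1)"
  and E_nonneg: "\<omega> \<in> space P \<Longrightarrow> 0 \<le> E \<omega>"
  and N_process: "r \<ge> 1 \<Longrightarrow> unit_poisson_process P (N r)"
  using model unfolding exp_poisson_model_def by blast+

lemma E_measurable [measurable]: "E \<in> borel_measurable P"
  using E_distributed unfolding distributed_def by simp

lemma N_measurable: "r \<ge> 1 \<Longrightarrow> t \<ge> 0 \<Longrightarrow> N r t \<in> measurable P (count_space UNIV)"
  using N_process unfolding unit_poisson_process_def by blast

lemma N_pgf:
  assumes r: "r \<ge> 1" and t: "t > 0" and u: "u \<in> {0..1::real}"
  shows "expectation (\<lambda>\<omega>. u ^ N r t \<omega>) = exp (- ((1 - u) * t))"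
proof -
  have z: "N r 0 \<omega> = 0" if "\<omega> \<in> space P" for \<omega>
    using N_process[OF r] that unfolding unit_poisson_process_def by blast
  have d: "distr P (count_space UNIV) (\<lambda>\<omega>. N r t \<omega> - N r 0 \<omega>) = measure_pmf (poisson_pmf (t - 0))"
    using N_process[OF r] t unfolding unit_poisson_process_def by blast
  have m: "(\<lambda>\<omega>. N r t \<omega> - N r 0 \<omega>) \<in> measurable P (count_space UNIV)"
  proof -
    have "N r t \<in> measurable P (count_space UNIV)" using r t by (intro N_measurable) auto
    moreover have "(\<lambda>\<omega>. N r t \<omega> - N r 0 \<omega>) \<in> measurable P (count_space UNIV) \<longleftrightarrow> N r t \<in> measurable P (count_space UNIV)"
      by (rule measurable_cong) (simp add: z)
    ultimately show ?thesis by simp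
  qed
  have "expectation (\<lambda>\<omega>. u ^ N r t \<omega>) = expectation (\<lambda>\<omega>. u ^ (N r t \<omega> - N r 0 \<omega>))"
    by (intro Bochner_Integration.integral_cong) (auto simp: z)
  also have "\<dots> = (\<integral>k. u ^ k \<partial>distr P (count_space UNIV) (\<lambda>\<omega>. N r t \<omega> - N r 0 \<omega>))"
    using m by (subst integral_distr) auto
  also have "\<dots> = exp (- ((1 - u) * t))"
    unfolding d using expectation_power_poisson[OF t u] by simp
  finally show ?thesis .
qed

text \<open>For deterministic times \<open>\<tau> r\<close>, each factor is a function of just one of the independent objects \<open>E\<close>, \<open>N 1\<close>, \<dots>, \<open>N R\<close>.\<close>

lemma E_N_independent:
  fixes \<tau> :: "nat \<Rightarrow> real" and h :: "real \<Rightarrow> real"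
  assumes \<tau>: "\<And>r. r \<in> {1..R} \<Longrightarrow> 0 \<le> \<tau> r" and h: "h \<in> borel_measurable borel" and h01: "\<And>x. h x \<in> {0..1}"
    and u: "\<And>r. r \<in> {1..R} \<Longrightarrow> u r \<in> {0..1::real}"
  shows "expectation (\<lambda>\<omega>. h (E \<omega>) * (\<Prod>r\<in>{1..R}. u r ^ N r (\<tau> r) \<omega>)) =
     expectation (\<lambda>\<omega>. h (E \<omega>)) * (\<Prod>r\<in>{1..R}. expectation (\<lambda>\<omega>. u r ^ N r (\<tau> r) \<omega>))"
proof -
  define W where "W r \<omega> = (if r = 0 then h (E \<omega>) else u r ^ N r (\<tau> r) \<omega>)" for r \<omega>
  let ?F = "\<lambda>r. if r = 0 then sets (vimage_algebra (space P) E borel)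
            else sets (vimage_algebra (space P) (\<lambda>\<omega>. \<lambda>t\<in>{0..}. N r t \<omega>) (Pi\<^sub>M {0..} (\<lambda>_. count_space UNIV)))"
  have ind: "indep_sets ?F UNIV" using model unfolding exp_poisson_model_def by blast
  have Wm: "W r \<in> borel_measurable P" if "r \<in> {0..R}" for r
  proof (cases "r = 0")
    case True
    have "(\<lambda>\<omega>. h (E \<omega>)) \<in> borel_measurable P" by (rule measurable_compose[OF E_measurable h])
    then show ?thesis using True by (simp add: W_def[abs_def])
  next
    case False
    have "(\<lambda>\<omega>. u r ^ N r (\<tau> r) \<omega>) \<in> borel_measurable P"
      using False that \<tau> by (intro borel_measurable_nat_fun N_measurable) auto
    then show ?thesis using False by (simp add: W_def[abs_def])
  qed
  have "indep_vars (\<lambda>_. borel) W {0..R}"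
    unfolding indep_vars_def2
  proof (intro conjI ballI)
    show "indep_sets (\<lambda>i. {W i -` A \<inter> space P |A. A \<in> sets borel}) {0..R}"
    proof (rule indep_sets_mono[OF ind])
      fix r assume r: "r \<in> {0..R}"
      show "{W r -` A \<inter> space P |A. A \<in> sets borel} \<subseteq> ?F r"
      proof (intro subsetI, elim CollectE exE conjE)
        fix B A assume B: "B = W r -` A \<inter> space P" and A: "A \<in> sets (borel :: real measure)"
        show "B \<in> ?F r"
        proof (cases "r = 0")
          case True
          have "h -` A \<in> sets borel" using measurable_sets[OF h A] by simp
          then have "E -` (h -` A) \<inter> space P \<in> sets (vimage_algebra (space P) E borel)" by (rule in_vimage_algebra)
          then show ?thesis using True unfolding B by (simp add: W_def[abs_def] vimage_def)
        next
          case False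
          let ?Pi = "Pi\<^sub>M {0::real..} (\<lambda>_. count_space (UNIV :: nat set))"
          let ?S = "(\<lambda>p. u r ^ p (\<tau> r)) -` A \<inter> space ?Pi"
          have t0: "0 \<le> \<tau> r" using \<tau> r False by auto
          have "(\<lambda>p. u r ^ p (\<tau> r)) \<in> borel_measurable ?Pi"
            using t0 by (intro borel_measurable_nat_fun measurable_component_singleton) auto
          then have S: "?S \<in> sets ?Pi" using A by (rule measurable_sets)
          have "(\<lambda>\<omega>. \<lambda>t\<in>{0..}. N r t \<omega>) -` ?S \<inter> space P = B"
            unfolding B using t0 False by (auto simp: W_def space_PiM)
          then show ?thesis using in_vimage_algebra[OF S, of "\<lambda>\<omega>. \<lambda>t\<in>{0..}. N r t \<omega>" "space P"] False by simp
        qed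
      qed
    qed simp
  qed (use Wm in auto)
  moreover have "integrable P (W r)" if r: "r \<in> {0..R}" for r
  proof (rule integrable_unit_valued[OF Wm[OF r]])
    fix \<omega>
    show "W r \<omega> \<in> {0..1}" using u[of r] h01[of "E \<omega>"] r unfolding W_def by (auto intro: power_le_one)
  qed
  ultimately have "expectation (\<lambda>\<omega>. \<Prod>r\<in>{0..R}. W r \<omega>) = (\<Prod>r\<in>{0..R}. expectation (W r))"
    by (intro indep_vars_lebesgue_integral) auto
  moreover have "{0..R} = insert 0 {1..R}" by auto
  ultimately show ?thesis by (simp add: W_def[abs_def])
qed

text \<open>The index of the dyadic interval of length \<open>2 ^ (- j)\<close> that contains \<open>E \<omega>\<close>.\<close>

definition cell :: "nat \<Rightarrow> 'c \<Rightarrow> nat" where "cell j \<omega> = nat \<lfloor>2 ^ j * E \<omega>\<rfloor>"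

text \<open>The right end point of a dyadic interval.  Approximating \<open>E\<close> from the right matches the one-sided continuity of the
paths.\<close>

definition grid :: "nat \<Rightarrow> nat \<Rightarrow> real" where "grid j i = real (Suc i) / 2 ^ j"

lemma grid_pos: "0 < grid j i" by (simp add: grid_def)

lemma grid_cell_bounds:
  assumes "\<omega> \<in> space P"
  shows "E \<omega> < grid j (cell j \<omega>)" "grid j (cell j \<omega>) \<le> E \<omega> + 1 / 2 ^ j"
proof -
  have c: "real (cell j \<omega>) = of_int \<lfloor>2 ^ j * E \<omega>\<rfloor>"
    unfolding cell_def using E_nonneg[OF assms] by simp
  have "2 ^ j * E \<omega> < real (Suc (cell j \<omega>))" "real (Suc (cell j \<omega>)) \<le> 2 ^ j * E \<omega> + 1"
    unfolding of_nat_Suc c by linarith+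
  then show "E \<omega> < grid j (cell j \<omega>)" "grid j (cell j \<omega>) \<le> E \<omega> + 1 / 2 ^ j"
    by (auto simp: grid_def field_simps)
qed

lemma grid_cell_tendsto:
  assumes "\<omega> \<in> space P"
  shows "(\<lambda>j. grid j (cell j \<omega>)) \<longlonglongrightarrow> E \<omega>"
proof (rule tendsto_sandwich[OF _ _ tendsto_const])
  have "(\<lambda>j. E \<omega> + 1 / 2 ^ j) \<longlonglongrightarrow> E \<omega> + 0" by (intro tendsto_intros) real_asymp
  then show "(\<lambda>j. E \<omega> + 1 / 2 ^ j) \<longlonglongrightarrow> E \<omega>" by simp
qed (use grid_cell_bounds[OF assms] in \<open>auto intro!: always_eventually less_imp_le\<close>)

lemma N_discretized_tendsto:
  assumes r: "r \<ge> 1" and \<omega>: "\<omega> \<in> space P"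
  shows "\<forall>\<^sub>F j in sequentially. N r (grid j (cell j \<omega>) / fact r) \<omega> = N r (E \<omega> / fact r) \<omega>"
proof -
  let ?t = "E \<omega> / fact r"
  have "continuous (at_right ?t) (\<lambda>s. real (N r s \<omega>))"
    using N_process[OF r] \<omega> E_nonneg[OF \<omega>] unfolding unit_poisson_process_def by simp
  then have "((\<lambda>s. real (N r s \<omega>)) \<longlongrightarrow> real (N r ?t \<omega>)) (at_right ?t)"
    by (simp add: continuous_within)
  moreover have "filterlim (\<lambda>j. grid j (cell j \<omega>) / fact r) (at_right ?t) sequentially"
    unfolding filterlim_at
  proof
    show "(\<lambda>j. grid j (cell j \<omega>) / fact r) \<longlonglongrightarrow> ?t"
      by (intro tendsto_divide grid_cell_tendsto[OF \<omega>] tendsto_const) simp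
    show "\<forall>\<^sub>F j in sequentially. grid j (cell j \<omega>) / fact r \<in> {?t<..} \<and> grid j (cell j \<omega>) / fact r \<noteq> ?t"
      using grid_cell_bounds(1)[OF \<omega>] by (intro always_eventually allI) (auto simp: divide_strict_right_mono less_imp_neq[THEN not_sym])
  qed
  ultimately have "(\<lambda>j. real (N r (grid j (cell j \<omega>) / fact r) \<omega>)) \<longlonglongrightarrow> real (N r ?t \<omega>)"
    by (rule filterlim_compose)
  then have "\<forall>\<^sub>F j in sequentially. dist (real (N r (grid j (cell j \<omega>) / fact r) \<omega>)) (real (N r ?t \<omega>)) < 1"
    by (rule tendstoD) simp
  then show ?thesis by eventually_elim (simp add: dist_real_def)
qed

lemma cell_measurable: "cell j \<in> measurable P (count_space UNIV)"
  unfolding cell_def[abs_def] by measurable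

lemma N_discretized_measurable:
  assumes "r \<ge> 1"
  shows "(\<lambda>\<omega>. N r (grid j (cell j \<omega>) / fact r) \<omega>) \<in> measurable P (count_space UNIV)"
proof (rule measurable_compose_countable[OF _ cell_measurable])
  show "N r (grid j i / fact r) \<in> measurable P (count_space UNIV)" for i
    using assms grid_pos[of j i] by (intro N_measurable) auto
qed

lemma N_E_measurable:
  assumes r: "r \<ge> 1"
  shows "(\<lambda>\<omega>. N r (E \<omega> / fact r) \<omega>) \<in> measurable P (count_space UNIV)"
proof -
  have "(\<lambda>\<omega>. real (N r (E \<omega> / fact r) \<omega>)) \<in> borel_measurable P"
  proof (rule borel_measurable_LIMSEQ_metric)
    show "(\<lambda>\<omega>. real (N r (grid j (cell j \<omega>) / fact r) \<omega>)) \<in> borel_measurable P" for j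
      by (rule borel_measurable_nat_fun[OF N_discretized_measurable[OF r]])
    show "(\<lambda>j. real (N r (grid j (cell j \<omega>) / fact r) \<omega>)) \<longlonglongrightarrow> real (N r (E \<omega> / fact r) \<omega>)" if "\<omega> \<in> space P" for \<omega>
      using N_discretized_tendsto[OF r that] by (intro tendsto_eventually) (auto elim: eventually_mono)
  qed
  then have "(\<lambda>\<omega>. nat \<lfloor>real (N r (E \<omega> / fact r) \<omega>)\<rfloor>) \<in> measurable P (count_space UNIV)" by measurable
  then show ?thesis by simp
qed

text \<open>On each event \<open>cell j \<omega> = i\<close> the processes are evaluated at deterministic times, where independence applies.  The
infinitely many cells are reached as a limit of finitely many.\<close>

lemma discretized_pgf:
  assumes u: "\<And>r. r \<in> {1..R} \<Longrightarrow> u r \<in> {0..1::real}"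
  shows "expectation (\<lambda>\<omega>. \<Prod>r\<in>{1..R}. u r ^ N r (grid j (cell j \<omega>) / fact r) \<omega>) =
    expectation (\<lambda>\<omega>. exp (- ((\<Sum>r\<in>{1..R}. (1 - u r) / fact r) * grid j (cell j \<omega>))))"
proof -
  let ?c = "\<Sum>r\<in>{1..R}. (1 - u r) / fact r"
  define A where "A \<omega> = (\<Prod>r\<in>{1..R}. u r ^ N r (grid j (cell j \<omega>) / fact r) \<omega>)" for \<omega>
  define B where "B \<omega> = exp (- (?c * grid j (cell j \<omega>)))" for \<omega>
  have c0: "0 \<le> ?c" using u by (intro sum_nonneg) auto
  have Am: "A \<in> borel_measurable P"
    unfolding A_def[abs_def] by (intro borel_measurable_prod borel_measurable_nat_fun N_discretized_measurable) auto
  have Bm: "B \<in> borel_measurable P"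
    unfolding B_def[abs_def] by (rule measurable_compose[OF cell_measurable]) simp
  have A01: "A \<omega> \<in> {0..1}" for \<omega>
    unfolding A_def using u by (auto intro!: prod_nonneg prod_le_1 power_le_one)
  have B01: "B \<omega> \<in> {0..1}" for \<omega> using c0 grid_pos[of j "cell j \<omega>"] unfolding B_def by simp
  have im: "(\<lambda>\<omega>. of_bool (Q (cell j \<omega>)) :: real) \<in> borel_measurable P" for Q
    by (rule measurable_compose[OF cell_measurable]) simp
  have cell_eq: "expectation (\<lambda>\<omega>. of_bool (cell j \<omega> = i) * A \<omega>) = expectation (\<lambda>\<omega>. of_bool (cell j \<omega> = i) * B \<omega>)" for i
  proof -
    let ?h = "\<lambda>x :: real. of_bool (nat \<lfloor>2 ^ j * x\<rfloor> = i) :: real"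
    have h: "?h \<in> borel_measurable borel"
    proof -
      have "(\<lambda>x :: real. nat \<lfloor>2 ^ j * x\<rfloor>) \<in> measurable borel (count_space UNIV)" by measurable
      then show ?thesis by (rule borel_measurable_nat_fun)
    qed
    have "expectation (\<lambda>\<omega>. of_bool (cell j \<omega> = i) * A \<omega>) =
       expectation (\<lambda>\<omega>. ?h (E \<omega>) * (\<Prod>r\<in>{1..R}. u r ^ N r (grid j i / fact r) \<omega>))"
      by (intro Bochner_Integration.integral_cong) (auto simp: A_def cell_def)
    also have "\<dots> = expectation (\<lambda>\<omega>. ?h (E \<omega>)) * (\<Prod>r\<in>{1..R}. expectation (\<lambda>\<omega>. u r ^ N r (grid j i / fact r) \<omega>))"
      using grid_pos[of j i] by (intro E_N_independent h u) auto
    also have "(\<Prod>r\<in>{1..R}. expectation (\<lambda>\<omega>. u r ^ N r (grid j i / fact r) \<omega>)) = (\<Prod>r\<in>{1..R}. exp (- ((1 - u r) * (grid j i / fact r))))"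
      using grid_pos[of j i] by (intro prod.cong refl N_pgf u) auto
    also have "\<dots> = exp (- (?c * grid j i))"
      by (simp add: exp_sum[symmetric] sum_negf[symmetric] sum_distrib_right)
    also have "expectation (\<lambda>\<omega>. ?h (E \<omega>)) * exp (- (?c * grid j i)) = expectation (\<lambda>\<omega>. ?h (E \<omega>) * exp (- (?c * grid j i)))"
      by simp
    also have "\<dots> = expectation (\<lambda>\<omega>. of_bool (cell j \<omega> = i) * B \<omega>)"
      by (intro Bochner_Integration.integral_cong) (auto simp: B_def cell_def)
    finally show ?thesis .
  qed
  have partial: "expectation (\<lambda>\<omega>. of_bool (cell j \<omega> < m) * F \<omega>) = (\<Sum>i<m. expectation (\<lambda>\<omega>. of_bool (cell j \<omega> = i) * F \<omega>))"
    if F: "F \<in> borel_measurable P" "\<And>\<omega>. F \<omega> \<in> {0..1::real}" for F m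
  proof -
    have "integrable P (\<lambda>\<omega>. of_bool (cell j \<omega> = i) * F \<omega>)" for i
      using F(2) by (intro integrable_unit_valued borel_measurable_times im[of "\<lambda>x. x = i"] F(1)) auto
    then have "(\<Sum>i<m. expectation (\<lambda>\<omega>. of_bool (cell j \<omega> = i) * F \<omega>)) = expectation (\<lambda>\<omega>. \<Sum>i<m. of_bool (cell j \<omega> = i) * F \<omega>)"
      by (subst Bochner_Integration.integral_sum) auto
    also have "\<dots> = expectation (\<lambda>\<omega>. of_bool (cell j \<omega> < m) * F \<omega>)"
      by (intro Bochner_Integration.integral_cong) (auto simp: of_bool_def if_distrib[of "\<lambda>x. x * _"] cong: if_cong)
    finally show ?thesis ..
  qed
  have lim: "(\<lambda>m. expectation (\<lambda>\<omega>. of_bool (cell j \<omega> < m) * F \<omega>)) \<longlonglongrightarrow> expectation F"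
    if F: "F \<in> borel_measurable P" "\<And>\<omega>. F \<omega> \<in> {0..1::real}" for F
  proof (rule integral_dominated_convergence[where w = "\<lambda>_. 1"])
    show "AE \<omega> in P. (\<lambda>m. of_bool (cell j \<omega> < m) * F \<omega>) \<longlonglongrightarrow> F \<omega>"
    proof (intro AE_I2 tendsto_eventually)
      fix \<omega> show "\<forall>\<^sub>F m in sequentially. of_bool (cell j \<omega> < m) * F \<omega> = F \<omega>"
        using eventually_gt_at_top[of "cell j \<omega>"] by eventually_elim simp
    qed
    show "(\<lambda>\<omega>. of_bool (cell j \<omega> < m) * F \<omega>) \<in> borel_measurable P" for m
      by (intro borel_measurable_times im[of "\<lambda>x. x < m"] F(1))
  qed (use F in auto)
  have "expectation A = expectation B"
    using lim[OF Am A01] lim[OF Bm B01] unfolding partial[OF Am A01] partial[OF Bm B01] cell_eq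
    by (rule LIMSEQ_unique)
  then show ?thesis unfolding A_def B_def .
qed

theorem finite_pgf:
  assumes u: "\<And>r. r \<in> {1..R} \<Longrightarrow> u r \<in> {0..1::real}"
  shows "expectation (\<lambda>\<omega>. \<Prod>r\<in>{1..R}. u r ^ N r (E \<omega> / fact r) \<omega>) = 1 / (1 + (\<Sum>r\<in>{1..R}. (1 - u r) / fact r))"
proof -
  let ?c = "\<Sum>r\<in>{1..R}. (1 - u r) / fact r"
  let ?A = "\<lambda>j \<omega>. \<Prod>r\<in>{1..R}. u r ^ N r (grid j (cell j \<omega>) / fact r) \<omega>" and ?Z = "\<lambda>\<omega>. \<Prod>r\<in>{1..R}. u r ^ N r (E \<omega> / fact r) \<omega>"
  have c0: "0 \<le> ?c" using u by (intro sum_nonneg) auto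
  have 1: "(\<lambda>j. expectation (\<lambda>\<omega>. ?A j \<omega>)) \<longlonglongrightarrow>
     expectation (\<lambda>\<omega>. ?Z \<omega>)"
  proof (rule integral_dominated_convergence[where w = "\<lambda>_. 1"])
    show "AE \<omega> in P. (\<lambda>j. ?A j \<omega>) \<longlonglongrightarrow> ?Z \<omega>"
    proof (intro AE_I2 tendsto_prod tendsto_eventually)
      fix \<omega> r assume "\<omega> \<in> space P" "r \<in> {1..R}"
      then have "\<forall>\<^sub>F j in sequentially. N r (grid j (cell j \<omega>) / fact r) \<omega> = N r (E \<omega> / fact r) \<omega>"
        by (intro N_discretized_tendsto) auto
      then show "\<forall>\<^sub>F j in sequentially. u r ^ N r (grid j (cell j \<omega>) / fact r) \<omega> = u r ^ N r (E \<omega> / fact r) \<omega>"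
        by eventually_elim simp
    qed
    show "(\<lambda>\<omega>. ?A j \<omega>) \<in> borel_measurable P" for j
      by (intro borel_measurable_prod borel_measurable_nat_fun N_discretized_measurable) auto
    show "(\<lambda>\<omega>. ?Z \<omega>) \<in> borel_measurable P"
      by (intro borel_measurable_prod borel_measurable_nat_fun N_E_measurable) auto
    have "?A j \<omega> \<in> {0..1}" for j \<omega>
      using u by (auto intro!: prod_nonneg prod_le_1 power_le_one)
    then show "AE \<omega> in P. norm (?A j \<omega>) \<le> 1" for j
      by (intro AE_I2) auto
  qed simp
  have 2: "(\<lambda>j. expectation (\<lambda>\<omega>. exp (- (?c * grid j (cell j \<omega>))))) \<longlonglongrightarrow> expectation (\<lambda>\<omega>. exp (- (?c * E \<omega>)))"
  proof (rule integral_dominated_convergence[where w = "\<lambda>_. 1"])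
    show "AE \<omega> in P. (\<lambda>j. exp (- (?c * grid j (cell j \<omega>)))) \<longlonglongrightarrow> exp (- (?c * E \<omega>))"
      by (intro AE_I2 tendsto_intros grid_cell_tendsto)
    show "(\<lambda>\<omega>. exp (- (?c * grid j (cell j \<omega>)))) \<in> borel_measurable P" for j
      by (rule measurable_compose[OF cell_measurable]) simp
    have "0 \<le> ?c * grid j (cell j \<omega>)" for j \<omega> using c0 grid_pos[of j "cell j \<omega>"] by simp
    then show "AE \<omega> in P. norm (exp (- (?c * grid j (cell j \<omega>)))) \<le> 1" for j
      by (intro AE_I2) simp
  qed auto
  have "expectation (\<lambda>\<omega>. ?Z \<omega>) = expectation (\<lambda>\<omega>. exp (- (?c * E \<omega>)))"
  proof -
    have "expectation (\<lambda>\<omega>. ?A j \<omega>) =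
      expectation (\<lambda>\<omega>. exp (- (?c * grid j (cell j \<omega>))))" for j
      by (rule discretized_pgf) (rule u)
    then show ?thesis using 1 2 by (simp only:) (rule LIMSEQ_unique)
  qed
  also have "\<dots> = 1 / (1 + ?c)"
    by (rule expectation_exp_exponential[OF prob_space_axioms E_distributed c0])
  finally show ?thesis .
qed

end

section \<open>The limit law and the convergence theorem\<close>

text \<open>As \<open>exp 1 - 1\<close> is the sum of \<open>1 / r!\<close> over \<open>r \<ge> 1\<close>, the generating function of the limit law is the limit of the
finite-dimensional ones.\<close>

lemma limit_pgf_value:
  assumes u: "\<And>r. r \<ge> 1 \<Longrightarrow> 0 \<le> u r \<and> u r \<le> (1::real)"
  shows "(\<lambda>m. 1 / (1 + (\<Sum>r\<in>{1..m}. (1 - u r) / fact r)))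
      \<longlonglongrightarrow> inverse (exp 1 - (\<Sum>k. u (Suc k) / fact (Suc k)))"
proof -
  have "(\<lambda>k. 1 ^ k /\<^sub>R fact k) sums (exp 1 :: real)" by (rule exp_converges)
  then have "(\<lambda>k. 1 / fact k) sums (exp 1 :: real)" by (simp add: divide_inverse)
  then have e: "(\<lambda>k. 1 / fact (Suc k)) sums (exp 1 - 1 :: real)"
    using sums_split_initial_segment[of "\<lambda>k. 1 / fact k" "exp 1 :: real" 1] by simp
  have "summable (\<lambda>k. u (Suc k) / fact (Suc k))"
  proof (rule summable_comparison_test'[OF sums_summable[OF e]])
    fix k show "norm (u (Suc k) / fact (Suc k)) \<le> 1 / fact (Suc k)"
      using u[of "Suc k"] by (auto intro: divide_right_mono)
  qed
  then have "(\<lambda>k. u (Suc k) / fact (Suc k)) sums (\<Sum>k. u (Suc k) / fact (Suc k))" by (rule summable_sums)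
  from sums_diff[OF e this]
  have s: "(\<lambda>k. (1 - u (Suc k)) / fact (Suc k)) sums (exp 1 - 1 - (\<Sum>k. u (Suc k) / fact (Suc k)))"
    by (simp add: diff_divide_distrib)
  have ge: "0 \<le> exp 1 - 1 - (\<Sum>k. u (Suc k) / fact (Suc k))"
    using u by (intro sums_le[OF _ sums_zero s]) (auto intro!: divide_nonneg_nonneg)
  have "(\<Sum>r\<in>{1..m}. (1 - u r) / fact r) = (\<Sum>k<m. (1 - u (Suc k)) / fact (Suc k))" for m
    by (simp add: sum.atLeast1_atMost_eq)
  with s have "(\<lambda>m. \<Sum>r\<in>{1..m}. (1 - u r) / fact r) \<longlonglongrightarrow> exp 1 - 1 - (\<Sum>k. u (Suc k) / fact (Suc k))"
    by (simp add: sums_def)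
  then have "(\<lambda>m. inverse (1 + (\<Sum>r\<in>{1..m}. (1 - u r) / fact r))) \<longlonglongrightarrow> inverse (1 + (exp 1 - 1 - (\<Sum>k. u (Suc k) / fact (Suc k))))"
    using ge by (intro tendsto_intros) auto
  then show ?thesis by (simp add: inverse_eq_divide)
qed

lemma limit_pgf_value_finite:
  assumes u: "\<And>r. r \<in> {1..R} \<Longrightarrow> u r \<in> {0..1::real}"
  shows "inverse (exp 1 - (\<Sum>k. (if Suc k \<le> R then u (Suc k) else 1) / fact (Suc k)))
     = 1 / (1 + (\<Sum>r\<in>{1..R}. (1 - u r) / fact r))"
proof -
  let ?u = "\<lambda>r. if r \<le> R then u r else 1"
  have lim: "(\<lambda>m. 1 / (1 + (\<Sum>r\<in>{1..m}. (1 - ?u r) / fact r))) \<longlonglongrightarrow> inverse (exp 1 - (\<Sum>k. ?u (Suc k) / fact (Suc k)))"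
    using u by (intro limit_pgf_value) auto
  have "(\<Sum>r\<in>{1..m}. (1 - ?u r) / fact r) = (\<Sum>r\<in>{1..R}. (1 - u r) / fact r)" if "m \<ge> R" for m
    using that by (intro sum.mono_neutral_cong_right) auto
  then have "\<forall>\<^sub>F m in sequentially. 1 / (1 + (\<Sum>r\<in>{1..m}. (1 - ?u r) / fact r)) = 1 / (1 + (\<Sum>r\<in>{1..R}. (1 - u r) / fact r))"
    unfolding eventually_sequentially by (intro exI[of _ R]) auto
  then have "(\<lambda>m. 1 / (1 + (\<Sum>r\<in>{1..m}. (1 - ?u r) / fact r))) \<longlonglongrightarrow> 1 / (1 + (\<Sum>r\<in>{1..R}. (1 - u r) / fact r))"
    by (rule tendsto_eventually)
  with lim show ?thesis by (rule LIMSEQ_unique)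
qed

text \<open>Setting \<open>u r = 1\<close> for \<open>r > R\<close> removes all but the first \<open>R\<close> factors.\<close>

lemma finite_pgf_of_limit_pgf:
  assumes pgf: "has_limit_pgf L G" and u: "\<And>r. r \<in> {1..R} \<Longrightarrow> u r \<in> {0..1::real}"
  shows "(\<integral>\<omega>. (\<Prod>r\<in>{1..R}. u r ^ G r \<omega>) \<partial>L) = 1 / (1 + (\<Sum>r\<in>{1..R}. (1 - u r) / fact r))"
proof -
  let ?u = "\<lambda>r. if r \<le> R then u r else 1"
  have "lim (\<lambda>m. \<Prod>r = 1..m. ?u r ^ G r \<omega>) = (\<Prod>r\<in>{1..R}. u r ^ G r \<omega>)" for \<omega>
  proof (rule limI, rule tendsto_eventually)
    have "(\<Prod>r = 1..m. ?u r ^ G r \<omega>) = (\<Prod>r\<in>{1..R}. u r ^ G r \<omega>)" if "m \<ge> R" for m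
      using that by (intro prod.mono_neutral_cong_right) auto
    then show "\<forall>\<^sub>F m in sequentially. (\<Prod>r = 1..m. ?u r ^ G r \<omega>) = (\<Prod>r\<in>{1..R}. u r ^ G r \<omega>)"
      unfolding eventually_sequentially by (intro exI[of _ R]) auto
  qed
  then have "(\<integral>\<omega>. (\<Prod>r\<in>{1..R}. u r ^ G r \<omega>) \<partial>L) = joint_pgf L G ?u"
    unfolding joint_pgf_def by simp
  also have "\<dots> = inverse (exp 1 - (\<Sum>k. ?u (Suc k) / fact (Suc k)))"
    using pgf u unfolding has_limit_pgf_def by auto
  also have "\<dots> = 1 / (1 + (\<Sum>r\<in>{1..R}. (1 - u r) / fact r))"
    by (rule limit_pgf_value_finite) (rule u)
  finally show ?thesis .
qed

lemma partial_products_convergent: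
  assumes u: "\<And>r. r \<ge> 1 \<Longrightarrow> 0 \<le> u r \<and> u r \<le> (1::real)"
  shows "convergent (\<lambda>m. \<Prod>r = 1..m. u r ^ g r)"
proof -
  have p: "0 \<le> (\<Prod>r = 1..m. u r ^ g r)" for m using u by (intro prod_nonneg) auto
  have d: "decseq (\<lambda>m. \<Prod>r = 1..m. u r ^ g r)"
  proof (rule decseq_SucI)
    fix m
    have "(\<Prod>r = 1..Suc m. u r ^ g r) = (\<Prod>r = 1..m. u r ^ g r) * u (Suc m) ^ g (Suc m)" by simp
    also have "\<dots> \<le> (\<Prod>r = 1..m. u r ^ g r)"
      using u[of "Suc m"] p[of m] by (intro mult_left_le power_le_one) auto
    finally show "(\<Prod>r = 1..Suc m. u r ^ g r) \<le> (\<Prod>r = 1..m. u r ^ g r)" .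
  qed
  obtain l where "(\<lambda>m. \<Prod>r = 1..m. u r ^ g r) \<longlonglongrightarrow> l"
    using decseq_convergent[OF d, of 0] p by blast
  then show ?thesis by (rule convergentI)
qed

lemma has_limit_pgf_of_finite_pgf:
  assumes L: "prob_space L" and G: "\<And>r. r \<ge> 1 \<Longrightarrow> G r \<in> measurable L (count_space UNIV)"
    and fin: "\<And>R u. (\<And>r. r \<in> {1..R} \<Longrightarrow> u r \<in> {0..1::real}) \<Longrightarrow>
      (\<integral>\<omega>. (\<Prod>r\<in>{1..R}. u r ^ G r \<omega>) \<partial>L) = 1 / (1 + (\<Sum>r\<in>{1..R}. (1 - u r) / fact r))"
  shows "has_limit_pgf L G"
  unfolding has_limit_pgf_def
proof (intro allI impI)
  fix u :: "nat \<Rightarrow> real" assume "\<forall>r\<ge>1. 0 \<le> u r \<and> u r \<le> 1"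
  then have u: "\<And>r. r \<ge> 1 \<Longrightarrow> 0 \<le> u r \<and> u r \<le> 1" by blast
  interpret prob_space L by (rule L)
  have m: "(\<lambda>\<omega>. \<Prod>r = 1..m. u r ^ G r \<omega>) \<in> borel_measurable L" for m
    by (intro borel_measurable_prod borel_measurable_nat_fun G) auto
  have conv: "(\<lambda>m. \<Prod>r = 1..m. u r ^ G r \<omega>) \<longlonglongrightarrow> lim (\<lambda>m. \<Prod>r = 1..m. u r ^ G r \<omega>)" for \<omega>
    using partial_products_convergent[of u "\<lambda>r. G r \<omega>", OF u] by (simp add: convergent_LIMSEQ_iff)
  have "(\<lambda>m. \<integral>\<omega>. (\<Prod>r = 1..m. u r ^ G r \<omega>) \<partial>L) \<longlonglongrightarrow> joint_pgf L G u"
    unfolding joint_pgf_def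
  proof (rule integral_dominated_convergence[where w = "\<lambda>_. 1"])
    show "(\<lambda>\<omega>. lim (\<lambda>m. \<Prod>r = 1..m. u r ^ G r \<omega>)) \<in> borel_measurable L"
      by (rule borel_measurable_LIMSEQ_metric[OF m conv])
    show "AE \<omega> in L. (\<lambda>m. \<Prod>r = 1..m. u r ^ G r \<omega>) \<longlonglongrightarrow> lim (\<lambda>m. \<Prod>r = 1..m. u r ^ G r \<omega>)"
      using conv by (intro AE_I2)
    have "(\<Prod>r = 1..m. u r ^ G r \<omega>) \<in> {0..1}" for m \<omega>
      using u by (auto intro!: prod_nonneg prod_le_1 power_le_one)
    then show "AE \<omega> in L. norm (\<Prod>r = 1..m. u r ^ G r \<omega>) \<le> 1" for m by (intro AE_I2) auto
  qed (use m in auto)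
  moreover have "(\<integral>\<omega>. (\<Prod>r = 1..m. u r ^ G r \<omega>) \<partial>L) = 1 / (1 + (\<Sum>r\<in>{1..m}. (1 - u r) / fact r))" for m
    using u by (intro fin) auto
  ultimately have "(\<lambda>m. 1 / (1 + (\<Sum>r\<in>{1..m}. (1 - u r) / fact r))) \<longlonglongrightarrow> joint_pgf L G u" by simp
  then show "joint_pgf L G u = inverse (exp 1 - (\<Sum>k. u (Suc k) / fact (Suc k)))"
    using limit_pgf_value[of u, OF u] by (rule LIMSEQ_unique)
qed

lemma shifted_product:
  fixes u :: "nat \<Rightarrow> real"
  shows "(\<Prod>k<R. u k ^ V (Suc k) \<omega>) = (\<Prod>r\<in>{1..R}. u (r - 1) ^ V r \<omega>)"
  by (simp add: prod.atLeast1_atMost_eq)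

text \<open>Expresses the generating function through the law alone; rounding down recovers the natural numbers from their images
under \<open>real\<close>.\<close>

lemma finite_pgf_of_law:
  assumes V: "\<And>r. r \<ge> 1 \<Longrightarrow> V r \<in> measurable N (count_space UNIV)"
  shows "(\<integral>\<omega>. (\<Prod>r\<in>{1..R}. (u r :: real) ^ V r \<omega>) \<partial>N) =
    (\<integral>x. (\<Prod>r\<in>{1..R}. u r ^ nat \<lfloor>x (r - 1)\<rfloor>) \<partial>distr N borel (real_seq V))"
proof -
  have m: "real_seq V \<in> borel_measurable N"
    unfolding real_seq_def[abs_def] using V by (intro real_sequence_measurable) auto
  have "(\<lambda>x :: nat \<Rightarrow> real. \<Prod>r\<in>{1..R}. u r ^ nat \<lfloor>x (r - 1)\<rfloor>) \<in> borel_measurable borel"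
  proof (intro borel_measurable_prod)
    fix r
    have "(\<lambda>x :: nat \<Rightarrow> real. x (r - 1)) \<in> borel_measurable borel"
      by (rule measurable_product_then_coordinatewise) simp
    then have "(\<lambda>x :: nat \<Rightarrow> real. nat \<lfloor>x (r - 1)\<rfloor>) \<in> measurable borel (count_space UNIV)" by measurable
    then show "(\<lambda>x :: nat \<Rightarrow> real. u r ^ nat \<lfloor>x (r - 1)\<rfloor>) \<in> borel_measurable borel" by (rule borel_measurable_nat_fun)
  qed
  then have "(\<integral>x. (\<Prod>r\<in>{1..R}. u r ^ nat \<lfloor>x (r - 1)\<rfloor>) \<partial>distr N borel (real_seq V)) =
     (\<integral>\<omega>. (\<Prod>r\<in>{1..R}. u r ^ nat \<lfloor>real_seq V \<omega> (r - 1)\<rfloor>) \<partial>N)"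
    by (rule integral_distr[OF m])
  also have "\<dots> = (\<integral>\<omega>. (\<Prod>r\<in>{1..R}. u r ^ V r \<omega>) \<partial>N)"
    by (intro Bochner_Integration.integral_cong prod.cong) (auto simp: real_seq_def)
  finally show ?thesis ..
qed

theorem theorem2p2:
  fixes M :: "nat \<Rightarrow> 'a measure" and C :: "nat \<Rightarrow> nat \<Rightarrow> 'a \<Rightarrow> nat"
    and d :: "nat \<Rightarrow> nat \<Rightarrow> nat"
    and L :: "'b measure" and G :: "nat \<Rightarrow> 'b \<Rightarrow> nat"
    and P :: "'c measure" and E :: "'c \<Rightarrow> real" and N :: "nat \<Rightarrow> real \<Rightarrow> 'c \<Rightarrow> nat"
  assumes coupons: "\<And>n. n \<ge> 1 \<Longrightarrow> coupon_sequence (M n) n (C n)"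
    and d_pos: "\<And>r n. r \<ge> 1 \<Longrightarrow> n \<ge> 1 \<Longrightarrow> d r n > 0"
    and d_asymp: "\<And>r. r \<ge> 1 \<Longrightarrow>
      (\<lambda>n. real (d r n) - real r * real n * ln (ln (real n))) \<in> o(\<lambda>n. real n)"
    and L: "prob_space L"
    and G: "\<And>r. r \<ge> 1 \<Longrightarrow> G r \<in> measurable L (count_space UNIV)"
  shows "(has_limit_pgf L G \<longrightarrow>
            converges_in_distribution M
              (\<lambda>n. real_seq (\<lambda>r. empty_spots n (C n) r (d r n))) L (real_seq G)) \<and>
         (exp_poisson_model P E N \<longrightarrow>
            (has_limit_pgf L G \<longleftrightarrow>
             distr L borel (real_seq G) =
             distr P borel (real_seq (\<lambda>r \<omega>. N r (E \<omega> / fact r) \<omega>))))"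
proof (intro conjI impI)
  have cc: "coupon_collector (M n) n (C n)" if "n \<ge> 1" for n
    using coupons[OF that] that by unfold_locales
  assume pgf: "has_limit_pgf L G"
  let ?X = "\<lambda>n k. empty_spots n (C n) (Suc k) (d (Suc k) n)"
  have X_meas: "?X n k \<in> measurable (M n) (count_space UNIV)" if "n \<ge> 1" for n k
    using coupon_collector.empty_spots_measurable[OF cc[OF that]] by simp
  have Mp: "prob_space (M n)" if "n \<ge> 1" for n using coupons[OF that] unfolding coupon_sequence_def by blast
  interpret pgf_convergence M ?X L "\<lambda>k. G (Suc k)"
  proof (rule pgf_convergence.intro)
    fix R and u :: "nat \<Rightarrow> real" assume u: "\<And>k. k < R \<Longrightarrow> u k \<in> {0..1}"
    have u': "u (r - 1) \<in> {0..1}" if "r \<in> {1..R}" for r using that by (intro u) auto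
    have "(\<lambda>n. \<integral>\<omega>. (\<Prod>r\<in>{1..R}. u (r - 1) ^ empty_spots n (C n) r (d r n) \<omega>) \<partial>M n)
      \<longlonglongrightarrow> 1 / (1 + (\<Sum>r\<in>{1..R}. (1 - u (r - 1)) / fact r))"
      by (rule empty_spots_pgf_limit[OF cc d_asymp u']) auto
    also have "1 / (1 + (\<Sum>r\<in>{1..R}. (1 - u (r - 1)) / fact r)) = (\<integral>\<omega>. (\<Prod>r\<in>{1..R}. u (r - 1) ^ G r \<omega>) \<partial>L)"
      by (rule finite_pgf_of_limit_pgf[OF pgf, symmetric]) (rule u')
    finally show "(\<lambda>n. \<integral>\<omega>. (\<Prod>k<R. u k ^ ?X n k \<omega>) \<partial>M n) \<longlonglongrightarrow> (\<integral>\<omega>. (\<Prod>k<R. u k ^ G (Suc k) \<omega>) \<partial>L)"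
      unfolding shifted_product[of u "\<lambda>r. empty_spots n (C n) r (d r n)" for n] shifted_product[of u G] .
  next
    show "prob_space (M n)" if "n \<ge> 1" for n by (rule Mp[OF that])
    show "?X n k \<in> measurable (M n) (count_space UNIV)" if "n \<ge> 1" for n k by (rule X_meas[OF that])
    show "prob_space L" by (rule L)
    show "G (Suc k) \<in> measurable L (count_space UNIV)" for k by (rule G) simp
  qed
  show "converges_in_distribution M (\<lambda>n. real_seq (\<lambda>r. empty_spots n (C n) r (d r n))) L (real_seq G)"
    unfolding converges_in_distribution_def real_seq_def[abs_def]
  proof (intro conjI allI impI)
    show "\<forall>\<^sub>F n in sequentially. (\<lambda>\<omega> k. real (?X n k \<omega>)) \<in> borel_measurable (M n)"
      using eventually_ge_at_top[of 1] by eventually_elim (intro real_sequence_measurable X_meas)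
    show "(\<lambda>\<omega> k. real (G (Suc k) \<omega>)) \<in> borel_measurable L"
      by (intro real_sequence_measurable G) simp
    show "(\<lambda>n. \<integral>\<omega>. f (\<lambda>k. real (?X n k \<omega>)) \<partial>M n) \<longlonglongrightarrow> (\<integral>\<omega>. f (\<lambda>k. real (G (Suc k) \<omega>)) \<partial>L)"
      if "continuous_on UNIV f" "bounded (range f)" for f :: "(nat \<Rightarrow> real) \<Rightarrow> real"
      using that by (rule convergence_in_distribution)
  qed
next
  assume model: "exp_poisson_model P E N"
  interpret exp_poisson P E N using model by unfold_locales
  let ?H = "\<lambda>r \<omega>. N r (E \<omega> / fact r) \<omega>"
  show "has_limit_pgf L G \<longleftrightarrow> distr L borel (real_seq G) = distr P borel (real_seq ?H)"
  proof
    assume pgf: "has_limit_pgf L G"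
    show "distr L borel (real_seq G) = distr P borel (real_seq ?H)"
      unfolding real_seq_def[abs_def]
    proof (rule equal_pgfs_imp_equal_laws[OF L prob_space_axioms])
      fix R and u :: "nat \<Rightarrow> real" assume u: "\<And>k. k < R \<Longrightarrow> u k \<in> {0..1}"
      have u': "u (r - 1) \<in> {0..1}" if "r \<in> {1..R}" for r using that by (intro u) auto
      have "(\<integral>\<omega>. (\<Prod>r\<in>{1..R}. u (r - 1) ^ G r \<omega>) \<partial>L) = (\<integral>\<omega>. (\<Prod>r\<in>{1..R}. u (r - 1) ^ ?H r \<omega>) \<partial>P)"
        using finite_pgf_of_limit_pgf[OF pgf, of R "\<lambda>r. u (r - 1)", OF u'] finite_pgf[of R "\<lambda>r. u (r - 1)", OF u'] by simp
      then show "(\<integral>\<omega>. (\<Prod>k<R. u k ^ G (Suc k) \<omega>) \<partial>L) = (\<integral>\<omega>. (\<Prod>k<R. u k ^ ?H (Suc k) \<omega>) \<partial>P)"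
        unfolding shifted_product[of u G] shifted_product[of u ?H] .
    next
      show "G (Suc k) \<in> measurable L (count_space UNIV)" for k by (rule G) simp
      show "?H (Suc k) \<in> measurable P (count_space UNIV)" for k by (rule N_E_measurable) simp
    qed
  next
    assume law: "distr L borel (real_seq G) = distr P borel (real_seq ?H)"
    show "has_limit_pgf L G"
    proof (rule has_limit_pgf_of_finite_pgf[OF L G])
      fix R and u :: "nat \<Rightarrow> real" assume u: "\<And>r. r \<in> {1..R} \<Longrightarrow> u r \<in> {0..1}"
      have "(\<integral>\<omega>. (\<Prod>r\<in>{1..R}. u r ^ G r \<omega>) \<partial>L) = (\<integral>\<omega>. (\<Prod>r\<in>{1..R}. u r ^ ?H r \<omega>) \<partial>P)"
      proof -
        have "(\<integral>\<omega>. (\<Prod>r\<in>{1..R}. u r ^ G r \<omega>) \<partial>L) =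
          (\<integral>x. (\<Prod>r\<in>{1..R}. u r ^ nat \<lfloor>x (r - 1)\<rfloor>) \<partial>distr L borel (real_seq G))"
          by (rule finite_pgf_of_law) (rule G)
        also have "\<dots> = (\<integral>\<omega>. (\<Prod>r\<in>{1..R}. u r ^ ?H r \<omega>) \<partial>P)"
          unfolding law by (rule finite_pgf_of_law[symmetric]) (rule N_E_measurable)
        finally show ?thesis .
      qed
      then show "(\<integral>\<omega>. (\<Prod>r\<in>{1..R}. u r ^ G r \<omega>) \<partial>L) = 1 / (1 + (\<Sum>r\<in>{1..R}. (1 - u r) / fact r))"
        using finite_pgf[of R u, OF u] by simp
    qed auto
  qed
qed

end
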